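(* Let $k$ be a field of characteristic zero, let $f\colon X\to Y$ be a morphism between essentially finite groupoids, and let $V\colon X\to\mathit{Vect}$ be a representation of $X$ in finite-dimensional $k$-vector spaces. For $x\in X$ let $f(A_x)$ be the image of $A_x$ in $A_{fx}$, and denote by $K_x$ the kernel of the induced map $A_x\xrightarrow{f}A_{fx}$. Then: (1) The map $\gamma_f$ at $y\in Y$, $$\gamma_{f,y}\colon\bigoplus_{x\mid fx=y}\mathrm{Hom}_{k[A_x]}(k[A_y],V(x))\to\bigoplus_{x\mid fx=y}k[A_y]\otimes_{k[A_x]}V(x),$$ is induced by the assignments $$\mathrm{Hom}_{k[A_x]}(k[A_y],V(x))\ni\phi_x\mapsto\frac{1}{|f(A_x)|}\sum_{g\in A_y}g^{-1}\otimes\phi_x(g).$$ (2) The map $\delta_f\colon f_!V(y)\to f_!V(y)$ at $y$ is given at each summand by multiplication by $|K_x|$. (3) The Nakayama map $\nu_f$ at $y$ is induced at each summand by the map $$\phi_x\mapsto\frac{1}{|A_x|}\sum_{g\in A_y}g^{-1}\otimes\phi_x(g).$$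
   Context: A groupoid is essentially finite if it has finitely many isomorphism classes of objects and all hom-sets are finite. Every essentially finite groupoid considered here is assumed (up to equivalence) to have no morphisms between distinct objects; $A_x$ denotes the automorphism group of an object $x$. $\mathit{Vect}$ is the symmetric monoidal category of finite-dimensional vector spaces over $k$. For a groupoid $X$, $\mathit{Vect}^X$ is the category of functors $X\to\mathit{Vect}$ with pointwise tensor product. For $f\colon X\to Y$, $f^*\colon\mathit{Vect}^Y\to\mathit{Vect}^X$ is restriction, with left adjoint $f_!$ and right adjoint $f_*$ (Kan extensions). These are presented as follows. $f_!V(y)=\bigoplus_{x\mid fx=y}k[A_y]\otimes_{k[A_x]}V(x)$, with unit $V(x)\to f^*f_!V(x)$, $v\mapsto 1\otimes v$, and counit $f_!f^*W(y)\to W(y)$ induced by $g\otimes w\mapsto gw$. $f_*V(y)=\bigoplus_{x\mid fx=y}\mathrm{Hom}_{k[A_x]}(k[A_y],V(x))$, with unit $W(y)\to f_*f^*W(y)$, $w\mapsto\sum_{x\mid fx=y}\phi_{w,x}$, where $\phi_{w,x}(g)=gw$, and counit $f^*f_*V(x)\to V(x)$, $\sum_{x'\mid fx'=fx}\phi_{x'}\mapsto\phi_x(1)$. For any strong symmetric monoidal functor $f^*\colon\mathcal{A}\to\mathcal{B}$ between symmetric monoidal categories in which all objects are dualizable, with left adjoint $f_!$ and right adjoint $f_*$, with units $\eta_!\colon \mathrm{id}\to f^*f_!$, $\eta_*\colon\mathrm{id}\to f_*f^*$ and counits $\epsilon_!\colon f_!f^*\to\mathrm{id}$, $\epsilon_*\colon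 f^*f_*\to\mathrm{id}$, set $\lambda\colon f_!(A\otimes f^*B)\xrightarrow{f_!(\eta_!\otimes \mathrm{id})}f_!(f^*f_!A\otimes f^*B)\cong f_!f^*(f_!A\otimes B)\xrightarrow{\epsilon_!}f_!A\otimes B$ and $\rho\colon A\otimes f_*B\xrightarrow{\eta_*}f_*f^*(A\otimes f_*B)\cong f_*(f^*A\otimes f^*f_*B)\xrightarrow{f_*(\mathrm{id}\otimes\epsilon_* )}f_*(f^*A\otimes B)$; both are isomorphisms. The pre-Nakayama map $\gamma_f\colon f_*\to f_!$ is $f_*A\cong f_*(A\otimes 1)\xrightarrow{f_*(\eta_!\otimes \mathrm{id})}f_*(f^*f_!A\otimes 1)\xrightarrow{\rho^{-1}}f_!A\otimes f_*1\xrightarrow{\lambda^{-1}}f_!(A\otimes f^*f_*1)\xrightarrow{f_!(\mathrm{id}\otimes\epsilon_* )}f_!(A\otimes 1)\cong f_!A$. For $f\colon X\to Y$ a map of essentially finite groupoids, let $p\colon P_y\to X$ be the homotopy fibre of $f$ at $y$, so that $f_!V(y)=\operatorname{colim}_{P_y}p^*V$. On each connected component $\hat P$ of $P_y$ the essentially unique map $\iota\colon\{*\}\to\hat P$ gives an endomorphism $1\xrightarrow{\eta_*}\iota_*\iota^*1\xrightarrow{\gamma_\iota}\iota_!\iota^*1\xrightarrow{\epsilon_!}1$ of the unit of $\mathit{Vect}^{\hat P}$; together these define an endomorphism $\delta_f$ of $1$ on $P_y$, hence by tensoring an endomorphism $\delta_f$ of $p^*V$ and an induced endomorphism (also written $\delta_f$)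 of $f_!V(y)$. The Nakayama map is $\nu_f\colon f_*V\xrightarrow{\gamma_f}f_!V\xrightarrow{f_!\delta_f^{-1}}f_!V$. *)

theory Defs
  imports "HOL-Algebra.AbelCoset" "HOL-Algebra.Module"
begin

section \<open>Linear algebra over a field \<open>K\<close>, with carriers\<close>

text \<open>Vector spaces are HOL-Algebra modules over \<open>K\<close>. The fields \<open>mult\<close> and \<open>one\<close> of the module
  record are only meaningful for \<open>self_module\<close> and \<open>group_algebra\<close>.\<close>

definition lin_maps ::
  "('k,'r) ring_scheme \<Rightarrow> ('k,'v) module \<Rightarrow> ('k,'w) module \<Rightarrow> ('v \<Rightarrow> 'w) set" where
  "lin_maps K M N = {h \<in> carrier M \<rightarrow> carrier N.
     (\<forall>u\<in>carrier M. \<forall>v\<in>carrier M. h (u \<oplus>\<^bsub>M\<^esub> v) = h u \<oplus>\<^bsub>N\<^esub> h v) \<and>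
     (\<forall>c\<in>carrier K. \<forall>v\<in>carrier M. h (c \<odot>\<^bsub>M\<^esub> v) = c \<odot>\<^bsub>N\<^esub> h v)}"

definition mspan :: "('k,'r) ring_scheme \<Rightarrow> ('k,'v) module \<Rightarrow> 'v set \<Rightarrow> 'v set" where
  "mspan K M S = \<Inter>{N. submodule N K M \<and> S \<subseteq> N}"

definition fin_dim :: "('k,'r) ring_scheme \<Rightarrow> ('k,'v) module \<Rightarrow> bool" where
  "fin_dim K M \<longleftrightarrow> (\<exists>B. finite B \<and> B \<subseteq> carrier M \<and> carrier M = mspan K M B)"

definition self_module :: "('k,'r) ring_scheme \<Rightarrow> ('k,'k) module" where
  "self_module K = \<lparr>carrier = carrier K, mult = mult K, one = one K,
     zero = zero K, add = add K, smult = mult K\<rparr>"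

text \<open>The free module on \<open>S\<close>: finitely supported functions, extended by zero outside \<open>S\<close>.\<close>

definition free_module :: "('k,'r) ring_scheme \<Rightarrow> 's set \<Rightarrow> ('k,'s \<Rightarrow> 'k) module" where
  "free_module K S = \<lparr>
     carrier = {u. (\<forall>s. u s \<in> carrier K) \<and> finite {s. u s \<noteq> \<zero>\<^bsub>K\<^esub>} \<and> {s. u s \<noteq> \<zero>\<^bsub>K\<^esub>} \<subseteq> S},
     mult = undefined, one = undefined,
     zero = (\<lambda>s. \<zero>\<^bsub>K\<^esub>),
     add = (\<lambda>u v s. u s \<oplus>\<^bsub>K\<^esub> v s),
     smult = (\<lambda>c u s. c \<otimes>\<^bsub>K\<^esub> u s)\<rparr>"

definition basis_elt :: "('k,'r) ring_scheme \<Rightarrow> 's \<Rightarrow> 's \<Rightarrow> 'k" where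
  "basis_elt K s = (\<lambda>t. if t = s then \<one>\<^bsub>K\<^esub> else \<zero>\<^bsub>K\<^esub>)"

definition quot_module :: "('k,'v) module \<Rightarrow> 'v set \<Rightarrow> ('k,'v set) module" where
  "quot_module M N = \<lparr>
     carrier = a_rcosets\<^bsub>M\<^esub> N,
     mult = undefined, one = undefined,
     zero = N,
     add = set_add M,
     smult = (\<lambda>c U. \<Union>u\<in>U. N +>\<^bsub>M\<^esub> (c \<odot>\<^bsub>M\<^esub> u))\<rparr>"

text \<open>Direct sum of a family indexed by a \<^emph>\<open>finite\<close> set \<open>I\<close>, as a product.\<close>

definition dsum :: "'i set \<Rightarrow> ('i \<Rightarrow> ('k,'v) module) \<Rightarrow> ('k,'i \<Rightarrow> 'v) module" where
  "dsum I M = \<lparr>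
     carrier = (\<Pi>\<^sub>E i\<in>I. carrier (M i)),
     mult = undefined, one = undefined,
     zero = (\<lambda>i\<in>I. \<zero>\<^bsub>M i\<^esub>),
     add = (\<lambda>u v. \<lambda>i\<in>I. u i \<oplus>\<^bsub>M i\<^esub> v i),
     smult = (\<lambda>c u. \<lambda>i\<in>I. c \<odot>\<^bsub>M i\<^esub> u i)\<rparr>"

subsection \<open>Tensor products\<close>

text \<open>\<open>M \<otimes>\<^sub>R N\<close> for a \<open>K\<close>-algebra \<open>R\<close> with underlying set \<open>R\<close>, acting on the right of \<open>M\<close> by
  \<open>ract\<close> and on the left of \<open>N\<close> by \<open>lact\<close>: the free \<open>K\<close>-module on \<open>M \<times> N\<close> modulo the
  \<open>K\<close>-bilinear and \<open>R\<close>-balanced relations.\<close>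

definition tensor_rel ::
  "('k,'r) ring_scheme \<Rightarrow> ('k,'m) module \<Rightarrow> ('k,'n) module \<Rightarrow>
   'a set \<Rightarrow> ('m \<Rightarrow> 'a \<Rightarrow> 'm) \<Rightarrow> ('a \<Rightarrow> 'n \<Rightarrow> 'n) \<Rightarrow> ('m \<times> 'n \<Rightarrow> 'k) set" where
  "tensor_rel K M N R ract lact =
     (let F = free_module K (carrier M \<times> carrier N) in
      mspan K F
       ({basis_elt K (m \<oplus>\<^bsub>M\<^esub> m', n) \<ominus>\<^bsub>F\<^esub> (basis_elt K (m, n) \<oplus>\<^bsub>F\<^esub> basis_elt K (m', n)) | m m' n.
            m \<in> carrier M \<and> m' \<in> carrier M \<and> n \<in> carrier N}
      \<union> {basis_elt K (m, n \<oplus>\<^bsub>N\<^esub> n') \<ominus>\<^bsub>F\<^esub> (basis_elt K (m, n) \<oplus>\<^bsub>F\<^esub> basis_elt K (m, n')) | m n n'.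
            m \<in> carrier M \<and> n \<in> carrier N \<and> n' \<in> carrier N}
      \<union> {basis_elt K (c \<odot>\<^bsub>M\<^esub> m, n) \<ominus>\<^bsub>F\<^esub> c \<odot>\<^bsub>F\<^esub> basis_elt K (m, n) | c m n.
            c \<in> carrier K \<and> m \<in> carrier M \<and> n \<in> carrier N}
      \<union> {basis_elt K (m, c \<odot>\<^bsub>N\<^esub> n) \<ominus>\<^bsub>F\<^esub> c \<odot>\<^bsub>F\<^esub> basis_elt K (m, n) | c m n.
            c \<in> carrier K \<and> m \<in> carrier M \<and> n \<in> carrier N}
      \<union> {basis_elt K (ract m r, n) \<ominus>\<^bsub>F\<^esub> basis_elt K (m, lact r n) | m r n.
            m \<in> carrier M \<and> r \<in> R \<and> n \<in> carrier N}))"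

definition tensor_over ::
  "('k,'r) ring_scheme \<Rightarrow> ('k,'m) module \<Rightarrow> ('k,'n) module \<Rightarrow>
   'a set \<Rightarrow> ('m \<Rightarrow> 'a \<Rightarrow> 'm) \<Rightarrow> ('a \<Rightarrow> 'n \<Rightarrow> 'n) \<Rightarrow> ('k, ('m \<times> 'n \<Rightarrow> 'k) set) module" where
  "tensor_over K M N R ract lact =
     quot_module (free_module K (carrier M \<times> carrier N)) (tensor_rel K M N R ract lact)"

definition pure_over ::
  "('k,'r) ring_scheme \<Rightarrow> ('k,'m) module \<Rightarrow> ('k,'n) module \<Rightarrow>
   'a set \<Rightarrow> ('m \<Rightarrow> 'a \<Rightarrow> 'm) \<Rightarrow> ('a \<Rightarrow> 'n \<Rightarrow> 'n) \<Rightarrow> 'm \<Rightarrow> 'n \<Rightarrow> ('m \<times> 'n \<Rightarrow> 'k) set" where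
  "pure_over K M N R ract lact m n =
     tensor_rel K M N R ract lact +>\<^bsub>free_module K (carrier M \<times> carrier N)\<^esub> basis_elt K (m, n)"

text \<open>The map into \<open>P\<close> out of a tensor product that is induced by \<open>m \<otimes> n \<mapsto> \<beta> m n\<close>: the linear
  extension of \<open>\<beta>\<close> takes a single value on each coset.\<close>

definition tensor_lift ::
  "('k,'r) ring_scheme \<Rightarrow> ('k,'p) module \<Rightarrow> ('m \<Rightarrow> 'n \<Rightarrow> 'p) \<Rightarrow> ('m \<times> 'n \<Rightarrow> 'k) set \<Rightarrow> 'p" where
  "tensor_lift K P \<beta> U =
     the_elem ((\<lambda>u. \<Oplus>\<^bsub>P\<^esub>s\<in>{s. u s \<noteq> \<zero>\<^bsub>K\<^esub>}. u s \<odot>\<^bsub>P\<^esub> \<beta> (fst s) (snd s)) ` U)"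

definition tensor ::
  "('k,'r) ring_scheme \<Rightarrow> ('k,'m) module \<Rightarrow> ('k,'n) module \<Rightarrow> ('k, ('m \<times> 'n \<Rightarrow> 'k) set) module" where
  "tensor K M N = tensor_over K M N (carrier K) (\<lambda>m c. c \<odot>\<^bsub>M\<^esub> m) (\<lambda>c n. c \<odot>\<^bsub>N\<^esub> n)"

definition pure_tensor ::
  "('k,'r) ring_scheme \<Rightarrow> ('k,'m) module \<Rightarrow> ('k,'n) module \<Rightarrow> 'm \<Rightarrow> 'n \<Rightarrow> ('m \<times> 'n \<Rightarrow> 'k) set" where
  "pure_tensor K M N = pure_over K M N (carrier K) (\<lambda>m c. c \<odot>\<^bsub>M\<^esub> m) (\<lambda>c n. c \<odot>\<^bsub>N\<^esub> n)"

text \<open>\<open>\<phi> \<otimes> \<psi>\<close>; the modules \<open>M\<close>, \<open>N\<close> are the targets of \<open>\<phi>\<close>, \<open>\<psi>\<close>.\<close>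

definition tensor_map ::
  "('k,'r) ring_scheme \<Rightarrow> ('k,'m) module \<Rightarrow> ('k,'n) module \<Rightarrow> ('a \<Rightarrow> 'm) \<Rightarrow> ('b \<Rightarrow> 'n) \<Rightarrow>
   ('a \<times> 'b \<Rightarrow> 'k) set \<Rightarrow> ('m \<times> 'n \<Rightarrow> 'k) set" where
  "tensor_map K M N \<phi> \<psi> = tensor_lift K (tensor K M N) (\<lambda>a b. pure_tensor K M N (\<phi> a) (\<psi> b))"

definition unitor_l :: "('k,'r) ring_scheme \<Rightarrow> ('k,'v) module \<Rightarrow> ('k \<times> 'v \<Rightarrow> 'k) set \<Rightarrow> 'v" where
  "unitor_l K M = tensor_lift K M (\<lambda>c v. c \<odot>\<^bsub>M\<^esub> v)"

definition unitor_l_inv :: "('k,'r) ring_scheme \<Rightarrow> ('k,'v) module \<Rightarrow> 'v \<Rightarrow> ('k \<times> 'v \<Rightarrow> 'k) set" where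
  "unitor_l_inv K M v = pure_tensor K (self_module K) M \<one>\<^bsub>K\<^esub> v"

definition unitor_r :: "('k,'r) ring_scheme \<Rightarrow> ('k,'v) module \<Rightarrow> ('v \<times> 'k \<Rightarrow> 'k) set \<Rightarrow> 'v" where
  "unitor_r K M = tensor_lift K M (\<lambda>v c. c \<odot>\<^bsub>M\<^esub> v)"

definition unitor_r_inv :: "('k,'r) ring_scheme \<Rightarrow> ('k,'v) module \<Rightarrow> 'v \<Rightarrow> ('v \<times> 'k \<Rightarrow> 'k) set" where
  "unitor_r_inv K M v = pure_tensor K M (self_module K) v \<one>\<^bsub>K\<^esub>"

subsection \<open>Group algebras of finite groups\<close>

definition group_algebra ::
  "('k,'r) ring_scheme \<Rightarrow> ('g,'s) monoid_scheme \<Rightarrow> ('k,'g \<Rightarrow> 'k) module" where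
  "group_algebra K G = (free_module K (carrier G))\<lparr>
     mult := (\<lambda>r s c. \<Oplus>\<^bsub>K\<^esub>p\<in>{p \<in> carrier G \<times> carrier G. fst p \<otimes>\<^bsub>G\<^esub> snd p = c}.
                 r (fst p) \<otimes>\<^bsub>K\<^esub> s (snd p)),
     one := basis_elt K \<one>\<^bsub>G\<^esub>\<rparr>"

text \<open>The homomorphism \<open>k[G] \<rightarrow> k[H]\<close> induced by a homomorphism \<open>h: G \<rightarrow> H\<close>.\<close>

definition group_algebra_map ::
  "('k,'r) ring_scheme \<Rightarrow> ('g,'s) monoid_scheme \<Rightarrow> ('g \<Rightarrow> 'h) \<Rightarrow> ('g \<Rightarrow> 'k) \<Rightarrow> 'h \<Rightarrow> 'k" where
  "group_algebra_map K G h r = (\<lambda>b. \<Oplus>\<^bsub>K\<^esub>a\<in>{a \<in> carrier G. h a = b}. r a)"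

definition group_algebra_act ::
  "('g,'s) monoid_scheme \<Rightarrow> ('k,'v) module \<Rightarrow> ('g \<Rightarrow> 'v \<Rightarrow> 'v) \<Rightarrow> ('g \<Rightarrow> 'k) \<Rightarrow> 'v \<Rightarrow> 'v" where
  "group_algebra_act G M \<sigma> r v = (\<Oplus>\<^bsub>M\<^esub>g\<in>carrier G. r g \<odot>\<^bsub>M\<^esub> \<sigma> g v)"

section \<open>Groupoids\<close>

record ('o,'a) groupoid_data =
  objs :: "'o set"
  arrs :: "'a set"
  src :: "'a \<Rightarrow> 'o"
  tgt :: "'a \<Rightarrow> 'o"
  cmp :: "'a \<Rightarrow> 'a \<Rightarrow> 'a"  \<comment> \<open>\<open>cmp G b a\<close> is \<open>b \<circ> a\<close>\<close>
  idn :: "'o \<Rightarrow> 'a"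

definition homs :: "('o,'a) groupoid_data \<Rightarrow> 'o \<Rightarrow> 'o \<Rightarrow> 'a set" where
  "homs G x y = {a \<in> arrs G. src G a = x \<and> tgt G a = y}"

locale groupoid =
  fixes G :: "('o,'a) groupoid_data"
  assumes src_obj: "a \<in> arrs G \<Longrightarrow> src G a \<in> objs G"
    and tgt_obj: "a \<in> arrs G \<Longrightarrow> tgt G a \<in> objs G"
    and idn_hom: "x \<in> objs G \<Longrightarrow> idn G x \<in> homs G x x"
    and cmp_hom: "\<lbrakk>a \<in> homs G x y; b \<in> homs G y z\<rbrakk> \<Longrightarrow> cmp G b a \<in> homs G x z"
    and cmp_assoc: "\<lbrakk>a \<in> homs G x y; b \<in> homs G y z; c \<in> homs G z w\<rbrakk> \<Longrightarrow>
          cmp G c (cmp G b a) = cmp G (cmp G c b) a"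
    and cmp_idn_right: "a \<in> homs G x y \<Longrightarrow> cmp G a (idn G x) = a"
    and cmp_idn_left: "a \<in> homs G x y \<Longrightarrow> cmp G (idn G y) a = a"
    and inverse: "a \<in> homs G x y \<Longrightarrow>
          \<exists>b\<in>homs G y x. cmp G b a = idn G x \<and> cmp G a b = idn G y"

text \<open>The objects isomorphic to \<open>x\<close>, which form the connected component of \<open>x\<close>.\<close>

definition iso_class :: "('o,'a) groupoid_data \<Rightarrow> 'o \<Rightarrow> 'o set" where
  "iso_class G x = {y \<in> objs G. homs G x y \<noteq> {}}"

locale ess_finite_groupoid = groupoid +
  assumes finite_iso_classes: "finite (iso_class G ` objs G)"
    and finite_homs: "\<lbrakk>x \<in> objs G; y \<in> objs G\<rbrakk> \<Longrightarrow> finite (homs G x y)"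

text \<open>No morphisms between distinct objects.\<close>

definition skeletal :: "('o,'a) groupoid_data \<Rightarrow> bool" where
  "skeletal G \<longleftrightarrow> (\<forall>a\<in>arrs G. src G a = tgt G a)"

definition aut_group :: "('o,'a) groupoid_data \<Rightarrow> 'o \<Rightarrow> 'a monoid" where
  "aut_group G x = \<lparr>carrier = homs G x x, mult = cmp G, one = idn G x\<rparr>"

record ('x,'a,'y,'b) gmap =
  fobj :: "'x \<Rightarrow> 'y"
  farr :: "'a \<Rightarrow> 'b"

locale groupoid_map = X: groupoid X + Y: groupoid Y
  for X :: "('x,'a) groupoid_data" and Y :: "('y,'b) groupoid_data" +
  fixes f :: "('x,'a,'y,'b) gmap"
  assumes fobj: "x \<in> objs X \<Longrightarrow> fobj f x \<in> objs Y"
    and farr: "a \<in> homs X x x' \<Longrightarrow> farr f a \<in> homs Y (fobj f x) (fobj f x')"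
    and farr_idn: "x \<in> objs X \<Longrightarrow> farr f (idn X x) = idn Y (fobj f x)"
    and farr_cmp: "\<lbrakk>a \<in> homs X x x'; b \<in> homs X x' x''\<rbrakk> \<Longrightarrow>
          farr f (cmp X b a) = cmp Y (farr f b) (farr f a)"

definition point_groupoid :: "(unit,unit) groupoid_data" where
  "point_groupoid = \<lparr>objs = {()}, arrs = {()}, src = (\<lambda>_. ()), tgt = (\<lambda>_. ()),
     cmp = (\<lambda>_ _. ()), idn = (\<lambda>_. ())\<rparr>"

definition point_map :: "('o,'a) groupoid_data \<Rightarrow> 'o \<Rightarrow> (unit,unit,'o,'a) gmap" where
  "point_map G q = \<lparr>fobj = (\<lambda>_. q), farr = (\<lambda>_. idn G q)\<rparr>"

definition full_sub :: "('o,'a) groupoid_data \<Rightarrow> 'o set \<Rightarrow> ('o,'a) groupoid_data" where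
  "full_sub G S = G\<lparr>objs := objs G \<inter> S, arrs := {a \<in> arrs G. src G a \<in> S \<and> tgt G a \<in> S}\<rparr>"

text \<open>The homotopy fibre \<open>P\<^sub>y\<close>: objects are pairs \<open>(x, h: f x \<rightarrow> y)\<close>, and a morphism
  \<open>(x, h) \<rightarrow> (x', h')\<close> is an \<open>a: x \<rightarrow> x'\<close> with \<open>h' \<circ> f a = h\<close>. The projection to \<open>X\<close> is
  \<open>fst\<close> on objects.\<close>

definition hfib ::
  "('x,'a) groupoid_data \<Rightarrow> ('y,'b) groupoid_data \<Rightarrow> ('x,'a,'y,'b) gmap \<Rightarrow> 'y \<Rightarrow>
   ('x \<times> 'b, ('x \<times> 'b) \<times> 'a \<times> ('x \<times> 'b)) groupoid_data" where
  "hfib X Y f y =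
     (let Ob = {(x, h). x \<in> objs X \<and> h \<in> homs Y (fobj f x) y} in
      \<lparr>objs = Ob,
       arrs = {(p, a, q). p \<in> Ob \<and> q \<in> Ob \<and> a \<in> homs X (fst p) (fst q) \<and>
                 cmp Y (snd q) (farr f a) = snd p},
       src = (\<lambda>(p, a, q). p),
       tgt = (\<lambda>(p, a, q). q),
       cmp = (\<lambda>(q', b, r) (p, a, q). (p, cmp X b a, r)),
       idn = (\<lambda>p. (p, idn X (fst p), p))\<rparr>)"

section \<open>Representations of groupoids\<close>

record ('x,'a,'k,'v) rep =
  ob :: "'x \<Rightarrow> ('k,'v) module"
  act :: "'a \<Rightarrow> 'v \<Rightarrow> 'v"

text \<open>Functors from \<open>X\<close> to finite-dimensional vector spaces.\<close>

locale vect_rep = groupoid X for X :: "('x,'a) groupoid_data" +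
  fixes K :: "('k,'r) ring_scheme" and V :: "('x,'a,'k,'v) rep"
  assumes ob_module: "x \<in> objs X \<Longrightarrow> module K (ob V x)"
    and ob_fin_dim: "x \<in> objs X \<Longrightarrow> fin_dim K (ob V x)"
    and act_lin: "a \<in> homs X x x' \<Longrightarrow> act V a \<in> lin_maps K (ob V x) (ob V x')"
    and act_idn: "\<lbrakk>x \<in> objs X; v \<in> carrier (ob V x)\<rbrakk> \<Longrightarrow> act V (idn X x) v = v"
    and act_cmp: "\<lbrakk>a \<in> homs X x x'; b \<in> homs X x' x''; v \<in> carrier (ob V x)\<rbrakk> \<Longrightarrow>
          act V (cmp X b a) v = act V b (act V a v)"

definition unit_rep :: "('k,'r) ring_scheme \<Rightarrow> ('x,'a,'k,'k) rep" where
  "unit_rep K = \<lparr>ob = (\<lambda>_. self_module K), act = (\<lambda>_ c. c)\<rparr>"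

definition tensor_rep ::
  "('k,'r) ring_scheme \<Rightarrow> ('x,'a) groupoid_data \<Rightarrow> ('x,'a,'k,'v) rep \<Rightarrow> ('x,'a,'k,'w) rep \<Rightarrow>
   ('x,'a,'k,('v \<times> 'w \<Rightarrow> 'k) set) rep" where
  "tensor_rep K X A B = \<lparr>
     ob = (\<lambda>x. tensor K (ob A x) (ob B x)),
     act = (\<lambda>a. tensor_map K (ob A (tgt X a)) (ob B (tgt X a)) (act A a) (act B a))\<rparr>"

text \<open>Restriction \<open>f\<^sup>*\<close>. It is strictly compatible with \<open>unit_rep\<close> and \<open>tensor_rep\<close>, so its
  monoidal structure maps are identities and do not appear below.\<close>

definition pullback :: "('x,'a,'y,'b) gmap \<Rightarrow> ('y,'b,'k,'v) rep \<Rightarrow> ('x,'a,'k,'v) rep" where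
  "pullback f W = \<lparr>ob = (\<lambda>x. ob W (fobj f x)), act = (\<lambda>a. act W (farr f a))\<rparr>"

text \<open>From here on \<open>X\<close> and \<open>Y\<close> are essentially finite and skeletal. Morphisms of representations
  are families of linear maps, indexed by objects.\<close>

definition obj_fibre :: "('x,'a) groupoid_data \<Rightarrow> ('x,'a,'y,'b) gmap \<Rightarrow> 'y \<Rightarrow> 'x set" where
  "obj_fibre X f y = {x \<in> objs X. fobj f x = y}"

abbreviation aut_alg ::
  "('k,'r) ring_scheme \<Rightarrow> ('o,'a) groupoid_data \<Rightarrow> 'o \<Rightarrow> ('k,'a \<Rightarrow> 'k) module" where
  "aut_alg K G x \<equiv> group_algebra K (aut_group G x)"

subsection \<open>The left adjoint \<open>f\<^sub>!\<close>\<close>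

text \<open>The summand \<open>k[A\<^bsub>fx\<^esub>] \<otimes>\<^bsub>k[A\<^bsub>x\<^esub>]\<^esub> V(x)\<close>, and its element \<open>r \<otimes> v\<close>.\<close>

definition ind_summand ::
  "('k,'r) ring_scheme \<Rightarrow> ('x,'a) groupoid_data \<Rightarrow> ('y,'b) groupoid_data \<Rightarrow> ('x,'a,'y,'b) gmap \<Rightarrow>
   ('x,'a,'k,'v) rep \<Rightarrow> 'x \<Rightarrow> ('k, (('b \<Rightarrow> 'k) \<times> 'v \<Rightarrow> 'k) set) module" where
  "ind_summand K X Y f V x =
     tensor_over K (aut_alg K Y (fobj f x)) (ob V x) (carrier (aut_alg K X x))
       (\<lambda>r s. r \<otimes>\<^bsub>aut_alg K Y (fobj f x)\<^esub> group_algebra_map K (aut_group X x) (farr f) s)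
       (group_algebra_act (aut_group X x) (ob V x) (act V))"

definition ind_pure ::
  "('k,'r) ring_scheme \<Rightarrow> ('x,'a) groupoid_data \<Rightarrow> ('y,'b) groupoid_data \<Rightarrow> ('x,'a,'y,'b) gmap \<Rightarrow>
   ('x,'a,'k,'v) rep \<Rightarrow> 'x \<Rightarrow> ('b \<Rightarrow> 'k) \<Rightarrow> 'v \<Rightarrow> (('b \<Rightarrow> 'k) \<times> 'v \<Rightarrow> 'k) set" where
  "ind_pure K X Y f V x =
     pure_over K (aut_alg K Y (fobj f x)) (ob V x) (carrier (aut_alg K X x))
       (\<lambda>r s. r \<otimes>\<^bsub>aut_alg K Y (fobj f x)\<^esub> group_algebra_map K (aut_group X x) (farr f) s)
       (group_algebra_act (aut_group X x) (ob V x) (act V))"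

definition left_kan ::
  "('k,'r) ring_scheme \<Rightarrow> ('x,'a) groupoid_data \<Rightarrow> ('y,'b) groupoid_data \<Rightarrow> ('x,'a,'y,'b) gmap \<Rightarrow>
   ('x,'a,'k,'v) rep \<Rightarrow> ('y,'b,'k,'x \<Rightarrow> (('b \<Rightarrow> 'k) \<times> 'v \<Rightarrow> 'k) set) rep" where
  "left_kan K X Y f V = \<lparr>
     ob = (\<lambda>y. dsum (obj_fibre X f y) (ind_summand K X Y f V)),
     act = (\<lambda>b t. \<lambda>x\<in>obj_fibre X f (tgt Y b).
        tensor_lift K (ind_summand K X Y f V x)
          (\<lambda>r v. ind_pure K X Y f V x (basis_elt K b \<otimes>\<^bsub>aut_alg K Y (fobj f x)\<^esub> r) v) (t x))\<rparr>"

text \<open>\<open>r \<otimes> v\<close> in the summand \<open>x\<close> of \<open>f\<^sub>!V(fx)\<close>.\<close>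

definition lan_inj ::
  "('k,'r) ring_scheme \<Rightarrow> ('x,'a) groupoid_data \<Rightarrow> ('y,'b) groupoid_data \<Rightarrow> ('x,'a,'y,'b) gmap \<Rightarrow>
   ('x,'a,'k,'v) rep \<Rightarrow> 'x \<Rightarrow> ('b \<Rightarrow> 'k) \<Rightarrow> 'v \<Rightarrow> ('x \<Rightarrow> (('b \<Rightarrow> 'k) \<times> 'v \<Rightarrow> 'k) set)" where
  "lan_inj K X Y f V x r v = (\<lambda>x'\<in>obj_fibre X f (fobj f x).
     if x' = x then ind_pure K X Y f V x r v else \<zero>\<^bsub>ind_summand K X Y f V x'\<^esub>)"

text \<open>\<open>f\<^sub>!\<close> on a morphism \<open>\<alpha>\<close> with target \<open>B\<close>, at \<open>y\<close>.\<close>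

definition lan_map ::
  "('k,'r) ring_scheme \<Rightarrow> ('x,'a) groupoid_data \<Rightarrow> ('y,'b) groupoid_data \<Rightarrow> ('x,'a,'y,'b) gmap \<Rightarrow>
   ('x,'a,'k,'w) rep \<Rightarrow> ('x \<Rightarrow> 'v \<Rightarrow> 'w) \<Rightarrow> 'y \<Rightarrow>
   ('x \<Rightarrow> (('b \<Rightarrow> 'k) \<times> 'v \<Rightarrow> 'k) set) \<Rightarrow> ('x \<Rightarrow> (('b \<Rightarrow> 'k) \<times> 'w \<Rightarrow> 'k) set)" where
  "lan_map K X Y f B \<alpha> y t = (\<lambda>x\<in>obj_fibre X f y.
     tensor_lift K (ind_summand K X Y f B x) (\<lambda>r v. ind_pure K X Y f B x r (\<alpha> x v)) (t x))"

definition eta_lan ::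
  "('k,'r) ring_scheme \<Rightarrow> ('x,'a) groupoid_data \<Rightarrow> ('y,'b) groupoid_data \<Rightarrow> ('x,'a,'y,'b) gmap \<Rightarrow>
   ('x,'a,'k,'v) rep \<Rightarrow> 'x \<Rightarrow> 'v \<Rightarrow> ('x \<Rightarrow> (('b \<Rightarrow> 'k) \<times> 'v \<Rightarrow> 'k) set)" where
  "eta_lan K X Y f V x v = lan_inj K X Y f V x \<one>\<^bsub>aut_alg K Y (fobj f x)\<^esub> v"

definition eps_lan ::
  "('k,'r) ring_scheme \<Rightarrow> ('x,'a) groupoid_data \<Rightarrow> ('y,'b) groupoid_data \<Rightarrow> ('x,'a,'y,'b) gmap \<Rightarrow>
   ('y,'b,'k,'w) rep \<Rightarrow> 'y \<Rightarrow> ('x \<Rightarrow> (('b \<Rightarrow> 'k) \<times> 'w \<Rightarrow> 'k) set) \<Rightarrow> 'w" where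
  "eps_lan K X Y f W y t = (\<Oplus>\<^bsub>ob W y\<^esub>x\<in>obj_fibre X f y.
     tensor_lift K (ob W y) (group_algebra_act (aut_group Y y) (ob W y) (act W)) (t x))"

subsection \<open>The right adjoint \<open>f\<^sub>*\<close>\<close>

text \<open>The summand \<open>Hom\<^bsub>k[A\<^bsub>x\<^esub>]\<^esub>(k[A\<^bsub>fx\<^esub>], V(x))\<close>.\<close>

definition coind_summand ::
  "('k,'r) ring_scheme \<Rightarrow> ('x,'a) groupoid_data \<Rightarrow> ('y,'b) groupoid_data \<Rightarrow> ('x,'a,'y,'b) gmap \<Rightarrow>
   ('x,'a,'k,'v) rep \<Rightarrow> 'x \<Rightarrow> ('k, ('b \<Rightarrow> 'k) \<Rightarrow> 'v) module" where
  "coind_summand K X Y f V x =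
     (let H = aut_alg K Y (fobj f x) in
      \<lparr>carrier = {\<phi> \<in> lin_maps K H (ob V x) \<inter> extensional (carrier H).
         \<forall>s\<in>carrier (aut_alg K X x). \<forall>r\<in>carrier H.
           \<phi> (group_algebra_map K (aut_group X x) (farr f) s \<otimes>\<^bsub>H\<^esub> r)
             = group_algebra_act (aut_group X x) (ob V x) (act V) s (\<phi> r)},
       mult = undefined, one = undefined,
       zero = (\<lambda>r\<in>carrier H. \<zero>\<^bsub>ob V x\<^esub>),
       add = (\<lambda>\<phi> \<psi>. \<lambda>r\<in>carrier H. \<phi> r \<oplus>\<^bsub>ob V x\<^esub> \<psi> r),
       smult = (\<lambda>c \<phi>. \<lambda>r\<in>carrier H. c \<odot>\<^bsub>ob V x\<^esub> \<phi> r)\<rparr>)"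

text \<open>\<open>A\<^sub>y\<close> acts on \<open>f\<^sub>*V(y)\<close> by right translation of the argument: \<open>(b \<phi>)(r) = \<phi>(r b)\<close>.\<close>

definition right_kan ::
  "('k,'r) ring_scheme \<Rightarrow> ('x,'a) groupoid_data \<Rightarrow> ('y,'b) groupoid_data \<Rightarrow> ('x,'a,'y,'b) gmap \<Rightarrow>
   ('x,'a,'k,'v) rep \<Rightarrow> ('y,'b,'k,'x \<Rightarrow> ('b \<Rightarrow> 'k) \<Rightarrow> 'v) rep" where
  "right_kan K X Y f V = \<lparr>
     ob = (\<lambda>y. dsum (obj_fibre X f y) (coind_summand K X Y f V)),
     act = (\<lambda>b \<phi>. \<lambda>x\<in>obj_fibre X f (tgt Y b). \<lambda>r\<in>carrier (aut_alg K Y (fobj f x)).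
        \<phi> x (r \<otimes>\<^bsub>aut_alg K Y (fobj f x)\<^esub> basis_elt K b))\<rparr>"

definition ran_map ::
  "('k,'r) ring_scheme \<Rightarrow> ('x,'a) groupoid_data \<Rightarrow> ('y,'b) groupoid_data \<Rightarrow> ('x,'a,'y,'b) gmap \<Rightarrow>
   ('x \<Rightarrow> 'v \<Rightarrow> 'w) \<Rightarrow> 'y \<Rightarrow> ('x \<Rightarrow> ('b \<Rightarrow> 'k) \<Rightarrow> 'v) \<Rightarrow> ('x \<Rightarrow> ('b \<Rightarrow> 'k) \<Rightarrow> 'w)" where
  "ran_map K X Y f \<alpha> y \<phi> = (\<lambda>x\<in>obj_fibre X f y. \<lambda>r\<in>carrier (aut_alg K Y y). \<alpha> x (\<phi> x r))"

definition eta_ran ::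
  "('k,'r) ring_scheme \<Rightarrow> ('x,'a) groupoid_data \<Rightarrow> ('y,'b) groupoid_data \<Rightarrow> ('x,'a,'y,'b) gmap \<Rightarrow>
   ('y,'b,'k,'w) rep \<Rightarrow> 'y \<Rightarrow> 'w \<Rightarrow> ('x \<Rightarrow> ('b \<Rightarrow> 'k) \<Rightarrow> 'w)" where
  "eta_ran K X Y f W y w = (\<lambda>x\<in>obj_fibre X f y. \<lambda>r\<in>carrier (aut_alg K Y y).
     group_algebra_act (aut_group Y y) (ob W y) (act W) r w)"

definition eps_ran ::
  "('k,'r) ring_scheme \<Rightarrow> ('x,'a) groupoid_data \<Rightarrow> ('y,'b) groupoid_data \<Rightarrow> ('x,'a,'y,'b) gmap \<Rightarrow>
   'x \<Rightarrow> ('x \<Rightarrow> ('b \<Rightarrow> 'k) \<Rightarrow> 'v) \<Rightarrow> 'v" where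
  "eps_ran K X Y f x \<phi> = \<phi> x \<one>\<^bsub>aut_alg K Y (fobj f x)\<^esub>"

section \<open>The pre-Nakayama map\<close>

text \<open>\<open>\<lambda>: f\<^sub>!(A \<otimes> f\<^sup>*B) \<rightarrow> f\<^sub>!A \<otimes> B\<close>\<close>

definition proj_lan ::
  "('k,'r) ring_scheme \<Rightarrow> ('x,'a) groupoid_data \<Rightarrow> ('y,'b) groupoid_data \<Rightarrow> ('x,'a,'y,'b) gmap \<Rightarrow>
   ('x,'a,'k,'v) rep \<Rightarrow> ('y,'b,'k,'w) rep \<Rightarrow> 'y \<Rightarrow>
   ('x \<Rightarrow> (('b \<Rightarrow> 'k) \<times> ('v \<times> 'w \<Rightarrow> 'k) set \<Rightarrow> 'k) set) \<Rightarrow>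
   (('x \<Rightarrow> (('b \<Rightarrow> 'k) \<times> 'v \<Rightarrow> 'k) set) \<times> 'w \<Rightarrow> 'k) set" where
  "proj_lan K X Y f A B y =
     eps_lan K X Y f (tensor_rep K Y (left_kan K X Y f A) B) y
     \<circ> lan_map K X Y f (tensor_rep K X (pullback f (left_kan K X Y f A)) (pullback f B))
         (\<lambda>x. tensor_map K (ob (left_kan K X Y f A) (fobj f x)) (ob B (fobj f x))
                (eta_lan K X Y f A x) (\<lambda>w. w)) y"

text \<open>\<open>\<rho>: A \<otimes> f\<^sub>*B \<rightarrow> f\<^sub>*(f\<^sup>*A \<otimes> B)\<close>\<close>

definition proj_ran ::
  "('k,'r) ring_scheme \<Rightarrow> ('x,'a) groupoid_data \<Rightarrow> ('y,'b) groupoid_data \<Rightarrow> ('x,'a,'y,'b) gmap \<Rightarrow>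
   ('y,'b,'k,'v) rep \<Rightarrow> ('x,'a,'k,'w) rep \<Rightarrow> 'y \<Rightarrow>
   ('v \<times> ('x \<Rightarrow> ('b \<Rightarrow> 'k) \<Rightarrow> 'w) \<Rightarrow> 'k) set \<Rightarrow>
   ('x \<Rightarrow> ('b \<Rightarrow> 'k) \<Rightarrow> ('v \<times> 'w \<Rightarrow> 'k) set)" where
  "proj_ran K X Y f A B y =
     ran_map K X Y f
       (\<lambda>x. tensor_map K (ob A (fobj f x)) (ob B x) (\<lambda>v. v) (eps_ran K X Y f x)) y
     \<circ> eta_ran K X Y f (tensor_rep K Y A (right_kan K X Y f B)) y"

definition proj_lan_inv where
  "proj_lan_inv K X Y f A B y =
     inv_into (carrier (ob (left_kan K X Y f (tensor_rep K X A (pullback f B))) y))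
       (proj_lan K X Y f A B y)"

definition proj_ran_inv where
  "proj_ran_inv K X Y f A B y =
     inv_into (carrier (ob (tensor_rep K Y A (right_kan K X Y f B)) y)) (proj_ran K X Y f A B y)"

definition pre_nakayama ::
  "('k,'r) ring_scheme \<Rightarrow> ('x,'a) groupoid_data \<Rightarrow> ('y,'b) groupoid_data \<Rightarrow> ('x,'a,'y,'b) gmap \<Rightarrow>
   ('x,'a,'k,'v) rep \<Rightarrow> 'y \<Rightarrow>
   ('x \<Rightarrow> ('b \<Rightarrow> 'k) \<Rightarrow> 'v) \<Rightarrow> ('x \<Rightarrow> (('b \<Rightarrow> 'k) \<times> 'v \<Rightarrow> 'k) set)" where
  "pre_nakayama K X Y f A y =
     lan_map K X Y f A (\<lambda>x. unitor_r K (ob A x)) y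
     \<circ> lan_map K X Y f (tensor_rep K X A (unit_rep K))
         (\<lambda>x. tensor_map K (ob A x) (self_module K) (\<lambda>v. v) (eps_ran K X Y f x)) y
     \<circ> proj_lan_inv K X Y f A (right_kan K X Y f (unit_rep K)) y
     \<circ> proj_ran_inv K X Y f (left_kan K X Y f A) (unit_rep K) y
     \<circ> ran_map K X Y f
         (\<lambda>x. tensor_map K (ob (left_kan K X Y f A) (fobj f x)) (self_module K)
                (eta_lan K X Y f A x) (\<lambda>c. c)) y
     \<circ> ran_map K X Y f (\<lambda>x. unitor_r_inv K (ob A x)) y"

section \<open>The endomorphism \<open>\<delta>\<^sub>f\<close> and the Nakayama map\<close>

text \<open>The endomorphism \<open>1 \<rightarrow> \<iota>\<^sub>*\<iota>\<^sup>*1 \<rightarrow> \<iota>\<^sub>!\<iota>\<^sup>*1 \<rightarrow> 1\<close> for the inclusion \<open>\<iota>\<close> of the object \<open>q\<close> into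
  its connected component in \<open>P\<close>. As the formulas for \<open>\<iota>\<^sub>!\<close> and \<open>\<iota>\<^sub>*\<close> presuppose a skeletal target,
  the component is replaced by the equivalent full subgroupoid on \<open>q\<close>.\<close>

definition unit_endo :: "('k,'r) ring_scheme \<Rightarrow> ('o,'a) groupoid_data \<Rightarrow> 'o \<Rightarrow> 'k \<Rightarrow> 'k" where
  "unit_endo K P q =
     (let S = full_sub P {q}; \<iota> = point_map P q; u = unit_rep K in
      eps_lan K point_groupoid S \<iota> u q
      \<circ> pre_nakayama K point_groupoid S \<iota> (pullback \<iota> u) q
      \<circ> eta_ran K point_groupoid S \<iota> u q)"

text \<open>\<open>\<delta>\<^sub>f\<close> as an endomorphism of the unit on \<open>P\<^sub>y\<close>, at the object \<open>p\<close>. One base point is chosen in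
  each connected component; the unit representation is constant, so the endomorphism found at
  the base point is the one at every object of the component.\<close>

definition delta_unit ::
  "('k,'r) ring_scheme \<Rightarrow> ('x,'a) groupoid_data \<Rightarrow> ('y,'b) groupoid_data \<Rightarrow> ('x,'a,'y,'b) gmap \<Rightarrow>
   'y \<Rightarrow> 'x \<times> 'b \<Rightarrow> 'k \<Rightarrow> 'k" where
  "delta_unit K X Y f y p =
     unit_endo K (hfib X Y f y) (SOME q. q \<in> iso_class (hfib X Y f y) p)"

text \<open>\<open>\<delta>\<^sub>f\<close> as an endomorphism of \<open>p\<^sup>*V \<cong> 1 \<otimes> p\<^sup>*V\<close> on \<open>P\<^sub>y\<close>, at the object \<open>p\<close>.\<close>

definition delta_pullback ::
  "('k,'r) ring_scheme \<Rightarrow> ('x,'a) groupoid_data \<Rightarrow> ('y,'b) groupoid_data \<Rightarrow> ('x,'a,'y,'b) gmap \<Rightarrow>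
   ('x,'a,'k,'v) rep \<Rightarrow> 'y \<Rightarrow> 'x \<times> 'b \<Rightarrow> 'v \<Rightarrow> 'v" where
  "delta_pullback K X Y f V y p =
     unitor_l K (ob V (fst p))
     \<circ> tensor_map K (self_module K) (ob V (fst p)) (delta_unit K X Y f y p) (\<lambda>v. v)
     \<circ> unitor_l_inv K (ob V (fst p))"

text \<open>The endomorphism of \<open>f\<^sub>!V(y) = colim p\<^sup>*V\<close> induced by an endomorphism \<open>s\<close> of \<open>p\<^sup>*V\<close> on \<open>P\<^sub>y\<close>.
  The colimit cocone at \<open>(x, h)\<close> is \<open>v \<mapsto> h \<otimes> v\<close>.\<close>

definition colim_endo ::
  "('k,'r) ring_scheme \<Rightarrow> ('x,'a) groupoid_data \<Rightarrow> ('y,'b) groupoid_data \<Rightarrow> ('x,'a,'y,'b) gmap \<Rightarrow>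
   ('x,'a,'k,'v) rep \<Rightarrow> 'y \<Rightarrow> ('x \<times> 'b \<Rightarrow> 'v \<Rightarrow> 'v) \<Rightarrow>
   ('x \<Rightarrow> (('b \<Rightarrow> 'k) \<times> 'v \<Rightarrow> 'k) set) \<Rightarrow> ('x \<Rightarrow> (('b \<Rightarrow> 'k) \<times> 'v \<Rightarrow> 'k) set)" where
  "colim_endo K X Y f V y s =
     (let L = ob (left_kan K X Y f V) y in
      THE D. D \<in> lin_maps K L L \<inter> extensional (carrier L) \<and>
        (\<forall>(x, h)\<in>objs (hfib X Y f y). \<forall>v\<in>carrier (ob V x).
           D (lan_inj K X Y f V x (basis_elt K h) v) = lan_inj K X Y f V x (basis_elt K h) (s (x, h) v)))"

definition delta_lan ::
  "('k,'r) ring_scheme \<Rightarrow> ('x,'a) groupoid_data \<Rightarrow> ('y,'b) groupoid_data \<Rightarrow> ('x,'a,'y,'b) gmap \<Rightarrow>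
   ('x,'a,'k,'v) rep \<Rightarrow> 'y \<Rightarrow>
   ('x \<Rightarrow> (('b \<Rightarrow> 'k) \<times> 'v \<Rightarrow> 'k) set) \<Rightarrow> ('x \<Rightarrow> (('b \<Rightarrow> 'k) \<times> 'v \<Rightarrow> 'k) set)" where
  "delta_lan K X Y f V y = colim_endo K X Y f V y (delta_pullback K X Y f V y)"

definition nakayama ::
  "('k,'r) ring_scheme \<Rightarrow> ('x,'a) groupoid_data \<Rightarrow> ('y,'b) groupoid_data \<Rightarrow> ('x,'a,'y,'b) gmap \<Rightarrow>
   ('x,'a,'k,'v) rep \<Rightarrow> 'y \<Rightarrow>
   ('x \<Rightarrow> ('b \<Rightarrow> 'k) \<Rightarrow> 'v) \<Rightarrow> ('x \<Rightarrow> (('b \<Rightarrow> 'k) \<times> 'v \<Rightarrow> 'k) set)" where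
  "nakayama K X Y f V y =
     colim_endo K X Y f V y
       (\<lambda>p. inv_into (carrier (ob V (fst p))) (delta_pullback K X Y f V y p))
     \<circ> pre_nakayama K X Y f V y"

section \<open>Characteristic zero\<close>

definition char_zero :: "('k,'r) ring_scheme \<Rightarrow> bool" where
  "char_zero K \<longleftrightarrow> (\<forall>n::nat. n > 0 \<longrightarrow> [n] \<cdot>\<^bsub>K\<^esub> \<one>\<^bsub>K\<^esub> \<noteq> \<zero>\<^bsub>K\<^esub>)"

text \<open>The scalar \<open>n\<close> of \<open>K\<close>.\<close>

abbreviation nat_scalar :: "('k,'r) ring_scheme \<Rightarrow> nat \<Rightarrow> 'k" where
  "nat_scalar K n \<equiv> [n] \<cdot>\<^bsub>K\<^esub> \<one>\<^bsub>K\<^esub>"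

end

theory Submission
  imports Defs
begin

text \<open>
  The pre-Nakayama map inverts \<open>\<rho>\<close> and \<open>\<lambda>\<close>. It suffices to exhibit preimages and to know that both
  maps are injective, so duality plays no role. At \<open>y\<close> one has \<open>\<rho>(t \<otimes> \<psi>)(x, h) = h t \<otimes> \<psi>(x, h)\<close> and
  \<open>\<lambda>(g \<otimes> (v \<otimes> w)) = (g \<otimes> v) \<otimes> g w\<close>. Let \<open>\<chi>(x, g) \<in> f\<^sub>*1(y)\<close> be the indicator function of the coset
  \<open>f(A\<^sub>x) g\<close>. Then \<open>\<Phi> \<mapsto> \<Sum> (g\<inverse> \<Phi>(x, g) \<otimes> \<chi>(x, g)) / |f(A\<^sub>x)|\<close>, summed over \<open>x\<close> and \<open>g\<close>, is a left inverse
  of \<open>\<rho>\<close>, because all elements of a coset contribute equally, and \<open>(g \<otimes> v) \<otimes> w \<mapsto> g \<otimes> (v \<otimes> g\<inverse> w)\<close> is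
  one of \<open>\<lambda>\<close>. Thus \<open>\<phi>\<close> goes to \<open>\<Sum> (g\<inverse> \<otimes> (\<phi>(x, g) \<otimes> g \<chi>(x, g))) / |f(A\<^sub>x)|\<close>, and the counit replaces
  \<open>g \<chi>(x, g)\<close> by its value \<open>\<chi>(x, g)(x, g) = 1\<close> at the unit. The automorphism group of an object \<open>(x, h)\<close> of the
  homotopy fibre is \<open>K\<^sub>x\<close>, so the formula applied to the inclusion of a point shows that \<open>\<delta>\<close> is
  multiplication by \<open>|K\<^sub>x|\<close>. Finally \<open>|A\<^sub>x| = |f(A\<^sub>x)| |K\<^sub>x|\<close>.
\<close>

section \<open>Linear maps\<close>

text \<open>A choice of coset representatives would give a basis of \<open>f_*1(y)\<close> and sums
  without denominators. Summing over all of \<open>A_y\<close> avoids the choice and overcounts each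
  coset |f(A_x)| times; this is the origin of the constant in \<open>\<gamma>_f\<close>, and the
  count is made once, in \<open>orbit_sum\<close>. The obstacle is that the twists by
  \<open>g\<close> and by its inverse make sense only for group elements, while the carriers are
  quotients of free modules over group algebras. Maps are therefore prescribed at group elements and
  extended linearly, balance is required at group elements only, and two linear maps are compared on
  generators \<open>g \<otimes> v\<close>. A left inverse does not show that a given vector lies in
  the image, so the two preimages are verified by a separate computation. The formula for
  \<open>\<gamma>\<close> is needed for two maps, \<open>f\<close> and the inclusion of an object of
  the homotopy fibre into the full subgroupoid on it; hence it is derived in a locale that is
  interpreted twice.\<close>

lemma linI:
  assumes "\<And>v. v \<in> carrier M \<Longrightarrow> h v \<in> carrier N"
    and "\<And>u v. u \<in> carrier M \<Longrightarrow> v \<in> carrier M \<Longrightarrow> h (u \<oplus>\<^bsub>M\<^esub> v) = h u \<oplus>\<^bsub>N\<^esub> h v"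
    and "\<And>c v. c \<in> carrier K \<Longrightarrow> v \<in> carrier M \<Longrightarrow> h (c \<odot>\<^bsub>M\<^esub> v) = c \<odot>\<^bsub>N\<^esub> h v"
  shows "h \<in> lin_maps K M N"
  using assms by (auto simp: lin_maps_def)

lemma lin_closed: "h \<in> lin_maps K M N \<Longrightarrow> v \<in> carrier M \<Longrightarrow> h v \<in> carrier N"
  by (auto simp: lin_maps_def)

lemma lin_add:
  "h \<in> lin_maps K M N \<Longrightarrow> u \<in> carrier M \<Longrightarrow> v \<in> carrier M \<Longrightarrow> h (u \<oplus>\<^bsub>M\<^esub> v) = h u \<oplus>\<^bsub>N\<^esub> h v"
  by (auto simp: lin_maps_def)

lemma lin_smult:
  "h \<in> lin_maps K M N \<Longrightarrow> c \<in> carrier K \<Longrightarrow> v \<in> carrier M \<Longrightarrow> h (c \<odot>\<^bsub>M\<^esub> v) = c \<odot>\<^bsub>N\<^esub> h v"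
  by (auto simp: lin_maps_def)

text \<open>Membership in \<open>lin_maps\<close> depends on the values on the carrier only, while
  functions given by different formulas agree there without being equal. This lemma stands in for
  rewriting.\<close>

lemma lin_cong:
  assumes "h \<in> lin_maps K M N" "\<And>v. v \<in> carrier M \<Longrightarrow> h' v = h v" "module K M"
  shows "h' \<in> lin_maps K M N"
proof -
  interpret M: module K M by fact
  show ?thesis
    using assms(1,2) by (auto simp: lin_maps_def)
qed

lemma lin_comp:
  "h \<in> lin_maps K M N \<Longrightarrow> h' \<in> lin_maps K N P \<Longrightarrow> (\<lambda>v. h' (h v)) \<in> lin_maps K M P"
  by (auto simp: lin_maps_def Pi_iff)

lemma lin_ident: "(\<lambda>v. v) \<in> lin_maps K M M"
  by (auto simp: lin_maps_def)

lemma lin_zero: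
  assumes "module K M" "module K N" "h \<in> lin_maps K M N"
  shows "h \<zero>\<^bsub>M\<^esub> = \<zero>\<^bsub>N\<^esub>"
proof -
  interpret M: module K M by fact
  interpret N: module K N by fact
  have "h (\<zero>\<^bsub>K\<^esub> \<odot>\<^bsub>M\<^esub> \<zero>\<^bsub>M\<^esub>) = \<zero>\<^bsub>K\<^esub> \<odot>\<^bsub>N\<^esub> h \<zero>\<^bsub>M\<^esub>"
    by (rule lin_smult[OF assms(3)]) auto
  then show ?thesis
    using lin_closed[OF assms(3)] by simp
qed

lemma lin_finsum:
  assumes "module K M" "module K N" "h \<in> lin_maps K M N" "finite A" "g \<in> A \<rightarrow> carrier M"
  shows "h (\<Oplus>\<^bsub>M\<^esub>a\<in>A. g a) = (\<Oplus>\<^bsub>N\<^esub>a\<in>A. h (g a))"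
proof -
  interpret M: module K M by fact
  interpret N: module K N by fact
  show ?thesis using assms(4,5)
  proof (induction A rule: finite_induct)
    case empty
    then show ?case by (simp add: lin_zero[OF assms(1-3)])
  next
    case (insert a A)
    then have g: "g \<in> A \<rightarrow> carrier M" "g a \<in> carrier M" by auto
    have hg: "(\<lambda>a. h (g a)) \<in> A \<rightarrow> carrier N" "h (g a) \<in> carrier N"
      using g lin_closed[OF assms(3)] by auto
    show ?case
      using insert g hg by (simp add: lin_add[OF assms(3)])
  qed
qed

lemma (in module) minus_eq_smult:
  "u \<in> carrier M \<Longrightarrow> v \<in> carrier M \<Longrightarrow> u \<ominus>\<^bsub>M\<^esub> v = u \<oplus>\<^bsub>M\<^esub> (\<ominus> \<one>) \<odot>\<^bsub>M\<^esub> v"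
  by (simp add: a_minus_def smult_l_minus)

lemma (in module) minus_eq_zeroD:
  assumes "u \<in> carrier M" "v \<in> carrier M" "u \<ominus>\<^bsub>M\<^esub> v = \<zero>\<^bsub>M\<^esub>"
  shows "u = v"
proof -
  have "(u \<ominus>\<^bsub>M\<^esub> v) \<oplus>\<^bsub>M\<^esub> v = u"
    using assms(1,2) by (simp add: a_minus_def M.a_assoc M.l_neg)
  then show ?thesis using assms by simp
qed

lemma (in module) minus_self: "u \<in> carrier M \<Longrightarrow> u \<ominus>\<^bsub>M\<^esub> u = \<zero>\<^bsub>M\<^esub>"
  by (simp add: a_minus_def M.r_neg)

lemma lin_minus:
  assumes "module K M" "module K N" "h \<in> lin_maps K M N" "u \<in> carrier M" "v \<in> carrier M"
  shows "h (u \<ominus>\<^bsub>M\<^esub> v) = h u \<ominus>\<^bsub>N\<^esub> h v"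
proof -
  interpret M: module K M by fact
  interpret N: module K N by fact
  show ?thesis
    using assms(4,5) lin_closed[OF assms(3)]
    by (simp add: M.minus_eq_smult N.minus_eq_smult lin_add[OF assms(3)] lin_smult[OF assms(3)])
qed

lemma lin_scale:
  assumes "module K N" "h \<in> lin_maps K M N" "c \<in> carrier K"
  shows "(\<lambda>v. c \<odot>\<^bsub>N\<^esub> h v) \<in> lin_maps K M N"
proof -
  interpret N: module K N by fact
  show ?thesis
    using assms(3) lin_closed[OF assms(2)]
    by (intro linI)
      (auto simp: lin_add[OF assms(2)] lin_smult[OF assms(2)] N.smult_r_distr
         N.smult_assoc1[symmetric] N.R.m_comm)
qed

lemma lin_plus:
  assumes "module K N" "h \<in> lin_maps K M N" "h' \<in> lin_maps K M N"
  shows "(\<lambda>v. h v \<oplus>\<^bsub>N\<^esub> h' v) \<in> lin_maps K M N"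
proof -
  interpret N: module K N by fact
  show ?thesis
    using lin_closed[OF assms(2)] lin_closed[OF assms(3)]
    by (intro linI)
      (auto simp: lin_add[OF assms(2)] lin_smult[OF assms(2)] lin_add[OF assms(3)]
         lin_smult[OF assms(3)] N.smult_r_distr N.M.a_ac)
qed

lemma lin_const_zero:
  assumes "module K N"
  shows "(\<lambda>v. \<zero>\<^bsub>N\<^esub>) \<in> lin_maps K M N"
proof -
  interpret N: module K N by fact
  show ?thesis by (intro linI) auto
qed

lemma lin_sum:
  assumes "module K N" "finite A" "\<And>a. a \<in> A \<Longrightarrow> h a \<in> lin_maps K M N" "module K M"
  shows "(\<lambda>v. \<Oplus>\<^bsub>N\<^esub>a\<in>A. h a v) \<in> lin_maps K M N"
proof -
  interpret N: module K N by fact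
  show ?thesis using assms(2,3)
  proof (induction A rule: finite_induct)
    case empty
    then show ?case using lin_const_zero[OF assms(1)] by simp
  next
    case (insert a A)
    have "(\<lambda>v. h a v \<oplus>\<^bsub>N\<^esub> (\<Oplus>\<^bsub>N\<^esub>a\<in>A. h a v)) \<in> lin_maps K M N"
      by (rule lin_plus[OF assms(1)]) (use insert in auto)
    then show ?case
    proof (rule lin_cong)
      fix v assume "v \<in> carrier M"
      then have "(\<lambda>a. h a v) \<in> A \<rightarrow> carrier N" "h a v \<in> carrier N"
        using lin_closed[OF insert.prems] by auto
      then show "(\<Oplus>\<^bsub>N\<^esub>a\<in>insert a A. h a v) = h a v \<oplus>\<^bsub>N\<^esub> (\<Oplus>\<^bsub>N\<^esub>a\<in>A. h a v)"
        using insert.hyps by simp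
    qed fact
  qed
qed

lemma lin_smult_left:
  assumes "module K M" "v \<in> carrier M"
  shows "(\<lambda>c. c \<odot>\<^bsub>M\<^esub> v) \<in> lin_maps K (self_module K) M"
proof -
  interpret M: module K M by fact
  show ?thesis using assms(2)
    by (intro linI) (auto simp: self_module_def M.smult_l_distr M.smult_assoc1)
qed

lemma module_self: "cring K \<Longrightarrow> module K (self_module K)"
proof -
  assume "cring K"
  then interpret cring K .
  show ?thesis
  proof (rule moduleI, rule is_cring, rule abelian_groupI)
    fix u assume "u \<in> carrier (self_module K)"
    then show "\<exists>v\<in>carrier (self_module K). v \<oplus>\<^bsub>self_module K\<^esub> u = \<zero>\<^bsub>self_module K\<^esub>"
      by (intro bexI[of _ "\<ominus>\<^bsub>K\<^esub> u"]) (auto simp: self_module_def l_neg)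
  qed (simp_all add: self_module_def a_ac m_assoc l_distr r_distr)
qed

section \<open>Spans\<close>

lemma mspan_superset: "S \<subseteq> mspan K M S"
  by (auto simp: mspan_def)

lemma mspan_least: "submodule N K M \<Longrightarrow> S \<subseteq> N \<Longrightarrow> mspan K M S \<subseteq> N"
  by (auto simp: mspan_def)

lemma submodule_mspan:
  assumes "module K M" "S \<subseteq> carrier M"
  shows "submodule (mspan K M S) K M"
proof -
  interpret M: module K M by fact
  show ?thesis
  proof (rule M.submoduleI)
    show "mspan K M S \<subseteq> carrier M"
      by (rule mspan_least[OF M.carrier_is_submodule assms(2)])
    show "\<zero>\<^bsub>M\<^esub> \<in> mspan K M S"
      using subgroup.one_closed submodule.axioms(1) by (fastforce simp: mspan_def)
  qed (auto simp: mspan_def dest: M.submoduleE)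
qed

text \<open>The kernel of \<open>h\<close> is a submodule containing \<open>S\<close>, hence
  contains the span. Tensor relations can thus be tested on their generators.\<close>

lemma lin_vanish_mspan:
  assumes "module K M" "module K N" "h \<in> lin_maps K M N" "S \<subseteq> carrier M"
    and "\<And>s. s \<in> S \<Longrightarrow> h s = \<zero>\<^bsub>N\<^esub>" "u \<in> mspan K M S"
  shows "h u = \<zero>\<^bsub>N\<^esub>"
proof -
  interpret M: module K M by fact
  interpret N: module K N by fact
  have "submodule {v \<in> carrier M. h v = \<zero>\<^bsub>N\<^esub>} K M"
  proof (rule M.submoduleI)
    fix a assume a: "a \<in> {v \<in> carrier M. h v = \<zero>\<^bsub>N\<^esub>}"
    have "\<ominus>\<^bsub>M\<^esub> a = (\<ominus>\<^bsub>K\<^esub> \<one>\<^bsub>K\<^esub>) \<odot>\<^bsub>M\<^esub> a"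
      using a by (simp add: M.smult_l_minus)
    then show "\<ominus>\<^bsub>M\<^esub> a \<in> {v \<in> carrier M. h v = \<zero>\<^bsub>N\<^esub>}"
      using a by (simp add: lin_smult[OF assms(3)])
  qed (auto simp: lin_zero[OF assms(1-3)] lin_add[OF assms(3)] lin_smult[OF assms(3)])
  from mspan_least[OF this, of S] assms show ?thesis by auto
qed

section \<open>Free modules\<close>

lemma module_free:
  assumes "cring K"
  shows "module K (free_module K S)"
proof -
  interpret cring K by fact
  have fin: "finite {s. u s \<oplus>\<^bsub>K\<^esub> v s \<noteq> \<zero>\<^bsub>K\<^esub>}"
    if "finite {s. u s \<noteq> \<zero>\<^bsub>K\<^esub>}" "finite {s. v s \<noteq> \<zero>\<^bsub>K\<^esub>}" for u v :: "'c \<Rightarrow> 'a"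
    by (rule finite_subset[OF _ finite_UnI[OF that]]) auto
  have sub: "{s. u s \<oplus>\<^bsub>K\<^esub> v s \<noteq> \<zero>\<^bsub>K\<^esub>} \<subseteq> S"
    if "{s. u s \<noteq> \<zero>\<^bsub>K\<^esub>} \<subseteq> S" "{s. v s \<noteq> \<zero>\<^bsub>K\<^esub>} \<subseteq> S" for u v :: "'c \<Rightarrow> 'a"
  proof
    fix s assume "s \<in> {s. u s \<oplus>\<^bsub>K\<^esub> v s \<noteq> \<zero>\<^bsub>K\<^esub>}"
    then have "u s \<noteq> \<zero>\<^bsub>K\<^esub> \<or> v s \<noteq> \<zero>\<^bsub>K\<^esub>" by auto
    then show "s \<in> S" using that by auto
  qed
  have sm: "finite {s. c \<otimes>\<^bsub>K\<^esub> u s \<noteq> \<zero>\<^bsub>K\<^esub>} \<and> {s. c \<otimes>\<^bsub>K\<^esub> u s \<noteq> \<zero>\<^bsub>K\<^esub>} \<subseteq> S"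
    if "finite {s. u s \<noteq> \<zero>\<^bsub>K\<^esub>}" "{s. u s \<noteq> \<zero>\<^bsub>K\<^esub>} \<subseteq> S" "c \<in> carrier K" for u :: "'c \<Rightarrow> 'a" and c
  proof -
    have "{s. c \<otimes>\<^bsub>K\<^esub> u s \<noteq> \<zero>\<^bsub>K\<^esub>} \<subseteq> {s. u s \<noteq> \<zero>\<^bsub>K\<^esub>}" using that by auto
    then show ?thesis using that(1,2) finite_subset by blast
  qed
  have neg: "\<exists>v. (\<forall>s. v s \<in> carrier K) \<and> finite {s. v s \<noteq> \<zero>\<^bsub>K\<^esub>} \<and> {s. v s \<noteq> \<zero>\<^bsub>K\<^esub>} \<subseteq> S \<and>
      (\<lambda>s. v s \<oplus>\<^bsub>K\<^esub> u s) = (\<lambda>s. \<zero>\<^bsub>K\<^esub>)"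
    if "\<forall>s. u s \<in> carrier K" "finite {s. u s \<noteq> \<zero>\<^bsub>K\<^esub>}" "{s. u s \<noteq> \<zero>\<^bsub>K\<^esub>} \<subseteq> S" for u :: "'c \<Rightarrow> 'a"
  proof (intro exI[of _ "\<lambda>s. \<ominus>\<^bsub>K\<^esub> u s"] conjI)
    have *: "{s. \<ominus>\<^bsub>K\<^esub> u s \<noteq> \<zero>\<^bsub>K\<^esub>} \<subseteq> {s. u s \<noteq> \<zero>\<^bsub>K\<^esub>}" by auto
    show "finite {s. \<ominus>\<^bsub>K\<^esub> u s \<noteq> \<zero>\<^bsub>K\<^esub>}" by (rule finite_subset[OF * that(2)])
    show "{s. \<ominus>\<^bsub>K\<^esub> u s \<noteq> \<zero>\<^bsub>K\<^esub>} \<subseteq> S" using * that(3) by auto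
  qed (use that in \<open>auto simp: l_neg\<close>)
  show ?thesis
  proof (rule moduleI, rule is_cring, rule abelian_groupI)
    fix u assume "u \<in> carrier (free_module K S)"
    with neg[of u] show "\<exists>v\<in>carrier (free_module K S). v \<oplus>\<^bsub>free_module K S\<^esub> u = \<zero>\<^bsub>free_module K S\<^esub>"
      by (simp add: free_module_def Bex_def)
  qed (use fin sub sm in \<open>simp_all add: free_module_def a_ac m_assoc l_distr r_distr\<close>)
qed

context cring
begin

lemma basis_elt_free: "s \<in> S \<Longrightarrow> basis_elt R s \<in> carrier (free_module R S)"
  by (auto simp: basis_elt_def free_module_def)

lemma finsum_basis_elt:
  assumes "finite S"
  shows "(\<Oplus>s\<in>S. basis_elt R a s) = (if a \<in> S then \<one> else \<zero>)"
proof -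
  have "(\<Oplus>s\<in>S. basis_elt R a s) = (\<Oplus>s\<in>S. if a = s then \<one> else \<zero>)"
    by (intro finsum_cong') (auto simp: basis_elt_def)
  also have "\<dots> = (if a \<in> S then \<one> else \<zero>)"
  proof (cases "a \<in> S")
    case False
    then have "(\<Oplus>s\<in>S. if a = s then \<one> else \<zero>) = (\<Oplus>s\<in>S. \<zero>)"
      by (intro finsum_cong') auto
    then show ?thesis using False by simp
  qed (use assms in \<open>simp add: finsum_singleton\<close>)
  finally show ?thesis .
qed

text \<open>Induction on the finite support: erasing one point \<open>s\<close> from
  \<open>u\<close> leaves a vector with smaller support, and the erased part is a multiple of a
  basis element.\<close>

lemma free_module_induct [consumes 1, case_names zero add]:
  assumes "u \<in> carrier (free_module R S)"
    and "Q \<zero>\<^bsub>free_module R S\<^esub>"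
    and step: "\<And>c s v. \<lbrakk>c \<in> carrier R; s \<in> S; v \<in> carrier (free_module R S); Q v\<rbrakk> \<Longrightarrow>
       Q (c \<odot>\<^bsub>free_module R S\<^esub> basis_elt R s \<oplus>\<^bsub>free_module R S\<^esub> v)"
  shows "Q u"
proof -
  have "finite {s. u s \<noteq> \<zero>}" using assms(1) by (simp add: free_module_def)
  then show ?thesis using assms(1)
  proof (induction "{s. u s \<noteq> \<zero>}" arbitrary: u rule: finite_induct)
    case empty
    then have "u = \<zero>\<^bsub>free_module R S\<^esub>" by (auto simp: free_module_def)
    then show ?case using assms(2) by simp
  next
    case (insert s F)
    define v where "v = u(s := \<zero>)"
    have F: "F = {t. v t \<noteq> \<zero>}"
      using insert(2,4) by (auto simp: v_def)
    have v: "v \<in> carrier (free_module R S)"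
      using insert(1,5) F by (auto simp: free_module_def v_def)
    have s: "s \<in> S" "u s \<in> carrier R" using insert(4,5) by (auto simp: free_module_def)
    have "u = u s \<odot>\<^bsub>free_module R S\<^esub> basis_elt R s \<oplus>\<^bsub>free_module R S\<^esub> v"
      using insert(5) by (auto simp: free_module_def v_def basis_elt_def)
    then show ?case
      using step[OF s(2,1) v insert(3)[OF F v]] by simp
  qed
qed

end

lemma lin_eq_free:
  assumes "module K N" "h \<in> lin_maps K (free_module K S) N" "h' \<in> lin_maps K (free_module K S) N"
    and "\<And>s. s \<in> S \<Longrightarrow> h (basis_elt K s) = h' (basis_elt K s)"
    and "u \<in> carrier (free_module K S)"
  shows "h u = h' u"
proof -
  interpret N: module K N by fact
  interpret F: module K "free_module K S" by (rule module_free) (rule N.R.is_cring)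
  show ?thesis using assms(5)
  proof (induction rule: N.R.free_module_induct)
    case zero
    then show ?case using assms(1-3) lin_zero F.module_axioms by metis
  next
    case (add c s v)
    then show ?case using assms(4)
      by (simp add: N.R.basis_elt_free lin_add[OF assms(2)] lin_add[OF assms(3)]
         lin_smult[OF assms(2)] lin_smult[OF assms(3)])
  qed
qed

text \<open>The function whose image over a coset is formed in \<open>tensor_lift\<close>. Naming it
  separates linearity from independence of the representative.\<close>

definition lin_ext :: "('k,'r) ring_scheme \<Rightarrow> ('k,'p,'q) module_scheme \<Rightarrow> ('s \<Rightarrow> 'p) \<Rightarrow> ('s \<Rightarrow> 'k) \<Rightarrow> 'p" where
  "lin_ext K P \<beta> u = (\<Oplus>\<^bsub>P\<^esub>s\<in>{s. u s \<noteq> \<zero>\<^bsub>K\<^esub>}. u s \<odot>\<^bsub>P\<^esub> \<beta> s)"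

context
  fixes R :: "('k,'r) ring_scheme" (structure) and M :: "('k,'p) module"
  assumes mod: "module R M"
begin

interpretation module R M by (rule mod)

text \<open>Additivity compares vectors with different supports, so the sums must first be brought
  to a common finite index set; the added terms are zero.\<close>

lemma lin_ext_superset:
  assumes "u \<in> carrier (free_module R S)" "\<And>s. s \<in> S \<Longrightarrow> \<beta> s \<in> carrier M"
    "finite T" "{s. u s \<noteq> \<zero>} \<subseteq> T" "T \<subseteq> S"
  shows "lin_ext R M \<beta> u = (\<Oplus>\<^bsub>M\<^esub>s\<in>T. u s \<odot>\<^bsub>M\<^esub> \<beta> s)"
proof -
  have "u s \<in> carrier R" for s using assms(1) by (simp add: free_module_def)
  moreover have "\<beta> s \<in> carrier M" if "s \<in> T" for s using assms(2,5) that by auto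
  ultimately show ?thesis
    unfolding lin_ext_def
    by (intro M.add.finprod_mono_neutral_cong_left) (use assms(3,4) in auto)
qed

lemma lin_ext_linear:
  assumes \<beta>: "\<And>s. s \<in> S \<Longrightarrow> \<beta> s \<in> carrier M"
  shows "lin_ext R M \<beta> \<in> lin_maps R (free_module R S) M"
proof (rule linI)
  interpret F: module R "free_module R S" by (rule module_free) (rule R.is_cring)
  fix u assume u: "u \<in> carrier (free_module R S)"
  then have fu: "finite {s. u s \<noteq> \<zero>}" "{s. u s \<noteq> \<zero>} \<subseteq> S" and uc: "\<And>s. u s \<in> carrier R"
    by (auto simp: free_module_def)
  have \<beta>u: "\<beta> s \<in> carrier M" if "u s \<noteq> \<zero>" for s using \<beta> fu that by auto
  show "lin_ext R M \<beta> u \<in> carrier M"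
    unfolding lin_ext_def using uc \<beta>u by (intro M.finsum_closed) auto
  { fix v assume v: "v \<in> carrier (free_module R S)"
    then have fv: "finite {s. v s \<noteq> \<zero>}" "{s. v s \<noteq> \<zero>} \<subseteq> S" and vc: "\<And>s. v s \<in> carrier R"
      by (auto simp: free_module_def)
    let ?T = "{s. u s \<noteq> \<zero>} \<union> {s. v s \<noteq> \<zero>}"
    let ?w = "u \<oplus>\<^bsub>free_module R S\<^esub> v"
    have T: "finite ?T" "?T \<subseteq> S" using fu fv by auto
    have \<beta>T: "\<beta> s \<in> carrier M" if "s \<in> ?T" for s using \<beta> T that by auto
    have "{s. ?w s \<noteq> \<zero>} \<subseteq> ?T" by (auto simp: free_module_def)
    then have "lin_ext R M \<beta> ?w = (\<Oplus>\<^bsub>M\<^esub>s\<in>?T. ?w s \<odot>\<^bsub>M\<^esub> \<beta> s)"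
      using T by (intro lin_ext_superset[OF F.M.a_closed[OF u v] \<beta>]) auto
    also have "\<dots> = (\<Oplus>\<^bsub>M\<^esub>s\<in>?T. u s \<odot>\<^bsub>M\<^esub> \<beta> s \<oplus>\<^bsub>M\<^esub> v s \<odot>\<^bsub>M\<^esub> \<beta> s)"
      using uc vc \<beta>T
      by (intro M.finsum_cong') (simp_all add: Pi_iff, simp add: free_module_def smult_l_distr)
    also have "\<dots> = (\<Oplus>\<^bsub>M\<^esub>s\<in>?T. u s \<odot>\<^bsub>M\<^esub> \<beta> s) \<oplus>\<^bsub>M\<^esub> (\<Oplus>\<^bsub>M\<^esub>s\<in>?T. v s \<odot>\<^bsub>M\<^esub> \<beta> s)"
      using uc vc \<beta>T by (intro M.finsum_addf) (simp_all add: Pi_iff)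
    also have "\<dots> = lin_ext R M \<beta> u \<oplus>\<^bsub>M\<^esub> lin_ext R M \<beta> v"
      using lin_ext_superset[OF u \<beta> T(1) _ T(2)] lin_ext_superset[OF v \<beta> T(1) _ T(2)] by simp
    finally show "lin_ext R M \<beta> ?w = lin_ext R M \<beta> u \<oplus>\<^bsub>M\<^esub> lin_ext R M \<beta> v" . }
  fix c assume c: "c \<in> carrier R"
  let ?w = "c \<odot>\<^bsub>free_module R S\<^esub> u"
  have "{s. ?w s \<noteq> \<zero>} \<subseteq> {s. u s \<noteq> \<zero>}" using c by (auto simp: free_module_def)
  then have "lin_ext R M \<beta> ?w = (\<Oplus>\<^bsub>M\<^esub>s\<in>{s. u s \<noteq> \<zero>}. ?w s \<odot>\<^bsub>M\<^esub> \<beta> s)"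
    using fu by (intro lin_ext_superset[OF F.smult_closed[OF c u] \<beta>]) auto
  also have "\<dots> = (\<Oplus>\<^bsub>M\<^esub>s\<in>{s. u s \<noteq> \<zero>}. c \<odot>\<^bsub>M\<^esub> (u s \<odot>\<^bsub>M\<^esub> \<beta> s))"
    using uc c \<beta>u by (intro M.finsum_cong') (simp_all add: Pi_iff, simp add: free_module_def smult_assoc1)
  also have "\<dots> = c \<odot>\<^bsub>M\<^esub> lin_ext R M \<beta> u"
    unfolding lin_ext_def using fu uc c \<beta>u by (intro finsum_smult_ldistr[symmetric]) auto
  finally show "lin_ext R M \<beta> ?w = c \<odot>\<^bsub>M\<^esub> lin_ext R M \<beta> u" .
qed

lemma lin_ext_basis:
  assumes "\<And>s. s \<in> S \<Longrightarrow> \<beta> s \<in> carrier M" "s \<in> S"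
  shows "lin_ext R M \<beta> (basis_elt R s) = \<beta> s"
proof -
  have "lin_ext R M \<beta> (basis_elt R s) = (\<Oplus>\<^bsub>M\<^esub>t\<in>{s}. basis_elt R s t \<odot>\<^bsub>M\<^esub> \<beta> t)"
    using assms(2)
    by (intro lin_ext_superset[OF R.basis_elt_free[OF assms(2)] assms(1)]) (auto simp: basis_elt_def)
  also have "\<dots> = \<beta> s"
    using assms by (simp add: basis_elt_def)
  finally show ?thesis .
qed

end

section \<open>Quotients\<close>

locale quotient_module = M: module K M + N: submodule N K M for K :: "('k,'r) ring_scheme" and M :: "('k,'v) module" (structure) and N
begin

lemma abelian_subgroup_N: "abelian_subgroup N M"
  by (rule abelian_subgroupI3)
    (auto intro: additive_subgroup.intro N.subgroup_axioms M.abelian_group_axioms)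

sublocale A: abelian_subgroup N M by (rule abelian_subgroup_N)

abbreviation "proj u \<equiv> N +>\<^bsub>M\<^esub> u"

lemma carrier_quot: "carrier (quot_module M N) = proj ` carrier M"
  by (auto simp: quot_module_def A_RCOSETS_def')

lemma proj_add: "u \<in> carrier M \<Longrightarrow> v \<in> carrier M \<Longrightarrow> proj u \<oplus>\<^bsub>quot_module M N\<^esub> proj v = proj (u \<oplus> v)"
  by (simp add: quot_module_def A.a_rcos_sum)

lemma proj_eqI:
  assumes "u \<in> carrier M" "v \<in> carrier M" "u \<ominus> v \<in> N"
  shows "proj u = proj v"
proof -
  have "u \<in> proj v" using assms A.a_rcos_module[OF assms(2,1)] by (simp add: a_minus_def)
  then show ?thesis using assms A.a_repr_independence' M.M.a_repr_independence[OF _ assms(2)]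
    using N.subgroup_axioms by metis
qed

lemma proj_smult:
  assumes "c \<in> carrier K" "u \<in> carrier M"
  shows "c \<odot>\<^bsub>quot_module M N\<^esub> proj u = proj (c \<odot> u)"
proof -
  \<comment> \<open>The scalar multiple in \<open>quot_module\<close> is a union over all
    representatives; it is a single coset because every representative gives the same one.\<close>
  have "proj (c \<odot> u') = proj (c \<odot> u)" if "u' \<in> proj u" for u'
  proof -
    have u': "u' \<in> carrier M" using that assms A.a_elemrcos_carrier by blast
    have "u' \<ominus> u \<in> N" using that A.a_rcos_module[OF assms(2) u'] by (simp add: a_minus_def)
    then have "c \<odot> (u' \<ominus> u) \<in> N" using assms by auto
    also have "c \<odot> (u' \<ominus> u) = c \<odot> u' \<ominus> c \<odot> u"
      using assms u' by (simp add: a_minus_def M.smult_r_distr M.smult_r_minus)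
    finally show ?thesis using assms u' by (intro proj_eqI) auto
  qed
  moreover have "u \<in> proj u" using assms A.a_rcos_self by blast
  ultimately have "(\<Union>u'\<in>proj u. proj (c \<odot> u')) = proj (c \<odot> u)" by blast
  then show ?thesis by (simp add: quot_module_def)
qed

lemma proj_zero: "\<zero>\<^bsub>quot_module M N\<^esub> = proj \<zero>"
  using N.subset by (simp add: quot_module_def)

lemma module_quot: "module K (quot_module M N)"
proof (rule moduleI, rule M.R.is_cring, rule abelian_groupI)
  fix U assume "U \<in> carrier (quot_module M N)"
  then obtain u where u: "u \<in> carrier M" "U = proj u" by (auto simp: carrier_quot)
  then have "proj (\<ominus> u) \<oplus>\<^bsub>quot_module M N\<^esub> U = \<zero>\<^bsub>quot_module M N\<^esub>"
    by (simp add: proj_add proj_zero M.l_neg)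
  then show "\<exists>W\<in>carrier (quot_module M N). W \<oplus>\<^bsub>quot_module M N\<^esub> U = \<zero>\<^bsub>quot_module M N\<^esub>"
    using u by (auto simp: carrier_quot)
qed (auto simp: carrier_quot proj_add proj_smult proj_zero M.M.a_ac M.smult_l_distr M.smult_r_distr
       M.smult_assoc1)

end

section \<open>Tensor products\<close>

definition bilinear_maps ::
  "('k,'r) ring_scheme \<Rightarrow> ('k,'m) module \<Rightarrow> ('k,'n) module \<Rightarrow> ('k,'p) module \<Rightarrow> ('m \<Rightarrow> 'n \<Rightarrow> 'p) set" where
  "bilinear_maps K M N P = {\<beta>. (\<forall>m\<in>carrier M. \<beta> m \<in> lin_maps K N P) \<and>
     (\<forall>n\<in>carrier N. (\<lambda>m. \<beta> m n) \<in> lin_maps K M P)}"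

lemma bilinearI:
  assumes "\<And>m. m \<in> carrier M \<Longrightarrow> (\<lambda>n. \<beta> m n) \<in> lin_maps K N P"
    and "\<And>n. n \<in> carrier N \<Longrightarrow> (\<lambda>m. \<beta> m n) \<in> lin_maps K M P"
  shows "\<beta> \<in> bilinear_maps K M N P"
  using assms by (simp add: bilinear_maps_def)

lemma bilinear_right: "\<beta> \<in> bilinear_maps K M N P \<Longrightarrow> m \<in> carrier M \<Longrightarrow> \<beta> m \<in> lin_maps K N P"
  by (simp add: bilinear_maps_def)

lemma bilinear_left:
  "\<beta> \<in> bilinear_maps K M N P \<Longrightarrow> n \<in> carrier N \<Longrightarrow> (\<lambda>m. \<beta> m n) \<in> lin_maps K M P"
  by (simp add: bilinear_maps_def)

lemma bilinear_closed:
  "\<beta> \<in> bilinear_maps K M N P \<Longrightarrow> m \<in> carrier M \<Longrightarrow> n \<in> carrier N \<Longrightarrow> \<beta> m n \<in> carrier P"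
  using bilinear_right lin_closed by metis

lemma bilinear_compose:
  "\<beta> \<in> bilinear_maps K M' N' P \<Longrightarrow> h \<in> lin_maps K M M' \<Longrightarrow> h' \<in> lin_maps K N N' \<Longrightarrow>
   (\<lambda>m n. \<beta> (h m) (h' n)) \<in> bilinear_maps K M N P"
  by (intro bilinearI)
    (auto intro: lin_comp[OF _ bilinear_right] lin_comp[OF _ bilinear_left] lin_closed)

lemma bilinear_into:
  "\<beta> \<in> bilinear_maps K M N P \<Longrightarrow> h \<in> lin_maps K P Q \<Longrightarrow> (\<lambda>m n. h (\<beta> m n)) \<in> bilinear_maps K M N Q"
  by (intro bilinearI)
    (auto intro: lin_comp[OF bilinear_right] lin_comp[OF bilinear_left])

lemma bilinear_cong:
  assumes "\<beta> \<in> bilinear_maps K M N P" "module K M" "module K N"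
    "\<And>m n. m \<in> carrier M \<Longrightarrow> n \<in> carrier N \<Longrightarrow> \<beta>' m n = \<beta> m n"
  shows "\<beta>' \<in> bilinear_maps K M N P"
  by (intro bilinearI)
    (auto intro: lin_cong[OF bilinear_right] lin_cong[OF bilinear_left] assms)

lemma bilinear_smult_left:
  assumes "module K M"
  shows "(\<lambda>c v. c \<odot>\<^bsub>M\<^esub> v) \<in> bilinear_maps K (self_module K) M M"
proof (rule bilinearI)
  fix c assume "c \<in> carrier (self_module K)"
  then show "(\<lambda>v. c \<odot>\<^bsub>M\<^esub> v) \<in> lin_maps K M M"
    using lin_scale[OF assms lin_ident] by (simp add: self_module_def)
qed (rule lin_smult_left[OF assms])

lemma bilinear_smult_right:
  assumes "module K M"
  shows "(\<lambda>v c. c \<odot>\<^bsub>M\<^esub> v) \<in> bilinear_maps K M (self_module K) M"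
  using bilinear_smult_left[OF assms] by (simp add: bilinear_maps_def)

text \<open>Covers both kinds of tensor product at once: over \<open>K\<close>, with scalars acting
  on either side, and over the group algebra of \<open>A_x\<close>, as in the summands of
  \<open>f_!\<close>.\<close>

locale balanced_tensor = M: module K M + N: module K N
  for K :: "('k,'r) ring_scheme" and M :: "('k,'m) module" and N :: "('k,'n) module" +
  fixes A :: "'a set" and ract :: "'m \<Rightarrow> 'a \<Rightarrow> 'm" and lact :: "'a \<Rightarrow> 'n \<Rightarrow> 'n"
  assumes ract_closed: "m \<in> carrier M \<Longrightarrow> r \<in> A \<Longrightarrow> ract m r \<in> carrier M"
    and lact_closed: "n \<in> carrier N \<Longrightarrow> r \<in> A \<Longrightarrow> lact r n \<in> carrier N"
begin

abbreviation "F \<equiv> free_module K (carrier M \<times> carrier N)"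
abbreviation "Rel \<equiv> tensor_rel K M N A ract lact"
abbreviation "T \<equiv> tensor_over K M N A ract lact"
abbreviation "pure \<equiv> pure_over K M N A ract lact"

sublocale F: module K F by (rule module_free) (rule M.R.is_cring)

abbreviation "b m n \<equiv> basis_elt K (m, n)"

definition gens :: "('m \<times> 'n \<Rightarrow> 'k) set" where
  "gens = {b (m \<oplus>\<^bsub>M\<^esub> m') n \<ominus>\<^bsub>F\<^esub> (b m n \<oplus>\<^bsub>F\<^esub> b m' n) | m m' n.
        m \<in> carrier M \<and> m' \<in> carrier M \<and> n \<in> carrier N}
      \<union> {b m (n \<oplus>\<^bsub>N\<^esub> n') \<ominus>\<^bsub>F\<^esub> (b m n \<oplus>\<^bsub>F\<^esub> b m n') | m n n'.
        m \<in> carrier M \<and> n \<in> carrier N \<and> n' \<in> carrier N}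
      \<union> {b (c \<odot>\<^bsub>M\<^esub> m) n \<ominus>\<^bsub>F\<^esub> c \<odot>\<^bsub>F\<^esub> b m n | c m n.
        c \<in> carrier K \<and> m \<in> carrier M \<and> n \<in> carrier N}
      \<union> {b m (c \<odot>\<^bsub>N\<^esub> n) \<ominus>\<^bsub>F\<^esub> c \<odot>\<^bsub>F\<^esub> b m n | c m n.
        c \<in> carrier K \<and> m \<in> carrier M \<and> n \<in> carrier N}
      \<union> {b (ract m r) n \<ominus>\<^bsub>F\<^esub> b m (lact r n) | m r n.
        m \<in> carrier M \<and> r \<in> A \<and> n \<in> carrier N}"

lemma rel_eq_mspan: "Rel = mspan K F gens"
  by (simp add: tensor_rel_def Let_def gens_def)

lemma b_closed: "m \<in> carrier M \<Longrightarrow> n \<in> carrier N \<Longrightarrow> b m n \<in> carrier F"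
  by (intro M.R.basis_elt_free) simp

lemma gens_closed: "gens \<subseteq> carrier F"
  unfolding gens_def
  by (intro Un_least) (auto intro!: F.M.minus_closed b_closed ract_closed lact_closed)

lemma rel_gens:
  "m \<in> carrier M \<Longrightarrow> m' \<in> carrier M \<Longrightarrow> n \<in> carrier N \<Longrightarrow>
     b (m \<oplus>\<^bsub>M\<^esub> m') n \<ominus>\<^bsub>F\<^esub> (b m n \<oplus>\<^bsub>F\<^esub> b m' n) \<in> Rel"
  "m \<in> carrier M \<Longrightarrow> n \<in> carrier N \<Longrightarrow> n' \<in> carrier N \<Longrightarrow>
     b m (n \<oplus>\<^bsub>N\<^esub> n') \<ominus>\<^bsub>F\<^esub> (b m n \<oplus>\<^bsub>F\<^esub> b m n') \<in> Rel"
  "c \<in> carrier K \<Longrightarrow> m \<in> carrier M \<Longrightarrow> n \<in> carrier N \<Longrightarrow> b (c \<odot>\<^bsub>M\<^esub> m) n \<ominus>\<^bsub>F\<^esub> c \<odot>\<^bsub>F\<^esub> b m n \<in> Rel"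
  "c \<in> carrier K \<Longrightarrow> m \<in> carrier M \<Longrightarrow> n \<in> carrier N \<Longrightarrow> b m (c \<odot>\<^bsub>N\<^esub> n) \<ominus>\<^bsub>F\<^esub> c \<odot>\<^bsub>F\<^esub> b m n \<in> Rel"
  "m \<in> carrier M \<Longrightarrow> r \<in> A \<Longrightarrow> n \<in> carrier N \<Longrightarrow> b (ract m r) n \<ominus>\<^bsub>F\<^esub> b m (lact r n) \<in> Rel"
  unfolding rel_eq_mspan gens_def
  by (rule subsetD[OF mspan_superset], rule UnI1, rule UnI1, rule UnI1, rule UnI1, blast)
    (rule subsetD[OF mspan_superset], rule UnI1, rule UnI1, rule UnI1, rule UnI2, blast,
     rule subsetD[OF mspan_superset], rule UnI1, rule UnI1, rule UnI2, blast,
     rule subsetD[OF mspan_superset], rule UnI1, rule UnI2, blast,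
     rule subsetD[OF mspan_superset], rule UnI2, blast)

text \<open>Bilinearity kills the first four families of generators and balance the fifth. Only the
  values of \<open>h\<close> on basis elements are constrained, which is all that a linear extension
  provides.\<close>

lemma gens_vanish:
  assumes P: "module K P" and h: "h \<in> lin_maps K F P" and g: "g \<in> gens"
    and bil: "(\<lambda>m n. h (b m n)) \<in> bilinear_maps K M N P"
    and bal: "\<And>m r n. m \<in> carrier M \<Longrightarrow> r \<in> A \<Longrightarrow> n \<in> carrier N \<Longrightarrow>
         h (b (ract m r) n) = h (b m (lact r n))"
  shows "h g = \<zero>\<^bsub>P\<^esub>"
proof -
  interpret P: module K P by fact
  note [simp] = lin_minus[OF F.module_axioms P h] lin_add[OF h] lin_smult[OF h]
    lin_closed[OF h b_closed] b_closed P.minus_self bal ract_closed lact_closed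
    lin_add[OF bilinear_left[OF bil]] lin_smult[OF bilinear_left[OF bil]]
    lin_add[OF bilinear_right[OF bil]] lin_smult[OF bilinear_right[OF bil]]
  from g show "h g = \<zero>\<^bsub>P\<^esub>"
    unfolding gens_def by (elim UnE) auto
qed

sublocale Q: quotient_module K F Rel
  unfolding rel_eq_mspan
  by (intro quotient_module.intro F.module_axioms submodule_mspan gens_closed)

lemma pure_eq_proj: "pure m n = Q.proj (basis_elt K (m, n))"
  by (simp add: pure_over_def)

lemma module_tensor_over: "module K T"
  unfolding tensor_over_def by (rule Q.module_quot)

lemma proj_add': "u \<in> carrier F \<Longrightarrow> v \<in> carrier F \<Longrightarrow> Q.proj u \<oplus>\<^bsub>T\<^esub> Q.proj v = Q.proj (u \<oplus>\<^bsub>F\<^esub> v)"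
  unfolding tensor_over_def by (rule Q.proj_add)

lemma proj_smult': "c \<in> carrier K \<Longrightarrow> u \<in> carrier F \<Longrightarrow> c \<odot>\<^bsub>T\<^esub> Q.proj u = Q.proj (c \<odot>\<^bsub>F\<^esub> u)"
  unfolding tensor_over_def by (rule Q.proj_smult)

lemma pure_closed: "m \<in> carrier M \<Longrightarrow> n \<in> carrier N \<Longrightarrow> pure m n \<in> carrier T"
  by (simp add: pure_eq_proj tensor_over_def Q.carrier_quot b_closed)

lemma pure_bilinear: "pure \<in> bilinear_maps K M N T"
  by (rule bilinearI; rule linI)
    (simp_all add: pure_closed, simp_all add: pure_eq_proj proj_add' proj_smult' b_closed,
      (rule Q.proj_eqI; simp add: b_closed rel_gens)+)

lemma pure_balanced:
  assumes "m \<in> carrier M" "r \<in> A" "n \<in> carrier N"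
  shows "pure (ract m r) n = pure m (lact r n)"
  unfolding pure_eq_proj
  by (rule Q.proj_eqI) (use assms in \<open>simp_all add: b_closed ract_closed lact_closed rel_gens\<close>)

text \<open>Scalars are absorbed into the left factor, so every element is a plain sum of pure
  tensors and the induction step needs no coefficient.\<close>

lemma tensor_over_induct [consumes 1, case_names zero add]:
  assumes "t \<in> carrier T" "Q \<zero>\<^bsub>T\<^esub>"
    and step: "\<And>m n t. \<lbrakk>m \<in> carrier M; n \<in> carrier N; t \<in> carrier T; Q t\<rbrakk> \<Longrightarrow> Q (pure m n \<oplus>\<^bsub>T\<^esub> t)"
  shows "Q t"
proof -
  obtain u where u: "u \<in> carrier F" and t: "t = Q.proj u"
    using assms(1) by (auto simp: tensor_over_def Q.carrier_quot)
  from u have "Q (Q.proj u)"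
  proof (induction rule: M.R.free_module_induct)
    case zero
    then show ?case using assms(2) Q.proj_zero by (simp add: tensor_over_def)
  next
    case (add c s v)
    obtain m n where s: "s = (m, n)" "m \<in> carrier M" "n \<in> carrier N" using add(2) by auto
    have "Q (pure (c \<odot>\<^bsub>M\<^esub> m) n \<oplus>\<^bsub>T\<^esub> Q.proj v)"
      using add s by (intro step) (auto simp: tensor_over_def Q.carrier_quot)
    moreover have "pure (c \<odot>\<^bsub>M\<^esub> m) n = Q.proj (c \<odot>\<^bsub>F\<^esub> basis_elt K s)"
      using add s lin_smult[OF bilinear_left[OF pure_bilinear]]
      by (simp add: pure_eq_proj proj_smult' b_closed)
    ultimately show ?case using add s by (simp add: proj_add' b_closed)
  qed
  then show ?thesis by (simp add: t)
qed

lemma lin_eq_tensor_over: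
  assumes "module K P" "h \<in> lin_maps K T P" "h' \<in> lin_maps K T P"
    and "\<And>m n. m \<in> carrier M \<Longrightarrow> n \<in> carrier N \<Longrightarrow> h (pure m n) = h' (pure m n)"
    and "t \<in> carrier T"
  shows "h t = h' t"
  using assms(5)
proof (induction rule: tensor_over_induct)
  case zero
  then show ?case using assms(1-3) lin_zero module_tensor_over by metis
next
  case (add m n t)
  then show ?case using assms(4)
    by (simp add: pure_closed lin_add[OF assms(2)] lin_add[OF assms(3)])
qed

context
  fixes P :: "('k,'p) module" and \<beta> :: "'m \<Rightarrow> 'n \<Rightarrow> 'p"
  assumes P: "module K P" and bil: "\<beta> \<in> bilinear_maps K M N P"
    and bal: "\<forall>m\<in>carrier M. \<forall>r\<in>A. \<forall>n\<in>carrier N. \<beta> (ract m r) n = \<beta> m (lact r n)"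
begin

text \<open>The linear extension of \<open>\<beta>\<close> vanishes on the relations, so its image
  over a coset is a singleton and \<open>the_elem\<close> in \<open>tensor_lift\<close> returns the
  value at any representative.\<close>

lemma tensor_lift_proj:
  assumes "u \<in> carrier F"
  shows "tensor_lift K P \<beta> (Q.proj u) = lin_ext K P (\<lambda>s. \<beta> (fst s) (snd s)) u"
    (is "_ = ?h u")
proof -
  interpret P: module K P by (rule P)
  have \<beta>: "\<beta> (fst s) (snd s) \<in> carrier P" if "s \<in> carrier M \<times> carrier N" for s
    using that by (auto intro: bilinear_closed[OF bil])
  have h: "?h \<in> lin_maps K F P" by (rule lin_ext_linear[OF P \<beta>])
  have hb: "?h (basis_elt K (m, n)) = \<beta> m n" if "m \<in> carrier M" "n \<in> carrier N" for m n
    using lin_ext_basis[OF P \<beta>, where s = "(m, n)"] that by simp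
  have van: "?h u = \<zero>\<^bsub>P\<^esub>" if u: "u \<in> Rel" for u
  proof (rule lin_vanish_mspan[OF F.module_axioms P h gens_closed])
    show "u \<in> mspan K F gens" using u by (simp add: rel_eq_mspan)
    fix g assume "g \<in> gens"
    then show "?h g = \<zero>\<^bsub>P\<^esub>"
      by (rule gens_vanish[OF P h])
        (use hb bal ract_closed lact_closed in
          \<open>auto intro: bilinear_cong[OF bil M.module_axioms N.module_axioms]\<close>)
  qed
  have "?h u' = ?h u" if u': "u' \<in> Q.proj u" for u'
  proof -
    have u'c: "u' \<in> carrier F" using u' assms Q.A.a_elemrcos_carrier by blast
    have "u' \<ominus>\<^bsub>F\<^esub> u \<in> Rel" using u' Q.A.a_rcos_module[OF assms u'c] by (simp add: a_minus_def)
    then have "?h u' \<ominus>\<^bsub>P\<^esub> ?h u = \<zero>\<^bsub>P\<^esub>"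
      using van lin_minus[OF F.module_axioms P h u'c assms] by simp
    then show ?thesis
      using P.minus_eq_zeroD lin_closed[OF h] u'c assms by blast
  qed
  then have "?h ` Q.proj u = {?h u}" using Q.A.a_rcos_self[OF assms] by blast
  then show ?thesis by (simp add: tensor_lift_def lin_ext_def)
qed

lemma tensor_lift_linear: "tensor_lift K P \<beta> \<in> lin_maps K T P"
proof -
  have h: "lin_ext K P (\<lambda>s. \<beta> (fst s) (snd s)) \<in> lin_maps K F P"
    by (rule lin_ext_linear[OF P]) (auto intro: bilinear_closed[OF bil])
  show ?thesis
  proof (rule linI)
    fix t assume "t \<in> carrier T"
    then obtain u where u: "u \<in> carrier F" "t = Q.proj u"
      by (auto simp: tensor_over_def Q.carrier_quot)
    then show "tensor_lift K P \<beta> t \<in> carrier P"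
      by (simp add: tensor_lift_proj lin_closed[OF h])
    { fix c assume "c \<in> carrier K"
      then show "tensor_lift K P \<beta> (c \<odot>\<^bsub>T\<^esub> t) = c \<odot>\<^bsub>P\<^esub> tensor_lift K P \<beta> t"
        using u by (simp add: tensor_lift_proj proj_smult' lin_smult[OF h]) }
    fix t' assume "t' \<in> carrier T"
    then obtain u' where u': "u' \<in> carrier F" "t' = Q.proj u'"
      by (auto simp: tensor_over_def Q.carrier_quot)
    then show "tensor_lift K P \<beta> (t \<oplus>\<^bsub>T\<^esub> t') = tensor_lift K P \<beta> t \<oplus>\<^bsub>P\<^esub> tensor_lift K P \<beta> t'"
      using u by (simp add: tensor_lift_proj proj_add' lin_add[OF h])
  qed
qed

lemma tensor_lift_pure:
  assumes "m \<in> carrier M" "n \<in> carrier N"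
  shows "tensor_lift K P \<beta> (pure m n) = \<beta> m n"
  using assms lin_ext_basis[OF P, of "carrier M \<times> carrier N" "\<lambda>s. \<beta> (fst s) (snd s)" "(m, n)"]
    bilinear_closed[OF bil]
  by (auto simp: pure_eq_proj tensor_lift_proj b_closed)

end

end

section \<open>Tensor products over the ground field\<close>

context
  fixes K :: "('k,'r) ring_scheme" and M :: "('k,'m) module" and N :: "('k,'n) module"
  assumes M: "module K M" and N: "module K N"
begin

interpretation M: module K M by (rule M)
interpretation N: module K N by (rule N)

interpretation balanced_tensor K M N "carrier K" "\<lambda>m c. c \<odot>\<^bsub>M\<^esub> m" "\<lambda>c n. c \<odot>\<^bsub>N\<^esub> n"
  by unfold_locales auto

lemma module_tensor: "module K (tensor K M N)"
  unfolding tensor_def by (rule module_tensor_over)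

lemma pure_tensor_bilinear: "pure_tensor K M N \<in> bilinear_maps K M N (tensor K M N)"
  unfolding tensor_def pure_tensor_def by (rule pure_bilinear)

lemma lin_eq_tensor:
  assumes "module K P" "h \<in> lin_maps K (tensor K M N) P" "h' \<in> lin_maps K (tensor K M N) P"
    and "\<And>m n. m \<in> carrier M \<Longrightarrow> n \<in> carrier N \<Longrightarrow> h (pure_tensor K M N m n) = h' (pure_tensor K M N m n)"
    and "t \<in> carrier (tensor K M N)"
  shows "h t = h' t"
  using assms unfolding tensor_def pure_tensor_def by (rule lin_eq_tensor_over)

lemma tensor_lift_tensor:
  assumes "module K P" "\<beta> \<in> bilinear_maps K M N P"
  shows "tensor_lift K P \<beta> \<in> lin_maps K (tensor K M N) P"
    and "\<And>m n. m \<in> carrier M \<Longrightarrow> n \<in> carrier N \<Longrightarrow> tensor_lift K P \<beta> (pure_tensor K M N m n) = \<beta> m n"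
proof -
  \<comment> \<open>Over \<open>K\<close> itself balance is a consequence of bilinearity.\<close>
  have bal: "\<forall>m\<in>carrier M. \<forall>c\<in>carrier K. \<forall>n\<in>carrier N. \<beta> (c \<odot>\<^bsub>M\<^esub> m) n = \<beta> m (c \<odot>\<^bsub>N\<^esub> n)"
    using lin_smult[OF bilinear_left[OF assms(2)]]
      lin_smult[OF bilinear_right[OF assms(2)]] by simp
  show "tensor_lift K P \<beta> \<in> lin_maps K (tensor K M N) P"
    unfolding tensor_def by (rule tensor_lift_linear[OF assms bal])
  show "tensor_lift K P \<beta> (pure_tensor K M N m n) = \<beta> m n"
    if "m \<in> carrier M" "n \<in> carrier N" for m n
    unfolding pure_tensor_def by (rule tensor_lift_pure[OF assms bal that])
qed

end

lemma tensor_map_linear: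
  assumes "module K M" "module K N" "module K M'" "module K N'"
    and "h \<in> lin_maps K M M'" "h' \<in> lin_maps K N N'"
  shows "tensor_map K M' N' h h' \<in> lin_maps K (tensor K M N) (tensor K M' N')"
    and "\<And>m n. m \<in> carrier M \<Longrightarrow> n \<in> carrier N \<Longrightarrow>
      tensor_map K M' N' h h' (pure_tensor K M N m n) = pure_tensor K M' N' (h m) (h' n)"
  unfolding tensor_map_def
  using tensor_lift_tensor[OF assms(1,2) module_tensor[OF assms(3,4)]
      bilinear_compose[OF pure_tensor_bilinear[OF assms(3,4)] assms(5,6)]]
  by blast+

lemma unitor_r_linear:
  assumes "module K M"
  shows "unitor_r K M \<in> lin_maps K (tensor K M (self_module K)) M"
    and "\<And>v c. v \<in> carrier M \<Longrightarrow> c \<in> carrier K \<Longrightarrow>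
      unitor_r K M (pure_tensor K M (self_module K) v c) = c \<odot>\<^bsub>M\<^esub> v"
proof -
  interpret M: module K M by fact
  note * = tensor_lift_tensor[OF assms module_self[OF M.R.is_cring] assms bilinear_smult_right[OF assms]]
  show "unitor_r K M \<in> lin_maps K (tensor K M (self_module K)) M"
    unfolding unitor_r_def by (rule *)
  show "unitor_r K M (pure_tensor K M (self_module K) v c) = c \<odot>\<^bsub>M\<^esub> v"
    if "v \<in> carrier M" "c \<in> carrier K" for v c
    unfolding unitor_r_def using that by (intro *) (auto simp: self_module_def)
qed

lemma unitor_l_pure:
  assumes "module K M" "v \<in> carrier M" "c \<in> carrier K"
  shows "unitor_l K M (pure_tensor K (self_module K) M c v) = c \<odot>\<^bsub>M\<^esub> v"
proof -
  interpret M: module K M by fact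
  show ?thesis
    unfolding unitor_l_def using assms(2,3)
    by (intro tensor_lift_tensor[OF module_self[OF M.R.is_cring] assms(1) assms(1)
      bilinear_smult_left[OF assms(1)]]) (auto simp: self_module_def)
qed

section \<open>Group algebras\<close>

definition group_rep :: "('k,'r) ring_scheme \<Rightarrow> ('g,'s) monoid_scheme \<Rightarrow> ('k,'v) module \<Rightarrow> ('g \<Rightarrow> 'v \<Rightarrow> 'v) \<Rightarrow> bool" where
  "group_rep K G M \<sigma> \<longleftrightarrow> module K M \<and> (\<forall>g\<in>carrier G. \<sigma> g \<in> lin_maps K M M) \<and>
     (\<forall>v\<in>carrier M. \<sigma> \<one>\<^bsub>G\<^esub> v = v) \<and>
     (\<forall>g\<in>carrier G. \<forall>h\<in>carrier G. \<forall>v\<in>carrier M. \<sigma> (g \<otimes>\<^bsub>G\<^esub> h) v = \<sigma> g (\<sigma> h v))"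

locale finite_group_algebra = K: cring K + G: group G
  for K :: "('k,'r) ring_scheme" and G :: "('g,'s) monoid_scheme" +
  assumes fin: "finite (carrier G)"
begin

abbreviation "kG \<equiv> group_algebra K G"

lemma ga_free: "carrier kG = carrier (free_module K (carrier G))"
  "add kG = add (free_module K (carrier G))" "smult kG = smult (free_module K (carrier G))"
  "zero kG = zero (free_module K (carrier G))"
  by (simp_all add: group_algebra_def)

lemma mem_kG: "r \<in> carrier kG \<longleftrightarrow> (\<forall>g. r g \<in> carrier K) \<and> (\<forall>g. g \<notin> carrier G \<longrightarrow> r g = \<zero>\<^bsub>K\<^esub>)"
proof -
  have "finite {g. r g \<noteq> \<zero>\<^bsub>K\<^esub>}" if "{g. r g \<noteq> \<zero>\<^bsub>K\<^esub>} \<subseteq> carrier G"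
    using finite_subset[OF that fin] .
  then show ?thesis by (auto simp: ga_free free_module_def)
qed

lemma kG_val: "r \<in> carrier kG \<Longrightarrow> r g \<in> carrier K"
  by (simp add: mem_kG)

lemma kG_add: "(r \<oplus>\<^bsub>kG\<^esub> s) g = r g \<oplus>\<^bsub>K\<^esub> s g"
  by (simp add: group_algebra_def free_module_def)

lemma kG_smult: "(c \<odot>\<^bsub>kG\<^esub> s) g = c \<otimes>\<^bsub>K\<^esub> s g"
  by (simp add: group_algebra_def free_module_def)

text \<open>\<open>lin_maps\<close> reads only the linear fields of the record, and in those the
  group algebra is the free module on the group. Facts on free modules therefore transfer.\<close>

lemma lin_kG: "lin_maps K kG N = lin_maps K (free_module K (carrier G)) N"
  by (simp add: lin_maps_def ga_free)

lemma module_kG: "module K kG"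
proof -
  interpret F: module K "free_module K (carrier G)" by (rule module_free) (rule K.is_cring)
  show ?thesis
  proof (rule moduleI, rule K.is_cring, rule abelian_groupI)
    fix u assume "u \<in> carrier kG"
    then show "\<exists>v\<in>carrier kG. v \<oplus>\<^bsub>kG\<^esub> u = \<zero>\<^bsub>kG\<^esub>"
      by (intro bexI[of _ "\<ominus>\<^bsub>free_module K (carrier G)\<^esub> u"]) (simp_all add: ga_free F.M.l_neg)
  qed (simp_all add: ga_free F.M.a_ac F.smult_l_distr F.smult_r_distr F.smult_assoc1)
qed

lemma basis_kG: "g \<in> carrier G \<Longrightarrow> basis_elt K g \<in> carrier kG"
  by (simp add: ga_free K.basis_elt_free)

lemma lin_eq_kG:
  assumes "module K N" "h \<in> lin_maps K kG N" "h' \<in> lin_maps K kG N"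
    and "\<And>g. g \<in> carrier G \<Longrightarrow> h (basis_elt K g) = h' (basis_elt K g)"
    and "r \<in> carrier kG"
  shows "h r = h' r"
  using lin_eq_free[OF assms(1), of h "carrier G" h' r] assms(2-5)
  by (simp add: lin_kG ga_free)

lemma kG_lin_into:
  assumes "\<And>v g. v \<in> carrier M \<Longrightarrow> h v g \<in> carrier K"
    and "\<And>v g. v \<in> carrier M \<Longrightarrow> g \<notin> carrier G \<Longrightarrow> h v g = \<zero>\<^bsub>K\<^esub>"
    and "\<And>u v g. u \<in> carrier M \<Longrightarrow> v \<in> carrier M \<Longrightarrow> h (u \<oplus>\<^bsub>M\<^esub> v) g = h u g \<oplus>\<^bsub>K\<^esub> h v g"
    and "\<And>c v g. c \<in> carrier K \<Longrightarrow> v \<in> carrier M \<Longrightarrow> h (c \<odot>\<^bsub>M\<^esub> v) g = c \<otimes>\<^bsub>K\<^esub> h v g"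
  shows "h \<in> lin_maps K M kG"
  using assms by (intro linI ext) (auto simp: mem_kG kG_add kG_smult)

lemma kG_mult: "(r \<otimes>\<^bsub>kG\<^esub> s) c =
  (\<Oplus>\<^bsub>K\<^esub>p\<in>{p \<in> carrier G \<times> carrier G. fst p \<otimes>\<^bsub>G\<^esub> snd p = c}. r (fst p) \<otimes>\<^bsub>K\<^esub> s (snd p))"
  by (simp add: group_algebra_def)

lemma kG_mult_bilinear: "(\<lambda>r s. r \<otimes>\<^bsub>kG\<^esub> s) \<in> bilinear_maps K kG kG kG"
proof -
  have fin': "finite {p \<in> carrier G \<times> carrier G. fst p \<otimes>\<^bsub>G\<^esub> snd p = c}" for c
    using fin by simp
  \<comment> \<open>Elements of the group algebra must vanish off the group; a convolution does so
    because its index set is empty there.\<close>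
  have out: "{p \<in> carrier G \<times> carrier G. fst p \<otimes>\<^bsub>G\<^esub> snd p = c} = {}" if "c \<notin> carrier G" for c
    using that by auto
  show ?thesis
    by (rule bilinearI; rule kG_lin_into)
      (auto simp: kG_mult kG_add kG_smult out kG_val K.l_distr K.r_distr K.finsum_addf Pi_iff
        K.finsum_rdistr[OF fin'] K.finsum_closed K.m_assoc K.m_lcomm intro!: K.finsum_cong')
qed

lemma kG_mult_closed: "r \<in> carrier kG \<Longrightarrow> s \<in> carrier kG \<Longrightarrow> r \<otimes>\<^bsub>kG\<^esub> s \<in> carrier kG"
  by (rule bilinear_closed[OF kG_mult_bilinear])

lemma kG_basis_mult:
  assumes "g \<in> carrier G" "h \<in> carrier G"
  shows "basis_elt K g \<otimes>\<^bsub>kG\<^esub> basis_elt K h = basis_elt K (g \<otimes>\<^bsub>G\<^esub> h)"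
proof
  fix c
  let ?S = "{p \<in> carrier G \<times> carrier G. fst p \<otimes>\<^bsub>G\<^esub> snd p = c}"
  \<comment> \<open>A product of two indicators is the indicator of the pair \<open>(g, h)\<close>,
    so the convolution only asks whether that pair multiplies to \<open>c\<close>.\<close>
  have "(basis_elt K g \<otimes>\<^bsub>kG\<^esub> basis_elt K h) c = (\<Oplus>\<^bsub>K\<^esub>p\<in>?S. basis_elt K (g, h) p)"
    unfolding kG_mult by (intro K.finsum_cong') (auto simp: basis_elt_def)
  then show "(basis_elt K g \<otimes>\<^bsub>kG\<^esub> basis_elt K h) c = basis_elt K (g \<otimes>\<^bsub>G\<^esub> h) c"
    using assms fin by (simp add: K.finsum_basis_elt) (auto simp: basis_elt_def)
qed

lemma kG_one: "\<one>\<^bsub>kG\<^esub> = basis_elt K \<one>\<^bsub>G\<^esub>"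
  by (simp add: group_algebra_def)

context
  fixes M :: "('k,'v) module" and \<sigma> :: "'g \<Rightarrow> 'v \<Rightarrow> 'v"
  assumes rep: "group_rep K G M \<sigma>"
begin

interpretation M: module K M using rep by (simp add: group_rep_def)

lemma group_algebra_act_bilinear: "group_algebra_act G M \<sigma> \<in> bilinear_maps K kG M M"
proof (rule bilinearI)
  have \<sigma>: "\<sigma> g \<in> lin_maps K M M" if "g \<in> carrier G" for g using rep that by (simp add: group_rep_def)
  note [simp] = lin_closed[OF \<sigma>]
  { fix r assume "r \<in> carrier kG"
    then show "group_algebra_act G M \<sigma> r \<in> lin_maps K M M"
      unfolding group_algebra_act_def[abs_def]
      by (intro lin_sum[OF M.module_axioms fin _ M.module_axioms] lin_scale[OF M.module_axioms \<sigma>])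
        (auto simp: kG_val) }
  fix v assume v: "v \<in> carrier M"
  have "(\<lambda>r. r g \<odot>\<^bsub>M\<^esub> \<sigma> g v) \<in> lin_maps K kG M" if "g \<in> carrier G" for g
    using that v by (intro linI)
      (auto simp: kG_val kG_add kG_smult M.smult_l_distr M.smult_assoc1)
  then show "(\<lambda>r. group_algebra_act G M \<sigma> r v) \<in> lin_maps K kG M"
    unfolding group_algebra_act_def
    by (intro lin_sum[OF M.module_axioms fin _ module_kG])
qed

lemma group_algebra_act_basis:
  assumes "g \<in> carrier G" "v \<in> carrier M"
  shows "group_algebra_act G M \<sigma> (basis_elt K g) v = \<sigma> g v"
proof -
  have \<sigma>: "\<sigma> g v \<in> carrier M" if "g \<in> carrier G" for g
    using rep that assms(2) by (auto simp: group_rep_def intro: lin_closed)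
  have "group_algebra_act G M \<sigma> (basis_elt K g) v = (\<Oplus>\<^bsub>M\<^esub>h\<in>carrier G. if g = h then \<sigma> h v else \<zero>\<^bsub>M\<^esub>)"
    unfolding group_algebra_act_def by (intro M.finsum_cong') (auto simp: basis_elt_def \<sigma>)
  also have "\<dots> = \<sigma> g v"
    using assms(1) fin by (intro M.finsum_singleton) (auto simp: \<sigma>)
  finally show ?thesis .
qed

end

end

lemma group_algebra_map_linear:
  assumes "finite_group_algebra K H" "finite_group_algebra K G" "h \<in> carrier H \<rightarrow> carrier G"
  shows "group_algebra_map K H h \<in> lin_maps K (group_algebra K H) (group_algebra K G)"
proof -
  interpret H: finite_group_algebra K H by fact
  interpret G: finite_group_algebra K G by fact
  have fin': "finite {a \<in> carrier H. h a = b}" for b using H.fin by simp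
  have out: "{a \<in> carrier H. h a = b} = {}" if "b \<notin> carrier G" for b using that assms(3) by auto
  show ?thesis
    by (rule G.kG_lin_into)
      (auto simp: group_algebra_map_def H.kG_val H.kG_add H.kG_smult out H.K.finsum_addf Pi_iff
        H.K.finsum_rdistr[OF fin'] H.K.finsum_closed)
qed

lemma group_algebra_map_basis:
  assumes "finite_group_algebra K H" "a \<in> carrier H"
  shows "group_algebra_map K H h (basis_elt K a) = basis_elt K (h a)"
proof
  interpret H: finite_group_algebra K H by fact
  show "group_algebra_map K H h (basis_elt K a) b = basis_elt K (h a) b" for b
    using assms(2) H.fin
    by (simp add: group_algebra_map_def H.K.finsum_basis_elt) (auto simp: basis_elt_def)
qed

section \<open>Direct sums\<close>

lemma mem_dsum: "t \<in> carrier (dsum I M) \<longleftrightarrow> t \<in> extensional I \<and> (\<forall>i\<in>I. t i \<in> carrier (M i))"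
  by (auto simp: dsum_def PiE_iff)

lemma dsum_ops:
  "t \<oplus>\<^bsub>dsum I M\<^esub> u = (\<lambda>i\<in>I. t i \<oplus>\<^bsub>M i\<^esub> u i)"
  "c \<odot>\<^bsub>dsum I M\<^esub> t = (\<lambda>i\<in>I. c \<odot>\<^bsub>M i\<^esub> t i)"
  "\<zero>\<^bsub>dsum I M\<^esub> = (\<lambda>i\<in>I. \<zero>\<^bsub>M i\<^esub>)"
  by (simp_all add: dsum_def)

lemma dsum_component: "t \<in> carrier (dsum I M) \<Longrightarrow> i \<in> I \<Longrightarrow> t i \<in> carrier (M i)"
  by (simp add: mem_dsum)

lemma dsum_eqI: "t \<in> carrier (dsum I M) \<Longrightarrow> u \<in> carrier (dsum I M) \<Longrightarrow> (\<And>i. i \<in> I \<Longrightarrow> t i = u i) \<Longrightarrow> t = u"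
  by (auto simp: mem_dsum intro: extensionalityI)

lemma dsum_lin_into:
  assumes "\<And>i. i \<in> I \<Longrightarrow> (\<lambda>v. h v i) \<in> lin_maps K N (M i)"
    "\<And>v. v \<in> carrier N \<Longrightarrow> h v \<in> extensional I" "module K N"
  shows "h \<in> lin_maps K N (dsum I M)"
proof -
  interpret N: module K N by fact
  note * = lin_closed[OF assms(1)] lin_add[OF assms(1)] lin_smult[OF assms(1)]
  show ?thesis
    by (rule linI)
      (auto simp: mem_dsum dsum_ops * assms(2) intro!: extensionalityI[where A = I])
qed

lemma dsum_proj_linear: "i \<in> I \<Longrightarrow> (\<lambda>t. t i) \<in> lin_maps K (dsum I M) (M i)"
  by (rule linI) (auto simp: mem_dsum dsum_ops)

lemma dsum_proj_comp: "i \<in> I \<Longrightarrow> h \<in> lin_maps K (M i) N \<Longrightarrow> (\<lambda>t. h (t i)) \<in> lin_maps K (dsum I M) N"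
  by (rule lin_comp[of "\<lambda>t. t i"]) (rule dsum_proj_linear)

definition dsum_inj :: "'i set \<Rightarrow> ('i \<Rightarrow> ('k,'v) module) \<Rightarrow> 'i \<Rightarrow> 'v \<Rightarrow> 'i \<Rightarrow> 'v" where
  "dsum_inj I M i v = (\<lambda>j\<in>I. if j = i then v else \<zero>\<^bsub>M j\<^esub>)"

text \<open>The premise is an object-level bounded quantifier so that one stored fact, such as
  \<open>modules_ind\<close>, discharges it through \<open>OF\<close>.\<close>

context
  fixes K :: "('k,'r) ring_scheme" and I :: "'i set" and M :: "'i \<Rightarrow> ('k,'v) module"
  assumes mod_all: "\<forall>i\<in>I. module K (M i)" and K: "cring K"
begin

private lemma mod: "i \<in> I \<Longrightarrow> module K (M i)"
  using mod_all by blast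

lemma module_dsum: "module K (dsum I M)"
proof -
  interpret K: cring K by (rule K)
  note ag = module.axioms(2)[OF mod]
  note am = abelian_group.axioms(1)[OF ag]
  note [simp] = abelian_monoid.a_closed[OF am] module.smult_closed[OF mod] abelian_monoid.zero_closed[OF am]
    abelian_group.l_neg[OF ag] abelian_group.a_inv_closed[OF ag] abelian_monoid.l_zero[OF am]
    module.smult_one[OF mod]
  show ?thesis
  proof (rule moduleI, rule K, rule abelian_groupI)
    fix u assume u: "u \<in> carrier (dsum I M)"
    then show "\<exists>v\<in>carrier (dsum I M). v \<oplus>\<^bsub>dsum I M\<^esub> u = \<zero>\<^bsub>dsum I M\<^esub>"
      by (intro bexI[of _ "\<lambda>i\<in>I. \<ominus>\<^bsub>M i\<^esub> u i"])
        (auto simp: mem_dsum dsum_ops intro!: restrict_ext)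
  next
    fix u v w assume "u \<in> carrier (dsum I M)" "v \<in> carrier (dsum I M)" "w \<in> carrier (dsum I M)"
    then show "u \<oplus>\<^bsub>dsum I M\<^esub> v \<oplus>\<^bsub>dsum I M\<^esub> w = u \<oplus>\<^bsub>dsum I M\<^esub> (v \<oplus>\<^bsub>dsum I M\<^esub> w)"
      by (auto simp: mem_dsum dsum_ops abelian_monoid.a_assoc[OF am] intro!: restrict_ext)
  next
    fix u v assume "u \<in> carrier (dsum I M)" "v \<in> carrier (dsum I M)"
    then show "u \<oplus>\<^bsub>dsum I M\<^esub> v = v \<oplus>\<^bsub>dsum I M\<^esub> u"
      by (auto simp: mem_dsum dsum_ops intro!: restrict_ext abelian_monoid.a_comm[OF am])
  qed (auto simp: mem_dsum dsum_ops module.smult_l_distr[OF mod] module.smult_r_distr[OF mod]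
         module.smult_assoc1[OF mod] intro!: restrict_ext intro: extensionalityI[where A = I])
qed

lemma dsum_inj_linear: "i \<in> I \<Longrightarrow> dsum_inj I M i \<in> lin_maps K (M i) (dsum I M)"
proof (rule dsum_lin_into)
  fix j assume j: "j \<in> I" and i: "i \<in> I"
  show "(\<lambda>v. dsum_inj I M i v j) \<in> lin_maps K (M i) (M j)"
  proof (cases "j = i")
    case True
    then show ?thesis using i by (simp add: dsum_inj_def lin_ident)
  next
    case False
    then show ?thesis using j lin_const_zero[OF mod[OF j]] by (simp add: dsum_inj_def)
  qed
qed (auto simp: dsum_inj_def mod)

lemma dsum_decompose:
  assumes "finite I" "t \<in> carrier (dsum I M)"
  shows "t = (\<Oplus>\<^bsub>dsum I M\<^esub>i\<in>I. dsum_inj I M i (t i))"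
proof (rule dsum_eqI[OF assms(2)])
  interpret D: module K "dsum I M" by (rule module_dsum)
  have cl: "dsum_inj I M i (t i) \<in> carrier (dsum I M)" if "i \<in> I" for i
    using lin_closed[OF dsum_inj_linear[OF that] dsum_component[OF assms(2) that]] .
  then show "(\<Oplus>\<^bsub>dsum I M\<^esub>i\<in>I. dsum_inj I M i (t i)) \<in> carrier (dsum I M)" by auto
  fix j assume j: "j \<in> I"
  interpret Mj: module K "M j" using mod j .
  have "(\<Oplus>\<^bsub>dsum I M\<^esub>i\<in>I. dsum_inj I M i (t i)) j = (\<Oplus>\<^bsub>M j\<^esub>i\<in>I. dsum_inj I M i (t i) j)"
    using lin_finsum[OF module_dsum Mj.module_axioms dsum_proj_linear[OF j] assms(1)] cl by auto
  also have "\<dots> = (\<Oplus>\<^bsub>M j\<^esub>i\<in>I. if j = i then t j else \<zero>\<^bsub>M j\<^esub>)"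
    using j dsum_component[OF assms(2) j] by (intro Mj.finsum_cong') (auto simp: dsum_inj_def)
  also have "\<dots> = t j"
    using j assms(1) dsum_component[OF assms(2) j] by (intro Mj.finsum_singleton) auto
  finally show "t j = (\<Oplus>\<^bsub>dsum I M\<^esub>i\<in>I. dsum_inj I M i (t i)) j" ..
qed

lemma lin_eq_dsum:
  assumes "finite I" "module K P" "h \<in> lin_maps K (dsum I M) P" "h' \<in> lin_maps K (dsum I M) P"
    and "\<And>i v. i \<in> I \<Longrightarrow> v \<in> carrier (M i) \<Longrightarrow> h (dsum_inj I M i v) = h' (dsum_inj I M i v)"
    and "t \<in> carrier (dsum I M)"
  shows "h t = h' t"
proof -
  interpret P: module K P by fact
  have cl: "(\<lambda>i. dsum_inj I M i (t i)) \<in> I \<rightarrow> carrier (dsum I M)"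
    using lin_closed[OF dsum_inj_linear] dsum_component[OF assms(6)] by blast
  have "h (\<Oplus>\<^bsub>dsum I M\<^esub>i\<in>I. dsum_inj I M i (t i)) = h' (\<Oplus>\<^bsub>dsum I M\<^esub>i\<in>I. dsum_inj I M i (t i))"
    using lin_finsum[OF module_dsum assms(2,3,1) cl] lin_finsum[OF module_dsum assms(2,4,1) cl]
      assms(5) dsum_component[OF assms(6)] lin_closed[OF assms(4) funcset_mem[OF cl]]
    by (auto intro!: P.finsum_cong')
  then show ?thesis using dsum_decompose[OF assms(1,6)] by simp
qed

end

section \<open>Representations of skeletal groupoids\<close>

text \<open>A skeletal groupoid has only automorphisms, so a functor on it amounts to one group
  representation per object. This form is preserved by pullback, tensor product and both Kan
  extensions.\<close>

definition rep_on :: "('k,'r) ring_scheme \<Rightarrow> ('x,'a) groupoid_data \<Rightarrow> ('x,'a,'k,'v) rep \<Rightarrow> bool" where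
  "rep_on K X A \<longleftrightarrow> (\<forall>x\<in>objs X. group_rep K (aut_group X x) (ob A x) (act A))"

lemma group_repD:
  assumes "group_rep K G M \<sigma>"
  shows "module K M" "\<And>g. g \<in> carrier G \<Longrightarrow> \<sigma> g \<in> lin_maps K M M"
    "\<And>v. v \<in> carrier M \<Longrightarrow> \<sigma> \<one>\<^bsub>G\<^esub> v = v"
    "\<And>g h v. g \<in> carrier G \<Longrightarrow> h \<in> carrier G \<Longrightarrow> v \<in> carrier M \<Longrightarrow> \<sigma> (g \<otimes>\<^bsub>G\<^esub> h) v = \<sigma> g (\<sigma> h v)"
  using assms by (auto simp: group_rep_def)

lemma carrier_aut [simp]: "carrier (aut_group X x) = homs X x x"
  by (simp add: aut_group_def)

lemma one_aut: "\<one>\<^bsub>aut_group X x\<^esub> = idn X x"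
  by (simp add: aut_group_def)

lemma mult_aut: "a \<otimes>\<^bsub>aut_group X x\<^esub> b = cmp X a b"
  by (simp add: aut_group_def)

lemma (in groupoid) group_aut:
  assumes "x \<in> objs G"
  shows "group (aut_group G x)"
proof (rule groupI)
  fix a assume "a \<in> carrier (aut_group G x)"
  then show "\<exists>b\<in>carrier (aut_group G x). b \<otimes>\<^bsub>aut_group G x\<^esub> a = \<one>\<^bsub>aut_group G x\<^esub>"
    using inverse[of a x x] by (auto simp: one_aut mult_aut)
qed (use assms in \<open>auto simp: one_aut mult_aut idn_hom cmp_hom cmp_assoc cmp_idn_left\<close>)

lemma (in ess_finite_groupoid) finite_group_algebra_aut:
  assumes "cring K" "x \<in> objs G"
  shows "finite_group_algebra K (aut_group G x)"
  using assms group_aut[of x] finite_homs[of x x]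
  by (simp add: finite_group_algebra_def finite_group_algebra_axioms_def)

text \<open>Isomorphism classes in a skeletal groupoid are singletons. Finiteness of the fibres of
  \<open>f\<close> follows, which is what makes \<open>dsum\<close> a direct sum.\<close>

lemma (in ess_finite_groupoid) finite_objs:
  assumes "skeletal G"
  shows "finite (objs G)"
proof -
  have "iso_class G x = {x}" if "x \<in> objs G" for x
    using assms idn_hom[OF that] that by (auto simp: iso_class_def skeletal_def homs_def)
  then have "inj_on (iso_class G) (objs G)" by (auto intro: inj_onI)
  then show ?thesis using finite_iso_classes finite_imageD by blast
qed

lemma rep_on_unit:
  assumes "cring K"
  shows "rep_on K X (unit_rep K)"
  using module_self[OF assms] by (auto simp: rep_on_def group_rep_def unit_rep_def lin_ident)

lemma rep_on_pullback:
  assumes "groupoid_map X Y f" "rep_on K Y W"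
  shows "rep_on K X (pullback f W)"
proof -
  interpret groupoid_map X Y f by fact
  show ?thesis
    unfolding rep_on_def
  proof
    fix x assume x: "x \<in> objs X"
    then have W: "group_rep K (aut_group Y (fobj f x)) (ob W (fobj f x)) (act W)"
      using assms(2) fobj by (simp add: rep_on_def)
    show "group_rep K (aut_group X x) (ob (pullback f W) x) (act (pullback f W))"
      using group_repD[OF W] x farr[of _ x x]
      by (auto simp: group_rep_def pullback_def one_aut mult_aut farr_idn farr_cmp[of _ x x _ x])
  qed
qed

lemma act_tensor_rep:
  assumes "rep_on K X A" "rep_on K X B" "x \<in> objs X" "a \<in> homs X x x"
  shows "act (tensor_rep K X A B) a \<in> lin_maps K (tensor K (ob A x) (ob B x)) (tensor K (ob A x) (ob B x))"
    and "\<And>v w. v \<in> carrier (ob A x) \<Longrightarrow> w \<in> carrier (ob B x) \<Longrightarrow>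
      act (tensor_rep K X A B) a (pure_tensor K (ob A x) (ob B x) v w)
        = pure_tensor K (ob A x) (ob B x) (act A a v) (act B a w)"
proof -
  have A: "group_rep K (aut_group X x) (ob A x) (act A)" and B: "group_rep K (aut_group X x) (ob B x) (act B)"
    using assms by (auto simp: rep_on_def)
  have "tgt X a = x" using assms(4) by (simp add: homs_def)
  then have *: "act (tensor_rep K X A B) a = tensor_map K (ob A x) (ob B x) (act A a) (act B a)"
    by (simp add: tensor_rep_def)
  note tm = tensor_map_linear[OF group_repD(1)[OF A] group_repD(1)[OF B] group_repD(1)[OF A] group_repD(1)[OF B]
      group_repD(2)[OF A] group_repD(2)[OF B], of a a]
  show "act (tensor_rep K X A B) a \<in> lin_maps K (tensor K (ob A x) (ob B x)) (tensor K (ob A x) (ob B x))"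
    unfolding * using assms(4) by (intro tm) auto
  show "act (tensor_rep K X A B) a (pure_tensor K (ob A x) (ob B x) v w)
        = pure_tensor K (ob A x) (ob B x) (act A a v) (act B a w)"
    if "v \<in> carrier (ob A x)" "w \<in> carrier (ob B x)" for v w
    unfolding * using assms(4) that by (intro tm) auto
qed

lemma ob_tensor_rep: "ob (tensor_rep K X A B) x = tensor K (ob A x) (ob B x)"
  by (simp add: tensor_rep_def)

lemma rep_on_tensor:
  assumes "groupoid X" "rep_on K X A" "rep_on K X B"
  shows "rep_on K X (tensor_rep K X A B)"
  unfolding rep_on_def ob_tensor_rep
proof
  interpret groupoid X by fact
  fix x assume x: "x \<in> objs X"
  then have A: "group_rep K (aut_group X x) (ob A x) (act A)" and B: "group_rep K (aut_group X x) (ob B x) (act B)"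
    using assms by (auto simp: rep_on_def)
  note mA = group_repD(1)[OF A] and module_B = group_repD(1)[OF B]
  note act = act_tensor_rep[OF assms(2,3) x]
  note cl = lin_closed[OF group_repD(2)[OF A]] lin_closed[OF group_repD(2)[OF B]]
  let ?T = "tensor K (ob A x) (ob B x)"
  have id: "act (tensor_rep K X A B) (idn X x) t = t" if "t \<in> carrier ?T" for t
    by (rule lin_eq_tensor[OF mA module_B module_tensor[OF mA module_B] act(1) lin_ident _ that])
      (use idn_hom[OF x] group_repD(3)[OF A] group_repD(3)[OF B] in \<open>auto simp: act one_aut\<close>)
  have comp: "act (tensor_rep K X A B) (cmp X g h) t = act (tensor_rep K X A B) g (act (tensor_rep K X A B) h t)"
    if "t \<in> carrier ?T" "g \<in> homs X x x" "h \<in> homs X x x" for t g h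
    by (rule lin_eq_tensor[OF mA module_B module_tensor[OF mA module_B] act(1) lin_comp[OF act(1) act(1)] _ that(1)])
      (use that cmp_hom[of h x x g x] group_repD(4)[OF A] group_repD(4)[OF B] cl in \<open>auto simp: act mult_aut\<close>)
  show "group_rep K (aut_group X x) ?T (act (tensor_rep K X A B))"
    unfolding group_rep_def using module_tensor[OF mA module_B] act id comp by (auto simp: one_aut mult_aut)
qed

section \<open>The left Kan extension\<close>

text \<open>Interpreted for the given \<open>f\<close> and, through \<open>kan_at\<close> in
  \<open>unit_endo_eq\<close>, for the inclusion of a point; the same computation thus yields
  \<open>\<gamma>\<close> and \<open>\<delta>\<close>.\<close>

locale kan = XF: ess_finite_groupoid X + YF: ess_finite_groupoid Y + fmap: groupoid_map X Y f + K: field K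
  for X :: "('x,'a) groupoid_data" and Y :: "('y,'b) groupoid_data"
    and f :: "('x,'a,'y,'b) gmap" and K :: "('k,'r) ring_scheme" +
  assumes skeletal_X: "skeletal X" and skeletal_Y: "skeletal Y" and char_zero: "char_zero K"

text \<open>With \<open>y\<close> fixed, \<open>fobj f x\<close> is \<open>y\<close> for every
  \<open>x\<close> in the fibre, so a single group algebra occurs in all summands.\<close>

locale kan_at = kan X Y f K
  for X :: "('x,'a) groupoid_data" and Y :: "('y,'b) groupoid_data"
    and f :: "('x,'a,'y,'b) gmap" and K :: "('k,'r) ring_scheme" +
  fixes y :: 'y
  assumes y: "y \<in> objs Y"
begin

abbreviation "I \<equiv> obj_fibre X f y"
abbreviation "G \<equiv> aut_group Y y"
abbreviation "H x \<equiv> aut_group X x"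
abbreviation "\<delta> g \<equiv> basis_elt K g"
abbreviation "left \<equiv> left_kan K X Y f"
abbreviation "right \<equiv> right_kan K X Y f"
abbreviation "eta \<equiv> eta_lan K X Y f"
abbreviation "self \<equiv> self_module K"
abbreviation "Ay \<equiv> homs Y y y"
abbreviation "Ax x \<equiv> homs X x x"

sublocale G: finite_group_algebra K G
  by (rule YF.finite_group_algebra_aut[OF K.is_cring y])

lemma finite_I: "finite I"
  using XF.finite_objs[OF skeletal_X] by (simp add: obj_fibre_def)

lemma I_D: "x \<in> I \<Longrightarrow> fobj f x = y" "x \<in> I \<Longrightarrow> x \<in> objs X"
  by (auto simp: obj_fibre_def)

lemma H: "x \<in> I \<Longrightarrow> finite_group_algebra K (H x)"
  using I_D(2) XF.finite_group_algebra_aut[OF K.is_cring] by blast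

lemma farr_G: "x \<in> I \<Longrightarrow> a \<in> Ax x \<Longrightarrow> farr f a \<in> Ay"
  using I_D fmap.farr by metis

lemma module_self_K: "module K self"
  by (rule module_self[OF K.is_cring])

lemma y_homs: "g \<in> Ay \<Longrightarrow> h \<in> Ay \<Longrightarrow> g \<otimes>\<^bsub>G\<^esub> h \<in> Ay"
  using G.G.m_closed by simp

lemma group_algebra_map_farr:
  assumes "x \<in> I"
  shows "group_algebra_map K (H x) (farr f) \<in> lin_maps K (aut_alg K X x) G.kG"
  using farr_G[OF assms]
  by (intro group_algebra_map_linear H assms G.finite_group_algebra_axioms) auto

context
  fixes A :: "('x,'a,'k,'v) rep"
  assumes A: "rep_on K X A"
begin

abbreviation "ind x \<equiv> ind_summand K X Y f A x"
abbreviation "ipure x \<equiv> ind_pure K X Y f A x"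

lemma rep_at: "x \<in> I \<Longrightarrow> group_rep K (H x) (ob A x) (act A)"
  using A I_D(2) by (simp add: rep_on_def)

lemma module_at: "x \<in> I \<Longrightarrow> module K (ob A x)"
  using rep_at group_repD(1) by blast

lemma act_at: "x \<in> I \<Longrightarrow> a \<in> Ax x \<Longrightarrow> act A a \<in> lin_maps K (ob A x) (ob A x)"
  using group_repD(2)[OF rep_at] by simp

lemma balanced_ind:
  assumes "x \<in> I"
  shows "balanced_tensor K G.kG (ob A x) (carrier (aut_alg K X x))
     (\<lambda>r s. r \<otimes>\<^bsub>G.kG\<^esub> group_algebra_map K (H x) (farr f) s)
     (group_algebra_act (H x) (ob A x) (act A))"
proof -
  interpret H: finite_group_algebra K "H x" using H assms by blast
  show ?thesis
    using group_algebra_map_farr[OF assms] module_at[OF assms] G.module_kG lin_closed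
      bilinear_closed[OF H.group_algebra_act_bilinear[OF rep_at[OF assms]]]
    by (auto simp: balanced_tensor_def balanced_tensor_axioms_def intro!: G.kG_mult_closed
        dest: lin_closed)
qed

lemma ind_unfold:
  assumes "x \<in> I"
  shows "ind x = tensor_over K G.kG (ob A x) (carrier (aut_alg K X x))
     (\<lambda>r s. r \<otimes>\<^bsub>G.kG\<^esub> group_algebra_map K (H x) (farr f) s)
     (group_algebra_act (H x) (ob A x) (act A))"
  "ipure x = pure_over K G.kG (ob A x) (carrier (aut_alg K X x))
     (\<lambda>r s. r \<otimes>\<^bsub>G.kG\<^esub> group_algebra_map K (H x) (farr f) s)
     (group_algebra_act (H x) (ob A x) (act A))"
  using I_D[OF assms] by (simp_all add: ind_summand_def ind_pure_def)

lemma module_ind: "x \<in> I \<Longrightarrow> module K (ind x)"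
  by (simp add: ind_unfold balanced_tensor.module_tensor_over[OF balanced_ind])

lemma modules_ind: "\<forall>x\<in>I. module K (ind x)"
  using module_ind by blast

lemma ind_pure_bilinear: "x \<in> I \<Longrightarrow> ipure x \<in> bilinear_maps K G.kG (ob A x) (ind x)"
  by (simp add: ind_unfold balanced_tensor.pure_bilinear[OF balanced_ind])

lemma ind_pure_balanced:
  assumes "x \<in> I" "g \<in> Ay" "a \<in> Ax x" "v \<in> carrier (ob A x)"
  shows "ipure x (\<delta> (g \<otimes>\<^bsub>G\<^esub> farr f a)) v = ipure x (\<delta> g) (act A a v)"
proof -
  interpret H: finite_group_algebra K "H x" using H assms by blast
  show ?thesis
    using balanced_tensor.pure_balanced[OF balanced_ind[OF assms(1)], of "\<delta> g" "\<delta> a" v] assms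
      farr_G[OF assms(1,3)]
    by (simp add: ind_unfold G.basis_kG H.basis_kG H.group_algebra_act_basis[OF rep_at]
        group_algebra_map_basis[OF H.finite_group_algebra_axioms] G.kG_basis_mult)
qed

lemma lin_eq_ind:
  assumes "x \<in> I" "module K P" "h \<in> lin_maps K (ind x) P" "h' \<in> lin_maps K (ind x) P"
    and "\<And>g v. g \<in> Ay \<Longrightarrow> v \<in> carrier (ob A x) \<Longrightarrow> h (ipure x (\<delta> g) v) = h' (ipure x (\<delta> g) v)"
    and "t \<in> carrier (ind x)"
  shows "h t = h' t"
proof (rule balanced_tensor.lin_eq_tensor_over[OF balanced_ind[OF assms(1)],
      folded ind_unfold[OF assms(1)], OF assms(2-4) _ assms(6)])
  fix r v assume r: "r \<in> carrier G.kG" and v: "v \<in> carrier (ob A x)"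
  note p = bilinear_left[OF ind_pure_bilinear[OF assms(1)] v]
  show "h (ipure x r v) = h' (ipure x r v)"
    by (rule G.lin_eq_kG[OF assms(2) lin_comp[OF p assms(3)] lin_comp[OF p assms(4)] _ r])
      (use assms(5) v in auto)
qed

text \<open>Balance at group elements only. It is weaker in form than the condition of
  \<open>balanced_tensor\<close>, and \<open>ind_lift\<close> recovers the latter by
  linearity.\<close>

definition ind_balanced :: "'x \<Rightarrow> (('b \<Rightarrow> 'k) \<Rightarrow> 'v \<Rightarrow> 'p) \<Rightarrow> bool" where
  "ind_balanced x \<beta> \<longleftrightarrow> (\<forall>g\<in>Ay. \<forall>a\<in>Ax x. \<forall>v\<in>carrier (ob A x).
     \<beta> (\<delta> (g \<otimes>\<^bsub>G\<^esub> farr f a)) v = \<beta> (\<delta> g) (act A a v))"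

lemma ind_lift:
  assumes x: "x \<in> I" and P: "module K P" and \<beta>: "\<beta> \<in> bilinear_maps K G.kG (ob A x) P"
    and bal: "ind_balanced x \<beta>"
  shows "tensor_lift K P \<beta> \<in> lin_maps K (ind x) P"
    and "\<And>r v. r \<in> carrier G.kG \<Longrightarrow> v \<in> carrier (ob A x) \<Longrightarrow> tensor_lift K P \<beta> (ipure x r v) = \<beta> r v"
proof -
  interpret H: finite_group_algebra K "H x" using H x by blast
  let ?m = "group_algebra_map K (H x) (farr f)" and ?a = "group_algebra_act (H x) (ob A x) (act A)"
  note m = group_algebra_map_farr[OF x]
  note act = H.group_algebra_act_bilinear[OF rep_at[OF x]]
  note L = bilinear_left[OF G.kG_mult_bilinear] and R = bilinear_right[OF G.kG_mult_bilinear]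
  note \<beta>L = bilinear_left[OF \<beta>] and \<beta>R = bilinear_right[OF \<beta>]
  \<comment> \<open>Balance spreads from group elements in two stages: here to arbitrary
    \<open>r\<close> with \<open>s\<close> a group element, afterwards to arbitrary
    \<open>s\<close>.\<close>
  have bal1: "\<beta> (r \<otimes>\<^bsub>G.kG\<^esub> ?m (\<delta> a)) v = \<beta> r (?a (\<delta> a) v)"
    if "r \<in> carrier G.kG" "a \<in> Ax x" "v \<in> carrier (ob A x)" for r a v
    by (rule G.lin_eq_kG[OF P lin_comp[OF L \<beta>L] \<beta>L _ that(1)])
      (use that bal[unfolded ind_balanced_def] farr_G[OF x] lin_closed[OF act_at[OF x]] H.basis_kG in
        \<open>auto simp: group_algebra_map_basis[OF H.finite_group_algebra_axioms]
          H.group_algebra_act_basis[OF rep_at[OF x]] G.basis_kG G.kG_basis_mult\<close>)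
  have "\<beta> (r \<otimes>\<^bsub>G.kG\<^esub> ?m s) v = \<beta> r (?a s v)"
    if "r \<in> carrier G.kG" "s \<in> carrier H.kG" "v \<in> carrier (ob A x)" for r s v
    by (rule H.lin_eq_kG[OF P lin_comp[OF m lin_comp[OF R \<beta>L]]
          lin_comp[OF bilinear_left[OF act] \<beta>R] _ that(2)])
      (use that bal1 in auto)
  then have bal2: "\<forall>r\<in>carrier G.kG. \<forall>s\<in>carrier H.kG. \<forall>v\<in>carrier (ob A x).
      \<beta> (r \<otimes>\<^bsub>G.kG\<^esub> ?m s) v = \<beta> r (?a s v)" by blast
  note lift = balanced_tensor.tensor_lift_linear[OF balanced_ind[OF x] P \<beta> bal2]
    balanced_tensor.tensor_lift_pure[OF balanced_ind[OF x] P \<beta> bal2]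
  show "tensor_lift K P \<beta> \<in> lin_maps K (ind x) P"
    unfolding ind_unfold[OF x] by (rule lift)
  show "tensor_lift K P \<beta> (ipure x r v) = \<beta> r v" if "r \<in> carrier G.kG" "v \<in> carrier (ob A x)" for r v
    unfolding ind_unfold[OF x] by (rule lift(2)[OF that])
qed

abbreviation "lan \<equiv> ob (left A) y"
abbreviation "linj \<equiv> lan_inj K X Y f A"

lemma lan_eq_dsum: "lan = dsum I ind"
  by (simp add: left_kan_def)

lemma lan_inj_eq: "x \<in> I \<Longrightarrow> linj x r v = dsum_inj I ind x (ipure x r v)"
  using I_D by (simp add: lan_inj_def dsum_inj_def)

lemma module_lan: "module K lan"
  unfolding lan_eq_dsum by (rule module_dsum[OF modules_ind K.is_cring])

lemma lan_inj_bilinear: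
  assumes "x \<in> I"
  shows "linj x \<in> bilinear_maps K G.kG (ob A x) lan"
proof -
  have "linj x = (\<lambda>r v. dsum_inj I ind x (ipure x r v))"
    by (rule ext, rule ext, rule lan_inj_eq[OF assms])
  then show ?thesis
    using bilinear_into[OF ind_pure_bilinear[OF assms]
        dsum_inj_linear[where M = ind, OF modules_ind K.is_cring assms]]
    by (simp add: lan_eq_dsum)
qed

lemma lan_inj_closed: "x \<in> I \<Longrightarrow> g \<in> Ay \<Longrightarrow> v \<in> carrier (ob A x) \<Longrightarrow> linj x (\<delta> g) v \<in> carrier lan"
  using bilinear_closed[OF lan_inj_bilinear G.basis_kG] by simp

lemma lan_inj_balanced:
  "x \<in> I \<Longrightarrow> g \<in> Ay \<Longrightarrow> a \<in> Ax x \<Longrightarrow> v \<in> carrier (ob A x) \<Longrightarrow>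
   linj x (\<delta> (g \<otimes>\<^bsub>G\<^esub> farr f a)) v = linj x (\<delta> g) (act A a v)"
  by (simp add: lan_inj_eq ind_pure_balanced)

lemma lin_eq_lan:
  assumes "module K P" "h \<in> lin_maps K lan P" "h' \<in> lin_maps K lan P"
    and "\<And>x g v. x \<in> I \<Longrightarrow> g \<in> Ay \<Longrightarrow> v \<in> carrier (ob A x) \<Longrightarrow> h (linj x (\<delta> g) v) = h' (linj x (\<delta> g) v)"
    and "t \<in> carrier lan"
  shows "h t = h' t"
proof (rule lin_eq_dsum[OF modules_ind K.is_cring finite_I assms(1)])
  fix x u assume x: "x \<in> I" and u: "u \<in> carrier (ind x)"
  note J = dsum_inj_linear[OF modules_ind K.is_cring x]
  show "h (dsum_inj I ind x u) = h' (dsum_inj I ind x u)"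
    by (rule lin_eq_ind[OF x assms(1) _ _ _ u])
      (use assms(2-4) x J in \<open>auto simp: lan_eq_dsum lan_inj_eq intro: lin_comp[OF J]\<close>)
qed (use assms in \<open>simp_all add: lan_eq_dsum\<close>)

text \<open>Common source of the action on \<open>f_!A\<close>, of \<open>f_!\<close> on morphisms
  and of the inverse of \<open>\<lambda>\<close>: each acts summand by summand through a
  lift.\<close>

lemma lan_lift:
  fixes P :: "'x \<Rightarrow> ('k,'p) module"
  assumes P: "\<forall>x\<in>I. module K (P x)"
    and \<beta>: "\<forall>x\<in>I. \<beta> x \<in> bilinear_maps K G.kG (ob A x) (P x)"
    and bal: "\<forall>x\<in>I. ind_balanced x (\<beta> x)"
  shows "(\<lambda>t. \<lambda>x\<in>I. tensor_lift K (P x) (\<beta> x) (t x)) \<in> lin_maps K lan (dsum I P)"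
    and "\<And>x r v. x \<in> I \<Longrightarrow> r \<in> carrier G.kG \<Longrightarrow> v \<in> carrier (ob A x) \<Longrightarrow>
      (\<lambda>x'\<in>I. tensor_lift K (P x') (\<beta> x') (linj x r v x')) = dsum_inj I P x (\<beta> x r v)"
proof -
  note lift = ind_lift[OF _ P[rule_format] \<beta>[rule_format] bal[rule_format]]
  show "(\<lambda>t. \<lambda>x\<in>I. tensor_lift K (P x) (\<beta> x) (t x)) \<in> lin_maps K lan (dsum I P)"
  proof (rule dsum_lin_into)
    fix x assume x: "x \<in> I"
    show "(\<lambda>t. (\<lambda>x\<in>I. tensor_lift K (P x) (\<beta> x) (t x)) x) \<in> lin_maps K lan (P x)"
      using dsum_proj_comp[where M = ind, OF x lift(1)[OF x x x x]] x
      by (simp add: lan_eq_dsum)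
  qed (auto simp: module_lan)
  fix x r v assume x: "x \<in> I" and rv: "r \<in> carrier G.kG" "v \<in> carrier (ob A x)"
  show "(\<lambda>x'\<in>I. tensor_lift K (P x') (\<beta> x') (linj x r v x')) = dsum_inj I P x (\<beta> x r v)"
    unfolding dsum_inj_def
  proof (rule restrict_ext)
    fix x' assume x': "x' \<in> I"
    note lift = lift[OF x' x' x' x']
    show "tensor_lift K (P x') (\<beta> x') (linj x r v x') = (if x' = x then \<beta> x r v else \<zero>\<^bsub>P x'\<^esub>)"
      using x x' rv lift lin_zero[OF module_ind[OF x'] P[rule_format, OF x'] lift(1)]
      by (auto simp: lan_inj_eq dsum_inj_def)
  qed
qed

lemma lan_act:
  assumes b: "b \<in> Ay"
  shows "act (left A) b \<in> lin_maps K lan lan"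
    and "\<And>x g v. x \<in> I \<Longrightarrow> g \<in> Ay \<Longrightarrow> v \<in> carrier (ob A x) \<Longrightarrow>
      act (left A) b (linj x (\<delta> g) v) = linj x (\<delta> (b \<otimes>\<^bsub>G\<^esub> g)) v"
proof -
  let ?\<beta> = "\<lambda>x r v. ipure x (\<delta> b \<otimes>\<^bsub>G.kG\<^esub> r) v"
  have tb: "tgt Y b = y" using b by (simp add: homs_def)
  have act: "act (left A) b t = (\<lambda>x\<in>I. tensor_lift K (ind x) (?\<beta> x) (t x))" for t
    using I_D by (auto simp: left_kan_def tb intro!: restrict_ext)
  have bil: "?\<beta> x \<in> bilinear_maps K G.kG (ob A x) (ind x)" if "x \<in> I" for x
    using bilinear_compose[OF ind_pure_bilinear[OF that] bilinear_right[OF G.kG_mult_bilinear]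
      lin_ident] b by (simp add: G.basis_kG)
  \<comment> \<open>Left translation by \<open>b\<close> commutes with right multiplication by
    \<open>f(a)\<close>; this is associativity in \<open>A_y\<close>.\<close>
  have bal: "ind_balanced x (?\<beta> x)" if "x \<in> I" for x
    using that b farr_G[OF that]
    by (simp add: ind_balanced_def G.kG_basis_mult y_homs G.G.m_assoc[symmetric] ind_pure_balanced)
  have "\<forall>x\<in>I. ?\<beta> x \<in> bilinear_maps K G.kG (ob A x) (ind x)" "\<forall>x\<in>I. ind_balanced x (?\<beta> x)"
    using bil bal by blast+
  note lift = lan_lift[OF modules_ind this]
  show "act (left A) b \<in> lin_maps K lan lan"
    unfolding act[abs_def] using lift(1) by (simp add: lan_eq_dsum)
  show "act (left A) b (linj x (\<delta> g) v) = linj x (\<delta> (b \<otimes>\<^bsub>G\<^esub> g)) v"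
    if "x \<in> I" "g \<in> Ay" "v \<in> carrier (ob A x)" for x g v
    unfolding act using that b lift(2)[OF that(1) _ that(3), of "\<delta> g"]
    by (simp add: G.basis_kG G.kG_basis_mult lan_inj_eq)
qed

lemma group_rep_lan: "group_rep K G lan (act (left A))"
  unfolding group_rep_def
proof (intro conjI ballI)
  fix t assume t: "t \<in> carrier lan"
  have 1: "\<one>\<^bsub>G\<^esub> \<in> Ay" using G.G.one_closed by simp
  show "act (left A) \<one>\<^bsub>G\<^esub> t = t"
    by (rule lin_eq_lan[OF module_lan lan_act(1)[OF 1] lin_ident _ t]) (simp add: lan_act(2)[OF 1])
  fix g h assume gh: "g \<in> carrier G" "h \<in> carrier G"
  show "act (left A) (g \<otimes>\<^bsub>G\<^esub> h) t = act (left A) g (act (left A) h t)"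
    by (rule lin_eq_lan[OF module_lan lan_act(1) lin_comp[OF lan_act(1) lan_act(1)] _ t])
      (use gh in \<open>auto simp: y_homs lan_act(2) G.G.m_assoc\<close>)
qed (auto simp: module_lan lan_act)

end

section \<open>Morphisms and the counit for the left Kan extension\<close>

lemma lan_map:
  assumes A: "rep_on K X A" and B: "rep_on K X B"
    and \<alpha>: "\<forall>x\<in>I. \<alpha> x \<in> lin_maps K (ob A x) (ob B x)"
    and eq: "\<forall>x\<in>I. \<forall>a\<in>Ax x. \<forall>v\<in>carrier (ob A x). \<alpha> x (act A a v) = act B a (\<alpha> x v)"
  shows "lan_map K X Y f B \<alpha> y \<in> lin_maps K (ob (left A) y) (ob (left B) y)"
    and "\<And>x r v. x \<in> I \<Longrightarrow> r \<in> carrier G.kG \<Longrightarrow> v \<in> carrier (ob A x) \<Longrightarrow>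
      lan_map K X Y f B \<alpha> y (lan_inj K X Y f A x r v) = lan_inj K X Y f B x r (\<alpha> x v)"
proof -
  let ?\<beta> = "\<lambda>x r v. ind_pure K X Y f B x r (\<alpha> x v)"
  have bil: "?\<beta> x \<in> bilinear_maps K G.kG (ob A x) (ind_summand K X Y f B x)" if "x \<in> I" for x
    using bilinear_compose[OF ind_pure_bilinear[OF B that] lin_ident \<alpha>[rule_format, OF that]] .
  \<comment> \<open>Equivariance of \<open>\<alpha>\<close> is exactly what lets \<open>f(a)\<close>
    cross the tensor sign after \<open>\<alpha>\<close> has been applied.\<close>
  have bal: "ind_balanced A x (?\<beta> x)" if "x \<in> I" for x
    using that by (simp add: ind_balanced_def[OF A] eq ind_pure_balanced[OF B] lin_closed[OF \<alpha>[rule_format]])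
  have "\<forall>x\<in>I. ?\<beta> x \<in> bilinear_maps K G.kG (ob A x) (ind_summand K X Y f B x)"
    "\<forall>x\<in>I. ind_balanced A x (?\<beta> x)"
    using bil bal by blast+
  note lift = lan_lift[OF A modules_ind[OF B] this]
  show "lan_map K X Y f B \<alpha> y \<in> lin_maps K (ob (left A) y) (ob (left B) y)"
    using lift(1) by (simp add: lan_eq_dsum[OF B] lan_map_def[abs_def])
  show "lan_map K X Y f B \<alpha> y (lan_inj K X Y f A x r v) = lan_inj K X Y f B x r (\<alpha> x v)"
    if "x \<in> I" "r \<in> carrier G.kG" "v \<in> carrier (ob A x)" for x r v
    using lift(2)[OF that] that by (simp add: lan_map_def lan_inj_eq[OF B])
qed

lemma eps_lan:
  fixes W :: "('y,'b,'k,'w) rep"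
  assumes W: "rep_on K Y W"
  shows "eps_lan K X Y f W y \<in> lin_maps K (ob (left (pullback f W)) y) (ob W y)"
    and "\<And>x g w. x \<in> I \<Longrightarrow> g \<in> Ay \<Longrightarrow> w \<in> carrier (ob W y) \<Longrightarrow>
      eps_lan K X Y f W y (lan_inj K X Y f (pullback f W) x (\<delta> g) w) = act W g w"
proof -
  have Wy: "group_rep K G (ob W y) (act W)" using W y by (simp add: rep_on_def)
  interpret W: module K "ob W y" by (rule group_repD(1)[OF Wy])
  have P: "rep_on K X (pullback f W)" by (rule rep_on_pullback[OF fmap.groupoid_map_axioms W])
  let ?\<beta> = "group_algebra_act G (ob W y) (act W)"
  have ob: "ob (pullback f W) x = ob W y" if "x \<in> I" for x
    using I_D[OF that] by (simp add: pullback_def)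
  have bil: "?\<beta> \<in> bilinear_maps K G.kG (ob (pullback f W) x) (ob W y)" if "x \<in> I" for x
    using G.group_algebra_act_bilinear[OF Wy] by (simp add: ob that)
  have act: "act (pullback f W) a = act W (farr f a)" for a
    by (simp add: pullback_def)
  have bal: "ind_balanced (pullback f W) x ?\<beta>" if "x \<in> I" for x
    using that farr_G[OF that] lin_closed[OF group_repD(2)[OF Wy]]
    by (simp add: ind_balanced_def[OF P] ob act G.group_algebra_act_basis[OF Wy] y_homs group_repD(4)[OF Wy])
  note lift = ind_lift[OF P _ W.module_axioms bil bal]
  show lin: "eps_lan K X Y f W y \<in> lin_maps K (ob (left (pullback f W)) y) (ob W y)"
    unfolding eps_lan_def[abs_def]
    by (intro lin_sum W.module_axioms finite_I module_lan[OF P])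
      (auto simp: lan_eq_dsum[OF P] intro: dsum_proj_comp lift(1))
  show "eps_lan K X Y f W y (lan_inj K X Y f (pullback f W) x (\<delta> g) w) = act W g w"
    if x: "x \<in> I" and g: "g \<in> Ay" and w: "w \<in> carrier (ob W y)" for x g w
  proof -
    have gw: "act W g w \<in> carrier (ob W y)" using g w lin_closed[OF group_repD(2)[OF Wy]] by simp
    \<comment> \<open>A generator lives in one summand of the direct sum, so all other terms of the
      counit are lifts of zero.\<close>
    have "tensor_lift K (ob W y) ?\<beta> (lan_inj K X Y f (pullback f W) x (\<delta> g) w x') =
        (if x = x' then act W g w else \<zero>\<^bsub>ob W y\<^esub>)" if x': "x' \<in> I" for x'
      using x x' g w lift(2)[OF x x x] lin_zero[OF module_ind[OF P x'] W.module_axioms lift(1)[OF x' x' x']]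
      by (auto simp: lan_inj_eq[OF P] dsum_inj_def ob G.basis_kG G.group_algebra_act_basis[OF Wy])
    then have "eps_lan K X Y f W y (lan_inj K X Y f (pullback f W) x (\<delta> g) w) =
        (\<Oplus>\<^bsub>ob W y\<^esub>x'\<in>I. if x = x' then act W g w else \<zero>\<^bsub>ob W y\<^esub>)"
      unfolding eps_lan_def by (intro W.finsum_cong') (auto simp: gw)
    also have "\<dots> = act W g w"
      using x gw finite_I by (intro W.finsum_singleton) auto
    finally show ?thesis .
  qed
qed

end

lemma (in kan) rep_on_left_kan:
  assumes "rep_on K X A"
  shows "rep_on K Y (left_kan K X Y f A)"
  unfolding rep_on_def
proof
  fix y assume "y \<in> objs Y"
  then interpret kan_at X Y f K y
    by (simp add: kan_at_def kan_at_axioms_def kan_axioms)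
  show "group_rep K (aut_group Y y) (ob (left_kan K X Y f A) y) (act (left_kan K X Y f A))"
    by (rule group_rep_lan[OF assms])
qed

section \<open>The right Kan extension\<close>

context kan_at
begin

context
  fixes A :: "('x,'a,'k,'v) rep"
  assumes A: "rep_on K X A"
begin

abbreviation "coind x \<equiv> coind_summand K X Y f A x"

text \<open>Equivariance at group elements extends by linearity, first in \<open>r\<close> and then
  in \<open>s\<close>, to equivariance under the whole group algebra. From here on only group
  elements have to be inspected.\<close>

lemma mem_coind:
  assumes x: "x \<in> I"
  shows "\<phi> \<in> carrier (coind x) \<longleftrightarrow> \<phi> \<in> lin_maps K G.kG (ob A x) \<and> \<phi> \<in> extensional (carrier G.kG) \<and>
     (\<forall>a\<in>Ax x. \<forall>g\<in>Ay. \<phi> (\<delta> (farr f a \<otimes>\<^bsub>G\<^esub> g)) = act A a (\<phi> (\<delta> g)))" (is "?L \<longleftrightarrow> ?R")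
proof -
  interpret H: finite_group_algebra K "H x" using H x by blast
  let ?m = "group_algebra_map K (H x) (farr f)" and ?a = "group_algebra_act (H x) (ob A x) (act A)"
  note m = group_algebra_map_farr[OF x]
  note act = H.group_algebra_act_bilinear[OF rep_at[OF A x]]
  note L = bilinear_left[OF G.kG_mult_bilinear] and R = bilinear_right[OF G.kG_mult_bilinear]
  note aL = bilinear_left[OF act] and aR = bilinear_right[OF act]
  have eq: "?L \<longleftrightarrow> \<phi> \<in> lin_maps K G.kG (ob A x) \<and> \<phi> \<in> extensional (carrier G.kG) \<and>
      (\<forall>s\<in>carrier H.kG. \<forall>r\<in>carrier G.kG. \<phi> (?m s \<otimes>\<^bsub>G.kG\<^esub> r) = ?a s (\<phi> r))"
    using I_D[OF x] by (simp add: coind_summand_def Let_def)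
  show ?thesis
  proof
    assume ?L
    then have lin: "\<phi> \<in> lin_maps K G.kG (ob A x)" and ext: "\<phi> \<in> extensional (carrier G.kG)"
      and bal: "\<And>s r. s \<in> carrier H.kG \<Longrightarrow> r \<in> carrier G.kG \<Longrightarrow> \<phi> (?m s \<otimes>\<^bsub>G.kG\<^esub> r) = ?a s (\<phi> r)"
      unfolding eq by auto
    have "\<phi> (\<delta> (farr f a \<otimes>\<^bsub>G\<^esub> g)) = act A a (\<phi> (\<delta> g))" if "a \<in> Ax x" "g \<in> Ay" for a g
      using bal[of "\<delta> a" "\<delta> g"] that farr_G[OF x] lin_closed[OF lin G.basis_kG]
      by (simp add: H.basis_kG G.basis_kG group_algebra_map_basis[OF H.finite_group_algebra_axioms]
          H.group_algebra_act_basis[OF rep_at[OF A x]] G.kG_basis_mult)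
    then show ?R using lin ext by blast
  next
    assume R': ?R
    then have lin: "\<phi> \<in> lin_maps K G.kG (ob A x)" by blast
    have 1: "\<phi> (?m (\<delta> a) \<otimes>\<^bsub>G.kG\<^esub> r) = ?a (\<delta> a) (\<phi> r)" if "a \<in> Ax x" "r \<in> carrier G.kG" for a r
      by (rule G.lin_eq_kG[OF module_at[OF A x] lin_comp[OF R lin] lin_comp[OF lin aR] _ that(2)])
        (use that R' farr_G[OF x] H.basis_kG lin_closed[OF lin G.basis_kG] in
          \<open>auto simp: group_algebra_map_basis[OF H.finite_group_algebra_axioms]
            H.group_algebra_act_basis[OF rep_at[OF A x]] G.kG_basis_mult G.basis_kG\<close>)
    have "\<phi> (?m s \<otimes>\<^bsub>G.kG\<^esub> r) = ?a s (\<phi> r)" if "s \<in> carrier H.kG" "r \<in> carrier G.kG" for s r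
      by (rule H.lin_eq_kG[OF module_at[OF A x] lin_comp[OF m lin_comp[OF L lin]] aL _ that(1)])
        (use that 1 lin_closed[OF lin] in auto)
    then show ?L unfolding eq using R' by blast
  qed
qed

lemma coind_ops:
  assumes "x \<in> I"
  shows "\<phi> \<oplus>\<^bsub>coind x\<^esub> \<psi> = (\<lambda>r\<in>carrier G.kG. \<phi> r \<oplus>\<^bsub>ob A x\<^esub> \<psi> r)"
    "c \<odot>\<^bsub>coind x\<^esub> \<phi> = (\<lambda>r\<in>carrier G.kG. c \<odot>\<^bsub>ob A x\<^esub> \<phi> r)"
    "\<zero>\<^bsub>coind x\<^esub> = (\<lambda>r\<in>carrier G.kG. \<zero>\<^bsub>ob A x\<^esub>)"
  using I_D[OF assms] by (simp_all add: coind_summand_def Let_def)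

lemma coindI:
  assumes "x \<in> I" "\<phi> \<in> lin_maps K G.kG (ob A x)"
    "\<And>a g. a \<in> Ax x \<Longrightarrow> g \<in> Ay \<Longrightarrow> \<phi> (\<delta> (farr f a \<otimes>\<^bsub>G\<^esub> g)) = act A a (\<phi> (\<delta> g))"
  shows "(\<lambda>r\<in>carrier G.kG. \<phi> r) \<in> carrier (coind x)"
  unfolding mem_coind[OF assms(1)]
  using assms lin_cong[OF assms(2) _ G.module_kG, of "\<lambda>r\<in>carrier G.kG. \<phi> r"] farr_G[OF assms(1)]
  by (auto simp: G.basis_kG y_homs)

lemma module_coind:
  assumes x: "x \<in> I"
  shows "module K (coind x)"
proof -
  interpret M: module K "ob A x" by (rule module_at[OF A x])
  interpret kG: module K G.kG by (rule G.module_kG)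
  note lin = mem_coind[OF x, THEN iffD1, THEN conjunct1]
  note ext = mem_coind[OF x, THEN iffD1, THEN conjunct2, THEN conjunct1]
  note bal = mem_coind[OF x, THEN iffD1, THEN conjunct2, THEN conjunct2, rule_format]
  note [simp] = lin_closed[OF lin] coind_ops[OF x]
  note act = act_at[OF A x]
  note bcl = lin_closed[OF lin G.basis_kG]
  have add: "\<phi> \<oplus>\<^bsub>coind x\<^esub> \<psi> \<in> carrier (coind x)" if "\<phi> \<in> carrier (coind x)" "\<psi> \<in> carrier (coind x)" for \<phi> \<psi>
    unfolding coind_ops[OF x]
    by (intro coindI[OF x] lin_plus M.module_axioms lin that)
      (use that bal in \<open>simp add: bcl lin_add[OF act]\<close>)
  have smult: "c \<odot>\<^bsub>coind x\<^esub> \<phi> \<in> carrier (coind x)" if "\<phi> \<in> carrier (coind x)" "c \<in> carrier K" for \<phi> c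
    unfolding coind_ops[OF x]
    by (intro coindI[OF x] lin_scale M.module_axioms lin that)
      (use that bal in \<open>simp add: bcl lin_smult[OF act]\<close>)
  have zero: "\<zero>\<^bsub>coind x\<^esub> \<in> carrier (coind x)"
    unfolding coind_ops[OF x]
    by (intro coindI[OF x] lin_const_zero M.module_axioms)
      (simp add: lin_zero[OF M.module_axioms M.module_axioms act])
  show ?thesis
  proof (rule moduleI, rule K.is_cring, rule abelian_groupI)
    fix \<phi> assume \<phi>: "\<phi> \<in> carrier (coind x)"
    then show "\<one>\<^bsub>K\<^esub> \<odot>\<^bsub>coind x\<^esub> \<phi> = \<phi>"
      using ext by (auto intro!: extensionalityI[where A = "carrier G.kG"])
    show "\<zero>\<^bsub>coind x\<^esub> \<oplus>\<^bsub>coind x\<^esub> \<phi> = \<phi>"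
      using \<phi> ext by (auto intro!: extensionalityI[where A = "carrier G.kG"])
    have "(\<ominus>\<^bsub>K\<^esub> \<one>\<^bsub>K\<^esub>) \<odot>\<^bsub>coind x\<^esub> \<phi> \<oplus>\<^bsub>coind x\<^esub> \<phi> = \<zero>\<^bsub>coind x\<^esub>"
      using \<phi> by (auto simp: M.smult_l_minus M.M.l_neg intro!: restrict_ext)
    then show "\<exists>\<psi>\<in>carrier (coind x). \<psi> \<oplus>\<^bsub>coind x\<^esub> \<phi> = \<zero>\<^bsub>coind x\<^esub>"
      using smult[OF \<phi>, of "\<ominus>\<^bsub>K\<^esub> \<one>\<^bsub>K\<^esub>"] by blast
  qed (use add smult zero in \<open>auto simp: M.M.a_assoc M.smult_l_distr M.smult_r_distr M.smult_assoc1
       intro!: restrict_ext M.M.a_comm\<close>)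
qed

lemma modules_coind: "\<forall>x\<in>I. module K (coind x)"
  using module_coind by blast

abbreviation "rkan \<equiv> ob (right A) y"

lemma ran_eq_dsum: "rkan = dsum I coind"
  by (simp add: right_kan_def)

lemma module_ran: "module K rkan"
  unfolding ran_eq_dsum by (rule module_dsum[OF modules_coind K.is_cring])

lemma ran_coind: "\<phi> \<in> carrier rkan \<Longrightarrow> x \<in> I \<Longrightarrow> \<phi> x \<in> carrier (coind x)"
  by (simp add: ran_eq_dsum mem_dsum)

lemma ran_linear: "\<phi> \<in> carrier rkan \<Longrightarrow> x \<in> I \<Longrightarrow> \<phi> x \<in> lin_maps K G.kG (ob A x)"
  using ran_coind mem_coind by blast

lemma ran_closed: "\<phi> \<in> carrier rkan \<Longrightarrow> x \<in> I \<Longrightarrow> r \<in> carrier G.kG \<Longrightarrow> \<phi> x r \<in> carrier (ob A x)"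
  using ran_linear lin_closed by metis

lemma ran_equivariant:
  "\<phi> \<in> carrier rkan \<Longrightarrow> x \<in> I \<Longrightarrow> a \<in> Ax x \<Longrightarrow> g \<in> Ay \<Longrightarrow>
   \<phi> x (\<delta> (farr f a \<otimes>\<^bsub>G\<^esub> g)) = act A a (\<phi> x (\<delta> g))"
  using ran_coind mem_coind by blast

text \<open>Elements of \<open>f_*A(y)\<close> are extensional in both arguments and linear in the
  second, so their values at group elements determine them.\<close>

lemma ran_eqI:
  assumes "\<phi> \<in> carrier rkan" "\<psi> \<in> carrier rkan"
    "\<And>x g. x \<in> I \<Longrightarrow> g \<in> Ay \<Longrightarrow> \<phi> x (\<delta> g) = \<psi> x (\<delta> g)"
  shows "\<phi> = \<psi>"
proof (rule dsum_eqI[where I = I and M = coind])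
  fix x assume x: "x \<in> I"
  show "\<phi> x = \<psi> x"
  proof (rule extensionalityI[where A = "carrier G.kG"])
    fix r assume "r \<in> carrier G.kG"
    then show "\<phi> x r = \<psi> x r"
      by (rule G.lin_eq_kG[OF module_at[OF A x] ran_linear[OF assms(1) x] ran_linear[OF assms(2) x], rotated])
        (use assms(3) x in simp)
  qed (use ran_coind[OF assms(1) x] ran_coind[OF assms(2) x] mem_coind[OF x] in blast)+
qed (use assms in \<open>simp_all add: ran_eq_dsum\<close>)

lemma ran_eval_linear:
  assumes "x \<in> I" "r \<in> carrier G.kG"
  shows "(\<lambda>\<phi>. \<phi> x r) \<in> lin_maps K rkan (ob A x)"
  using assms ran_closed
  by (intro linI) (auto simp: ran_eq_dsum dsum_ops coind_ops)

lemma ranI: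
  assumes "\<And>x. x \<in> I \<Longrightarrow> \<phi> x \<in> lin_maps K G.kG (ob A x)"
    "\<And>x a g. x \<in> I \<Longrightarrow> a \<in> Ax x \<Longrightarrow> g \<in> Ay \<Longrightarrow> \<phi> x (\<delta> (farr f a \<otimes>\<^bsub>G\<^esub> g)) = act A a (\<phi> x (\<delta> g))"
  shows "(\<lambda>x\<in>I. \<lambda>r\<in>carrier G.kG. \<phi> x r) \<in> carrier rkan"
  using assms coindI[where \<phi> = "\<phi> x" for x] by (simp add: ran_eq_dsum mem_dsum)

lemma ran_act:
  assumes b: "b \<in> Ay"
  shows "act (right A) b \<in> lin_maps K rkan rkan"
    and "\<And>\<phi> x r. x \<in> I \<Longrightarrow> r \<in> carrier G.kG \<Longrightarrow>
      act (right A) b \<phi> x r = \<phi> x (r \<otimes>\<^bsub>G.kG\<^esub> \<delta> b)"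
proof -
  have tb: "tgt Y b = y" using b by (simp add: homs_def)
  have act: "act (right A) b \<phi> = (\<lambda>x\<in>I. \<lambda>r\<in>carrier G.kG. \<phi> x (r \<otimes>\<^bsub>G.kG\<^esub> \<delta> b))" for \<phi>
    using I_D by (auto simp: right_kan_def tb intro!: restrict_ext)
  show "act (right A) b \<phi> x r = \<phi> x (r \<otimes>\<^bsub>G.kG\<^esub> \<delta> b)" if "x \<in> I" "r \<in> carrier G.kG" for \<phi> x r
    using that by (simp add: act)
  note L = bilinear_left[OF G.kG_mult_bilinear G.basis_kG, of b]
  \<comment> \<open>Right translation by \<open>b\<close> commutes with left multiplication by
    \<open>f(a)\<close>, so it preserves equivariance.\<close>
  have cl: "act (right A) b \<phi> \<in> carrier rkan" if "\<phi> \<in> carrier rkan" for \<phi>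
    unfolding act using b that farr_G
    by (intro ranI lin_comp[OF L ran_linear])
      (auto simp: G.kG_basis_mult y_homs G.G.m_assoc ran_equivariant)
  show "act (right A) b \<in> lin_maps K rkan rkan"
  proof (rule linI[OF cl])
    interpret R: module K rkan by (rule module_ran)
    have mb: "\<delta> g \<otimes>\<^bsub>G.kG\<^esub> \<delta> b \<in> carrier G.kG" if "g \<in> Ay" for g
      using that b by (simp add: G.kG_mult_closed G.basis_kG)
    fix \<phi> assume \<phi>: "\<phi> \<in> carrier rkan"
    { fix \<psi> assume \<psi>: "\<psi> \<in> carrier rkan"
      show "act (right A) b (\<phi> \<oplus>\<^bsub>rkan\<^esub> \<psi>) =
          act (right A) b \<phi> \<oplus>\<^bsub>rkan\<^esub> act (right A) b \<psi>"
        by (rule ran_eqI)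
          (use \<phi> \<psi> in \<open>simp_all add: cl lin_add[OF ran_eval_linear] mb G.basis_kG, simp_all add: act
             lin_add[OF ran_eval_linear] mb G.basis_kG\<close>) }
    fix c assume c: "c \<in> carrier K"
    show "act (right A) b (c \<odot>\<^bsub>rkan\<^esub> \<phi>) = c \<odot>\<^bsub>rkan\<^esub> act (right A) b \<phi>"
      by (rule ran_eqI)
        (use \<phi> c in \<open>simp_all add: cl lin_smult[OF ran_eval_linear] mb G.basis_kG, simp_all add: act
             lin_smult[OF ran_eval_linear] mb G.basis_kG\<close>)
  qed
qed

lemma ran_act_basis:
  "b \<in> Ay \<Longrightarrow> g \<in> Ay \<Longrightarrow> x \<in> I \<Longrightarrow>
   act (right A) b \<phi> x (\<delta> g) = \<phi> x (\<delta> (g \<otimes>\<^bsub>G\<^esub> b))"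
  by (simp add: ran_act(2) G.basis_kG G.kG_basis_mult)

lemma group_rep_ran: "group_rep K G rkan (act (right A))"
  unfolding group_rep_def
proof (intro conjI ballI)
  fix \<phi> assume \<phi>: "\<phi> \<in> carrier rkan"
  have 1: "\<one>\<^bsub>G\<^esub> \<in> Ay" using G.G.one_closed by simp
  show "act (right A) \<one>\<^bsub>G\<^esub> \<phi> = \<phi>"
    by (rule ran_eqI[OF lin_closed[OF ran_act(1)[OF 1] \<phi>] \<phi>]) (simp add: ran_act_basis 1)
  fix g h assume gh: "g \<in> carrier G" "h \<in> carrier G"
  show "act (right A) (g \<otimes>\<^bsub>G\<^esub> h) \<phi> = act (right A) g (act (right A) h \<phi>)"
    by (rule ran_eqI)
      (use gh \<phi> lin_closed[OF ran_act(1)] in \<open>auto simp: ran_act_basis y_homs G.G.m_assoc\<close>)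
qed (auto simp: module_ran ran_act)

end

end

lemma (in kan) kan_atI: "y \<in> objs Y \<Longrightarrow> kan_at X Y f K y"
  by (simp add: kan_at_def kan_at_axioms_def kan_axioms)

lemma (in kan) rep_on_right_kan:
  assumes "rep_on K X A"
  shows "rep_on K Y (right_kan K X Y f A)"
  unfolding rep_on_def
proof
  fix y assume "y \<in> objs Y"
  then interpret kan_at X Y f K y by (rule kan_atI)
  show "group_rep K (aut_group Y y) (ob (right_kan K X Y f A) y) (act (right_kan K X Y f A))"
    by (rule group_rep_ran[OF assms])
qed

section \<open>The projection maps\<close>

lemma tensor_rel_cong:
  assumes "\<And>r n. r \<in> R \<Longrightarrow> n \<in> carrier N \<Longrightarrow> lact r n = lact' r n"
  shows "tensor_rel K M N R ract lact = tensor_rel K M N R ract lact'"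
proof -
  let ?F = "free_module K (carrier M \<times> carrier N)"
  have "{basis_elt K (ract m r, n) \<ominus>\<^bsub>?F\<^esub> basis_elt K (m, lact r n) | m r n.
            m \<in> carrier M \<and> r \<in> R \<and> n \<in> carrier N} =
      {basis_elt K (ract m r, n) \<ominus>\<^bsub>?F\<^esub> basis_elt K (m, lact' r n) | m r n.
            m \<in> carrier M \<and> r \<in> R \<and> n \<in> carrier N}"
    using assms by (intro Collect_cong) (metis (no_types, lifting))
  then show ?thesis unfolding tensor_rel_def Let_def by simp
qed

context kan_at
begin

text \<open>Representations that agree on the arrows at \<open>x\<close> may differ elsewhere as
  functions, yet they have equal relations and hence literally equal summands.
  \<open>lan_cong\<close> rests on this.\<close>

lemma ind_summand_cong:
  fixes A B :: "('x,'a,'k,'v) rep"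
  assumes "rep_on K X A" "x \<in> I" "ob B x = ob A x"
    and "\<And>a v. a \<in> Ax x \<Longrightarrow> v \<in> carrier (ob A x) \<Longrightarrow> act B a v = act A a v"
  shows "ind_summand K X Y f B x = ind_summand K X Y f A x"
    and "ind_pure K X Y f B x = ind_pure K X Y f A x"
proof -
  interpret M: module K "ob A x" by (rule module_at[OF assms(1,2)])
  interpret H: finite_group_algebra K "H x" using H assms(2) by blast
  have "group_algebra_act (H x) (ob B x) (act B) r v = group_algebra_act (H x) (ob A x) (act A) r v"
    if "r \<in> carrier H.kG" "v \<in> carrier (ob A x)" for r v
    unfolding group_algebra_act_def assms(3)
    using that lin_closed[OF act_at[OF assms(1,2)]] assms(4)
    by (intro M.finsum_cong') (auto simp: H.kG_val)
  then have "tensor_rel K (aut_alg K Y (fobj f x)) (ob A x) (carrier H.kG) ract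
      (group_algebra_act (H x) (ob B x) (act B)) =
     tensor_rel K (aut_alg K Y (fobj f x)) (ob A x) (carrier H.kG) ract
      (group_algebra_act (H x) (ob A x) (act A))" for ract
    by (rule tensor_rel_cong)
  then show "ind_summand K X Y f B x = ind_summand K X Y f A x"
    "ind_pure K X Y f B x = ind_pure K X Y f A x"
    by (simp_all add: ind_summand_def ind_pure_def[abs_def] tensor_over_def pure_over_def[abs_def] assms(3))
qed

end

lemma (in module) add_pow_eq_smult:
  "v \<in> carrier M \<Longrightarrow> [n] \<cdot>\<^bsub>M\<^esub> v = (nat_scalar R n) \<odot>\<^bsub>M\<^esub> v" for n :: nat
  by (induction n) (simp_all add: smult_l_distr)

text \<open>Linearity in the prescribed values for a fixed vector \<open>u\<close>, as opposed to
  linearity in \<open>u\<close>. Together the two make the extension bilinear in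
  \<open>proj_lan_inj\<close>.\<close>

lemma lin_ext_fun_linear:
  assumes "module K P" "module K M" "finite {s. u s \<noteq> \<zero>\<^bsub>K\<^esub>}" "\<And>s. u s \<in> carrier K"
    "\<And>s. u s \<noteq> \<zero>\<^bsub>K\<^esub> \<Longrightarrow> (\<lambda>v. \<beta> v s) \<in> lin_maps K M P"
  shows "(\<lambda>v. lin_ext K P (\<beta> v) u) \<in> lin_maps K M P"
  unfolding lin_ext_def using assms by (intro lin_sum lin_scale) auto

section \<open>Averaging over the cosets of \<open>f(A_x)\<close> in \<open>A_y\<close>\<close>

context kan_at
begin

lemma one_homs: "\<one>\<^bsub>G\<^esub> \<in> Ay"
  using G.G.one_closed by simp

lemma inv_homs: "g \<in> Ay \<Longrightarrow> inv\<^bsub>G\<^esub> g \<in> Ay"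
  using G.G.inv_closed by simp

lemma fin_homs: "finite Ay"
  using G.fin by simp

lemma kG_one_y: "x \<in> I \<Longrightarrow> \<one>\<^bsub>aut_alg K Y (fobj f x)\<^esub> = \<delta> \<one>\<^bsub>G\<^esub>"
  using I_D(1) by (simp add: G.kG_one)

text \<open>The right coset \<open>f(A_x) g\<close>, as an orbit of \<open>A_x\<close> acting on
  \<open>A_y\<close> by left multiplication through \<open>f\<close>.\<close>

abbreviation "orbit x g \<equiv> {h \<in> Ay. \<exists>a\<in>Ax x. h = farr f a \<otimes>\<^bsub>G\<^esub> g}"
abbreviation "c x \<equiv> inv\<^bsub>K\<^esub> (nat_scalar K (card (farr f ` Ax x)))"

text \<open>Characteristic zero enters here: the orders of \<open>f(A_x)\<close> and of the kernel
  become invertible scalars.\<close>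

lemma nat_scalar_nonzero: "n > 0 \<Longrightarrow> nat_scalar K n \<in> Units K"
  using char_zero K.one_closed K.add.nat_pow_closed by (simp add: char_zero_def K.field_Units)

lemma card_image_pos:
  assumes "x \<in> I"
  shows "card (farr f ` Ax x) > 0"
  using finite_group_algebra.fin[OF H[OF assms]] XF.idn_hom[OF I_D(2)[OF assms]]
  by (auto simp: card_gt_0_iff)

lemma c_closed: "x \<in> I \<Longrightarrow> c x \<in> carrier K"
  using nat_scalar_nonzero[OF card_image_pos] by blast

lemma group_hom_farr:
  assumes "x \<in> I"
  shows "group_hom (H x) G (farr f)"
proof -
  interpret H: finite_group_algebra K "H x" by (rule H[OF assms])
  have "farr f \<in> hom (H x) G"
    using farr_G[OF assms] fmap.farr_cmp[of _ x x _ x] by (auto simp: hom_def mult_aut)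
  then show ?thesis
    by (simp add: group_hom_def group_hom_axioms_def H.G.group_axioms G.G.group_axioms)
qed

lemma image_subgroup: "x \<in> I \<Longrightarrow> subgroup (farr f ` Ax x) G"
  using group_hom.img_is_subgroup[OF group_hom_farr] by simp

text \<open>The elements \<open>g\<close> whose coset contains \<open>h\<close> are exactly |f(A_x)|
  in number, so as many equal terms survive and the factor \<open>c x\<close> normalises them to
  \<open>v\<close>. It serves both to decompose \<open>f_*1(y)\<close> and to evaluate
  \<open>\<rho>\<close> at its preimage.\<close>

lemma orbit_sum:
  assumes M: "module K M" and x: "x \<in> I" and h: "h \<in> Ay" and v: "v \<in> carrier M"
    and F: "\<And>x' g. x' \<in> I \<Longrightarrow> g \<in> Ay \<Longrightarrow>
      F (x', g) = (if x' = x \<and> (\<exists>a\<in>Ax x. h = farr f a \<otimes>\<^bsub>G\<^esub> g) then c x \<odot>\<^bsub>M\<^esub> v else \<zero>\<^bsub>M\<^esub>)"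
  shows "(\<Oplus>\<^bsub>M\<^esub>p\<in>I \<times> Ay. F p) = v"
proof -
  interpret M: module K M by fact
  interpret S: subgroup "farr f ` Ax x" G by (rule image_subgroup[OF x])
  let ?n = "card (farr f ` Ax x)"
  let ?S = "{g \<in> Ay. \<exists>a\<in>Ax x. h = farr f a \<otimes>\<^bsub>G\<^esub> g}"
  \<comment> \<open>Solving \<open>h = b g\<close> for \<open>g\<close> parametrises the surviving
    terms by the elements \<open>b\<close> of the subgroup; the parametrisation is injective, which
    gives their number.\<close>
  have S: "?S = (\<lambda>b. inv\<^bsub>G\<^esub> b \<otimes>\<^bsub>G\<^esub> h) ` farr f ` Ax x"
  proof (intro equalityI subsetI)
    fix g assume "g \<in> ?S"
    then obtain a where a: "a \<in> Ax x" "h = farr f a \<otimes>\<^bsub>G\<^esub> g" and g: "g \<in> Ay" by auto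
    then have "g = inv\<^bsub>G\<^esub> (farr f a) \<otimes>\<^bsub>G\<^esub> h"
      using farr_G[OF x] by (simp add: G.G.m_assoc[symmetric] inv_homs)
    then show "g \<in> (\<lambda>b. inv\<^bsub>G\<^esub> b \<otimes>\<^bsub>G\<^esub> h) ` farr f ` Ax x" using a by blast
  next
    fix g assume "g \<in> (\<lambda>b. inv\<^bsub>G\<^esub> b \<otimes>\<^bsub>G\<^esub> h) ` farr f ` Ax x"
    then obtain a where a: "a \<in> Ax x" "g = inv\<^bsub>G\<^esub> (farr f a) \<otimes>\<^bsub>G\<^esub> h" by blast
    then have "h = farr f a \<otimes>\<^bsub>G\<^esub> g" "g \<in> Ay"
      using farr_G[OF x] h by (simp_all add: G.G.m_assoc[symmetric] inv_homs y_homs)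
    then show "g \<in> ?S" using a by blast
  qed
  have "inj_on (\<lambda>b. inv\<^bsub>G\<^esub> b \<otimes>\<^bsub>G\<^esub> h) (farr f ` Ax x)"
  proof (rule inj_onI)
    fix b b' assume "b \<in> farr f ` Ax x" "b' \<in> farr f ` Ax x"
      and eq: "inv\<^bsub>G\<^esub> b \<otimes>\<^bsub>G\<^esub> h = inv\<^bsub>G\<^esub> b' \<otimes>\<^bsub>G\<^esub> h"
    then have b: "b \<in> carrier G" "b' \<in> carrier G" using S.subset by auto
    then have "inv\<^bsub>G\<^esub> b = inv\<^bsub>G\<^esub> b'" using eq h by (simp add: inv_homs)
    then show "b = b'" using b G.G.inv_inv by metis
  qed
  then have card: "card ?S = ?n" unfolding S by (rule card_image)
  have cv: "c x \<odot>\<^bsub>M\<^esub> v \<in> carrier M" using v c_closed[OF x] by simp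
  have "(\<Oplus>\<^bsub>M\<^esub>p\<in>I \<times> Ay. F p) = (\<Oplus>\<^bsub>M\<^esub>p\<in>{x} \<times> ?S. c x \<odot>\<^bsub>M\<^esub> v)"
  proof (rule M.add.finprod_mono_neutral_cong_right)
    show "F p = \<zero>\<^bsub>M\<^esub>" if "p \<in> I \<times> Ay - {x} \<times> ?S" for p
    proof -
      from that obtain x' g where p: "p = (x', g)" "x' \<in> I" "g \<in> Ay" by blast
      then have "\<not> (x' = x \<and> (\<exists>a\<in>Ax x. h = farr f a \<otimes>\<^bsub>G\<^esub> g))" using that by blast
      then show ?thesis unfolding p(1) F[OF p(2,3)] by (rule if_not_P)
    qed
    show "F p = c x \<odot>\<^bsub>M\<^esub> v" if "p \<in> {x} \<times> ?S" for p
    proof -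
      from that obtain g where p: "p = (x, g)" "g \<in> Ay" "\<exists>a\<in>Ax x. h = farr f a \<otimes>\<^bsub>G\<^esub> g" by blast
      then show ?thesis using F[OF x p(2)] by simp
    qed
    have "F (x', g) \<in> carrier M" if "x' \<in> I" "g \<in> Ay" for x' g
      unfolding F[OF that] using cv by simp
    then show "F \<in> I \<times> Ay \<rightarrow> carrier M" by auto
  qed (use x finite_I fin_homs in auto)
  also have "\<dots> = [?n] \<cdot>\<^bsub>M\<^esub> (c x \<odot>\<^bsub>M\<^esub> v)"
    using M.add.finprod_const[OF cv, of "{x} \<times> ?S"] card by (simp add: card_cartesian_product)
  also have "\<dots> = (nat_scalar K ?n \<otimes>\<^bsub>K\<^esub> c x) \<odot>\<^bsub>M\<^esub> v"
    using cv v c_closed[OF x] by (simp add: M.add_pow_eq_smult M.smult_assoc1)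
  also have "\<dots> = v"
    using nat_scalar_nonzero[OF card_image_pos[OF x]] v by simp
  finally show ?thesis .
qed

text \<open>The indicator function of the coset \<open>f(A\<^sub>x) g\<close>, as an element of \<open>f\<^sub>*1(y)\<close>.\<close>

definition chi :: "'x \<Rightarrow> 'b \<Rightarrow> 'x \<Rightarrow> ('b \<Rightarrow> 'k) \<Rightarrow> 'k" where
  "chi x g = (\<lambda>x'\<in>I. \<lambda>r\<in>carrier G.kG. if x' = x then \<Oplus>\<^bsub>K\<^esub>h\<in>orbit x g. r h else \<zero>\<^bsub>K\<^esub>)"

lemma chi_basis:
  assumes "x' \<in> I" "h \<in> Ay"
  shows "chi x g x' (\<delta> h) = (if x' = x \<and> (\<exists>a\<in>Ax x. h = farr f a \<otimes>\<^bsub>G\<^esub> g) then \<one>\<^bsub>K\<^esub> else \<zero>\<^bsub>K\<^esub>)"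
proof -
  have "finite (orbit x g)" using fin_homs by simp
  then show ?thesis using assms by (simp add: chi_def G.basis_kG K.finsum_basis_elt)
qed

lemma unit_rep_simps: "ob (unit_rep K) x = self" "act (unit_rep K) a = (\<lambda>v. v)"
  by (simp_all add: unit_rep_def)

lemma self_module_simps: "carrier self = carrier K" "add self = add K"
  "zero self = zero K" "smult self = mult K"
  by (simp_all add: self_module_def)

lemma rep_unit: "rep_on K X (unit_rep K)"
  by (rule rep_on_unit[OF K.is_cring])

lemma chi_closed:
  assumes "x \<in> I" "g \<in> Ay"
  shows "chi x g \<in> carrier (rkan (unit_rep K))"
proof -
  interpret S: subgroup "farr f ` Ax x" G by (rule image_subgroup[OF assms(1)])
  have "(\<lambda>x'\<in>I. \<lambda>r\<in>carrier G.kG. chi x g x' r) \<in> carrier (rkan (unit_rep K))"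
  proof (rule ranI[OF rep_unit])
    fix x' assume x': "x' \<in> I"
    have fin: "finite (orbit x g)" using fin_homs by simp
    have "(\<lambda>r. if x' = x then \<Oplus>\<^bsub>K\<^esub>h\<in>orbit x g. r h else \<zero>\<^bsub>K\<^esub>) \<in> lin_maps K G.kG self"
      by (rule linI)
        (auto simp: self_module_simps G.kG_val G.kG_add G.kG_smult K.finsum_addf Pi_iff
          K.finsum_rdistr[OF fin] K.finsum_closed)
    then show "chi x g x' \<in> lin_maps K G.kG (ob (unit_rep K) x')"
      unfolding unit_rep_simps
      by (rule lin_cong) (use x' in \<open>simp_all add: chi_def G.module_kG\<close>)
  next
    fix x' a h assume x': "x' \<in> I" and a: "a \<in> homs X x' x'" and h: "h \<in> Ay"
    \<comment> \<open>Lying in \<open>f(A_x) g\<close> is rewritten as membership of a quotient in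
      the subgroup \<open>f(A_x)\<close>.\<close>
    have coset: "(\<exists>b\<in>Ax x. k = farr f b \<otimes>\<^bsub>G\<^esub> g) \<longleftrightarrow> k \<otimes>\<^bsub>G\<^esub> inv\<^bsub>G\<^esub> g \<in> farr f ` Ax x"
      if "k \<in> Ay" for k
      using that assms(2) farr_G[OF assms(1)] G.G.inv_solve_right[of "farr f _" k g] by fastforce
    \<comment> \<open>Multiplying by an element of a subgroup does not change membership in it.
      Since the action on the unit is trivial, this invariance is the equivariance of the
      indicator.\<close>
    have "farr f a \<otimes>\<^bsub>G\<^esub> (h \<otimes>\<^bsub>G\<^esub> inv\<^bsub>G\<^esub> g) \<in> farr f ` Ax x \<longleftrightarrow> h \<otimes>\<^bsub>G\<^esub> inv\<^bsub>G\<^esub> g \<in> farr f ` Ax x"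
      if "x' = x"
    proof -
      have "farr f a \<in> farr f ` Ax x" using a that by blast
      then show ?thesis using S.subset h assms(2) inv_homs y_homs
        by (metis G.G.inv_solve_left S.m_closed S.m_inv_closed S.mem_carrier carrier_aut)
    qed
    then have "(\<exists>b\<in>Ax x. farr f a \<otimes>\<^bsub>G\<^esub> h = farr f b \<otimes>\<^bsub>G\<^esub> g) \<longleftrightarrow> (\<exists>b\<in>Ax x. h = farr f b \<otimes>\<^bsub>G\<^esub> g)"
      if "x' = x"
      using that a h assms farr_G[OF assms(1)] by (simp add: coset y_homs inv_homs G.G.m_assoc)
    then show "chi x g x' (\<delta> (farr f a \<otimes>\<^bsub>G\<^esub> h)) = act (unit_rep K) a (chi x g x' (\<delta> h))"
      using x' h farr_G[OF x' a] by (auto simp: chi_basis y_homs unit_rep_simps)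
  qed
  also have "(\<lambda>x'\<in>I. \<lambda>r\<in>carrier G.kG. chi x g x' r) = chi x g"
    by (auto simp: chi_def fun_eq_iff)
  finally show ?thesis .
qed

subsection \<open>The map \<open>\<rho>\<close>\<close>

lemma group_rep_at: "rep_on K Y W \<Longrightarrow> group_rep K G (ob W y) (act W)"
  using y by (simp add: rep_on_def)

lemma module_at_y: "rep_on K Y W \<Longrightarrow> module K (ob W y)"
  using group_rep_at group_repD(1) by blast

context
  fixes W :: "('y,'b,'k,'w) rep" and B :: "('x,'a,'k,'v) rep"
  assumes W: "rep_on K Y W" and B: "rep_on K X B"
begin

abbreviation "R \<equiv> right B"
abbreviation "WR \<equiv> tensor K (ob W y) (ob R y)"
abbreviation "rho \<equiv> proj_ran K X Y f W B y"

lemma rep_R: "rep_on K Y R"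
  by (rule rep_on_right_kan[OF B])

lemma rep_WR: "rep_on K Y (tensor_rep K Y W R)"
  by (rule rep_on_tensor[OF YF.groupoid_axioms W rep_R])

lemma group_rep_WR: "group_rep K G WR (act (tensor_rep K Y W R))"
  using rep_WR y by (simp add: rep_on_def ob_tensor_rep)

lemma eps_ran_linear: "x \<in> I \<Longrightarrow> eps_ran K X Y f x \<in> lin_maps K (ob R y) (ob B x)"
  unfolding eps_ran_def[abs_def]
  using ran_eval_linear[OF B _ G.basis_kG[of "\<one>\<^bsub>G\<^esub>"]] by (simp add: kG_one_y one_homs)

lemma rho_eq:
  "x \<in> I \<Longrightarrow> r \<in> carrier G.kG \<Longrightarrow> rho t x r =
    tensor_map K (ob W y) (ob B x) (\<lambda>v. v) (eps_ran K X Y f x)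
      (group_algebra_act G WR (act (tensor_rep K Y W R)) r t)"
  using I_D by (simp add: proj_ran_def ran_map_def eta_ran_def ob_tensor_rep)

lemma rho_ext: "rho t = (\<lambda>x\<in>I. \<lambda>r\<in>carrier G.kG. rho t x r)"
  by (auto simp: proj_ran_def ran_map_def fun_eq_iff)

lemmas rho_tensor_map = tensor_map_linear[OF module_at_y[OF W] module_ran[OF B] module_at_y[OF W] module_at[OF B] lin_ident eps_ran_linear]

text \<open>Linearity in \<open>t\<close> makes the left inverse of \<open>\<rho>\<close> linear;
  linearity in \<open>r\<close> reduces an identity between values of \<open>\<rho>\<close> to group
  elements.\<close>

lemma rho_bilinear:
  assumes x: "x \<in> I"
  shows "(\<lambda>r t. rho t x r) \<in> bilinear_maps K G.kG WR (tensor K (ob W y) (ob B x))"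
  by (rule bilinear_cong[OF bilinear_into[OF G.group_algebra_act_bilinear[OF group_rep_WR]
        rho_tensor_map(1)[OF x x]]])
    (use x in \<open>simp_all add: rho_eq G.module_kG module_tensor module_at_y[OF W] module_ran B\<close>)

text \<open>The unit applies \<open>h\<close> diagonally to \<open>t \<otimes> \<psi>\<close>, and
  evaluating \<open>h \<psi>\<close> at 1 gives the value of \<open>\<psi>\<close> at
  \<open>h\<close>, because \<open>A_y\<close> acts on \<open>f_*\<close> by right
  translation.\<close>

lemma rho_pure:
  assumes "x \<in> I" "h \<in> Ay" "t \<in> carrier (ob W y)" "\<psi> \<in> carrier (ob R y)"
  shows "rho (pure_tensor K (ob W y) (ob R y) t \<psi>) x (\<delta> h) =
    pure_tensor K (ob W y) (ob B x) (act W h t) (\<psi> x (\<delta> h))"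
proof -
  have p: "pure_tensor K (ob W y) (ob R y) t \<psi> \<in> carrier WR"
    using assms by (intro bilinear_closed[OF pure_tensor_bilinear] module_at_y[OF W] module_ran B)
  have cl: "act W h t \<in> carrier (ob W y)" "act R h \<psi> \<in> carrier (ob R y)"
    using assms lin_closed[OF group_repD(2)[OF group_rep_at[OF W]]] lin_closed[OF ran_act(1)[OF B]] by auto
  have "eps_ran K X Y f x (act R h \<psi>) = \<psi> x (\<delta> h)"
    using assms one_homs by (simp add: eps_ran_def kG_one_y ran_act_basis[OF B])
  then show ?thesis
    using assms p cl
    by (simp add: rho_eq G.basis_kG G.group_algebra_act_basis[OF group_rep_WR] act_tensor_rep(2)[OF W rep_R y]
        rho_tensor_map(2))
qed

end

abbreviation "U1 \<equiv> unit_rep K"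

lemma ran_unit_closed: "\<psi> \<in> carrier (rkan U1) \<Longrightarrow> x \<in> I \<Longrightarrow> r \<in> carrier G.kG \<Longrightarrow> \<psi> x r \<in> carrier K"
  using ran_closed[OF rep_unit] by (simp add: unit_rep_simps self_module_simps)

text \<open>The action on the unit being trivial, an element of \<open>f_*1(y)\<close> is constant
  on each coset \<open>f(A_x) g\<close>, so it is a combination of coset indicators. The sum runs
  over all \<open>g\<close>, and \<open>c x\<close> compensates for the repetition of each
  coset.\<close>

lemma ran_unit_decompose:
  assumes "\<psi> \<in> carrier (rkan U1)"
  shows "(\<Oplus>\<^bsub>rkan U1\<^esub>p\<in>I \<times> Ay. (c (fst p) \<otimes>\<^bsub>K\<^esub> \<psi> (fst p) (\<delta> (snd p))) \<odot>\<^bsub>rkan U1\<^esub> chi (fst p) (snd p)) = \<psi>"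
    (is "(\<Oplus>\<^bsub>_\<^esub>p\<in>?P. ?s p) = _")
proof (rule ran_eqI[OF rep_unit])
  interpret R: module K "rkan U1" by (rule module_ran[OF rep_unit])
  have sc: "c (fst p) \<otimes>\<^bsub>K\<^esub> \<psi> (fst p) (\<delta> (snd p)) \<in> carrier K" if "p \<in> ?P" for p
    using that c_closed ran_unit_closed[OF assms] by (auto simp: G.basis_kG)
  have cl: "?s \<in> ?P \<rightarrow> carrier (rkan U1)"
    using sc chi_closed by auto
  then show "(\<Oplus>\<^bsub>rkan U1\<^esub>p\<in>?P. ?s p) \<in> carrier (rkan U1)" by (rule R.finsum_closed)
  fix x h assume x: "x \<in> I" and h: "h \<in> Ay"
  have ev: "(\<lambda>\<psi>. \<psi> x (\<delta> h)) \<in> lin_maps K (rkan U1) self"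
    using ran_eval_linear[OF rep_unit x G.basis_kG] h by (simp add: unit_rep_simps)
  have "(\<Oplus>\<^bsub>rkan U1\<^esub>p\<in>?P. ?s p) x (\<delta> h) = (\<Oplus>\<^bsub>self\<^esub>p\<in>?P. ?s p x (\<delta> h))"
    by (rule lin_finsum[OF module_ran[OF rep_unit] module_self_K ev _ cl]) (simp add: finite_I fin_homs)
  also have "\<dots> = \<psi> x (\<delta> h)"
  proof (rule orbit_sum[OF module_self_K x h])
    show "\<psi> x (\<delta> h) \<in> carrier self"
      using ran_unit_closed[OF assms x] h by (simp add: self_module_simps G.basis_kG)
    fix x' g assume xg: "x' \<in> I" "g \<in> Ay"
    have "?s (x', g) x (\<delta> h) = (c x' \<otimes>\<^bsub>K\<^esub> \<psi> x' (\<delta> g)) \<otimes>\<^bsub>K\<^esub> chi x' g x (\<delta> h)"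
      using lin_smult[OF ev sc[of "(x', g)"] chi_closed[OF xg]] xg by (simp add: self_module_simps)
    moreover have "\<psi> x (\<delta> (farr f a \<otimes>\<^bsub>G\<^esub> g)) = \<psi> x (\<delta> g)" if "a \<in> Ax x" for a
      using ran_equivariant[OF rep_unit assms x that xg(2)] by (simp add: unit_rep_simps)
    ultimately show "?s (x', g) x (\<delta> h) = (if x' = x \<and> (\<exists>a\<in>Ax x. h = farr f a \<otimes>\<^bsub>G\<^esub> g)
        then c x \<odot>\<^bsub>self\<^esub> \<psi> x (\<delta> h) else \<zero>\<^bsub>self\<^esub>)"
      using x h xg sc[of "(x', g)"] by (auto simp: chi_basis self_module_simps)
  qed
  finally show "(\<Oplus>\<^bsub>rkan U1\<^esub>p\<in>?P. ?s p) x (\<delta> h) = \<psi> x (\<delta> h)" .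
qed (rule assms)

lemma proj_ran_inj:
  fixes W :: "('y,'b,'k,'w) rep"
  assumes W: "rep_on K Y W"
  shows "inj_on (rho W U1) (carrier (ob (tensor_rep K Y W (right U1)) y))"
proof -
  let ?T = "tensor K (ob W y) (rkan U1)" and ?p = "pure_tensor K (ob W y) (rkan U1)"
  let ?P = "I \<times> Ay"
  note mW = module_at_y[OF W] and mR = module_ran[OF rep_unit] and gW = group_rep_at[OF W]
  interpret W: module K "ob W y" by (rule mW)
  interpret R: module K "rkan U1" by (rule mR)
  note mT = module_tensor[OF mW mR]
  interpret T: module K ?T by (rule mT)
  \<comment> \<open>The left factor recovered from \<open>\<rho> T\<close> at \<open>(x, g)\<close>:
    the unitor removes the scalar factor, and the inverse of \<open>g\<close> undoes the twist that
    \<open>\<rho>\<close> introduced.\<close>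
  let ?u = "\<lambda>p T. c (fst p) \<odot>\<^bsub>ob W y\<^esub> act W (inv\<^bsub>G\<^esub> (snd p))
    (unitor_r K (ob W y) (rho W U1 T (fst p) (\<delta> (snd p))))"
  define h where "h T = (\<Oplus>\<^bsub>?T\<^esub>p\<in>?P. ?p (?u p T) (chi (fst p) (snd p)))" for T
  have u: "?u p \<in> lin_maps K ?T (ob W y)" if "p \<in> ?P" for p
  proof -
    from that have p: "fst p \<in> I" "snd p \<in> Ay" by auto
    have r: "(\<lambda>T. rho W U1 T (fst p) (\<delta> (snd p))) \<in> lin_maps K ?T (tensor K (ob W y) self)"
      using bilinear_right[OF rho_bilinear[OF W rep_unit p(1)] G.basis_kG] p(2) by (simp add: unit_rep_simps)
    show ?thesis
      using p by (intro lin_scale mW c_closed lin_comp[OF lin_comp[OF r unitor_r_linear(1)[OF mW]]]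
          group_repD(2)[OF gW]) (simp_all add: inv_homs)
  qed
  have fin: "finite ?P" by (simp add: finite_I fin_homs)
  have chi: "chi (fst p) (snd p) \<in> carrier (rkan U1)" if "p \<in> ?P" for p
    using that chi_closed by auto
  have h: "h \<in> lin_maps K ?T ?T"
    unfolding h_def[abs_def]
    by (intro lin_sum[OF mT fin _ mT] lin_comp[OF u bilinear_left[OF pure_tensor_bilinear[OF mW mR] chi]])
  have "h T = T" if T: "T \<in> carrier ?T" for T
  proof (rule lin_eq_tensor[OF mW mR mT h lin_ident _ T])
    fix t \<psi> assume t: "t \<in> carrier (ob W y)" and \<psi>: "\<psi> \<in> carrier (rkan U1)"
    let ?s = "\<lambda>p. c (fst p) \<otimes>\<^bsub>K\<^esub> \<psi> (fst p) (\<delta> (snd p))"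
    \<comment> \<open>The scalar value of \<open>\<psi>\<close>, which came out with the left
      factor, is moved to the indicator on the right. The left factor becomes \<open>t\<close> in
      every term, and the sum over \<open>p\<close> becomes the decomposition of
      \<open>\<psi>\<close>.\<close>
    have "?p (?u p (?p t \<psi>)) (chi (fst p) (snd p)) = ?p t (?s p \<odot>\<^bsub>rkan U1\<^esub> chi (fst p) (snd p))"
      if "p \<in> ?P" for p
    proof -
      from that have p: "fst p \<in> I" "snd p \<in> Ay" by auto
      have cl: "\<psi> (fst p) (\<delta> (snd p)) \<in> carrier K" "act W (snd p) t \<in> carrier (ob W y)"
        using p t ran_unit_closed[OF \<psi> p(1)] lin_closed[OF group_repD(2)[OF gW]] by (auto simp: G.basis_kG)
      have "act W (inv\<^bsub>G\<^esub> (snd p)) (act W (snd p) t) = t"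
        using group_repD(4)[OF gW, of "inv\<^bsub>G\<^esub> (snd p)" "snd p" t] group_repD(3)[OF gW t] p t by (simp add: inv_homs)
      then have "?u p (?p t \<psi>) = ?s p \<odot>\<^bsub>ob W y\<^esub> t"
        using rho_pure[OF W rep_unit p t \<psi>] cl p t c_closed[OF p(1)]
          lin_smult[OF group_repD(2)[OF gW], of "inv\<^bsub>G\<^esub> (snd p)"]
        by (simp add: unit_rep_simps unitor_r_linear(2)[OF mW] inv_homs W.smult_assoc1)
      then show ?thesis
        using cl p t c_closed[OF p(1)] chi[OF that]
          lin_smult[OF bilinear_left[OF pure_tensor_bilinear[OF mW mR]]]
          lin_smult[OF bilinear_right[OF pure_tensor_bilinear[OF mW mR]]] by simp
    qed
    moreover have sc: "(\<lambda>p. ?s p \<odot>\<^bsub>rkan U1\<^esub> chi (fst p) (snd p)) \<in> ?P \<rightarrow> carrier (rkan U1)"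
      using chi c_closed ran_unit_closed[OF \<psi>] by (auto simp: G.basis_kG)
    moreover have "(\<lambda>p. ?p t (?s p \<odot>\<^bsub>rkan U1\<^esub> chi (fst p) (snd p))) \<in> ?P \<rightarrow> carrier ?T"
      using bilinear_closed[OF pure_tensor_bilinear[OF mW mR] t] sc by blast
    ultimately have "h (?p t \<psi>) = (\<Oplus>\<^bsub>?T\<^esub>p\<in>?P. ?p t (?s p \<odot>\<^bsub>rkan U1\<^esub> chi (fst p) (snd p)))"
      unfolding h_def by (intro T.finsum_cong') auto
    also have "\<dots> = ?p t (\<Oplus>\<^bsub>rkan U1\<^esub>p\<in>?P. ?s p \<odot>\<^bsub>rkan U1\<^esub> chi (fst p) (snd p))"
      using lin_finsum[OF mR mT bilinear_right[OF pure_tensor_bilinear[OF mW mR] t] fin sc] by simp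
    finally show "h (?p t \<psi>) = ?p t \<psi>" by (simp only: ran_unit_decompose[OF \<psi>])
  qed
  \<comment> \<open>\<open>h\<close> depends on \<open>T\<close> only through
    \<open>\<rho> T\<close>, so that \<open>h T = T\<close> makes \<open>\<rho>\<close>
    injective.\<close>
  moreover have "h T = h T'" if "rho W U1 T = rho W U1 T'" for T T'
    unfolding h_def that ..
  ultimately show ?thesis by (intro inj_onI) (metis ob_tensor_rep)
qed

subsection \<open>The map \<open>\<lambda>\<close>\<close>

lemma eta_lan_eq: "x \<in> I \<Longrightarrow> eta A x v = linj A x (\<delta> \<one>\<^bsub>G\<^esub>) v"
  by (simp add: eta_lan_def kG_one_y)

lemma eta_lan_linear:
  assumes "rep_on K X A" "x \<in> I"
  shows "eta A x \<in> lin_maps K (ob A x) (lan A)"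
  using bilinear_right[OF lan_inj_bilinear[OF assms] G.basis_kG[of "\<one>\<^bsub>G\<^esub>"]] one_homs
  by (simp add: eta_lan_eq[OF assms(2), abs_def])

lemma eta_lan_equivariant:
  assumes "rep_on K X A" "x \<in> I" "a \<in> Ax x" "v \<in> carrier (ob A x)"
  shows "eta A x (act A a v) = act (left A) (farr f a) (eta A x v)"
  using assms farr_G[OF assms(2,3)] lan_inj_balanced[OF assms(1,2) one_homs assms(3,4)]
  by (simp add: eta_lan_eq lan_act(2)[OF assms(1)] one_homs)

text \<open>\<open>f\<^sup>*(V \<otimes> W)\<close> and \<open>f\<^sup>*V \<otimes> f\<^sup>*W\<close> have actions that agree on arrows but are in general different
  HOL functions, so they can be exchanged only inside \<open>f\<^sub>!\<close>.\<close>

lemma lan_cong: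
  assumes "rep_on K X A" "\<forall>x\<in>I. ob B x = ob A x"
    and "\<forall>x\<in>I. \<forall>a\<in>Ax x. \<forall>v\<in>carrier (ob A x). act B a v = act A a v"
  shows "lan B = lan A" and "\<And>x. x \<in> I \<Longrightarrow> linj B x = linj A x"
proof -
  have ind: "ind_summand K X Y f B x = ind_summand K X Y f A x" "ind_pure K X Y f B x = ind_pure K X Y f A x"
    if "x \<in> I" for x
    using ind_summand_cong[OF assms(1) that, of B] assms(2,3) that by blast+
  show "lan B = lan A"
    by (simp add: left_kan_def dsum_def ind cong: PiE_cong restrict_cong)
  show "linj B x = linj A x" if "x \<in> I" for x
    using that I_D[OF that] by (auto simp: lan_inj_def ind fun_eq_iff)
qed

context
  fixes A :: "('x,'a,'k,'v) rep" and B :: "('y,'b,'k,'w) rep"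
  assumes A: "rep_on K X A" and B: "rep_on K Y B"
begin

abbreviation "L \<equiv> left A"
abbreviation "fB \<equiv> pullback f B"
abbreviation "AB \<equiv> tensor_rep K X A fB"
abbreviation "LB \<equiv> tensor K (lan A) (ob B y)"
abbreviation "pAB x \<equiv> pure_tensor K (ob A x) (ob B y)"
abbreviation "lambda \<equiv> proj_lan K X Y f A B y"
abbreviation "pLB \<equiv> pure_tensor K (lan A) (ob B y)"

lemma rep_fB: "rep_on K X fB"
  by (rule rep_on_pullback[OF fmap.groupoid_map_axioms B])

lemma rep_AB: "rep_on K X AB"
  by (rule rep_on_tensor[OF XF.groupoid_axioms A rep_fB])

lemma rep_L: "rep_on K Y L"
  by (rule rep_on_left_kan[OF A])

lemma pullback_simps: "ob (pullback f W) x = ob W (fobj f x)" "act (pullback f W) a = act W (farr f a)"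
  by (simp_all add: pullback_def)

lemma ob_AB: "x \<in> I \<Longrightarrow> ob AB x = tensor K (ob A x) (ob B y)"
  by (simp add: ob_tensor_rep pullback_simps I_D)

lemma act_AB:
  "x \<in> I \<Longrightarrow> a \<in> Ax x \<Longrightarrow> v \<in> carrier (ob A x) \<Longrightarrow> w \<in> carrier (ob B y) \<Longrightarrow>
   act AB a (pAB x v w) = pAB x (act A a v) (act B (farr f a) w)"
  using act_tensor_rep(2)[OF A rep_fB, of x a v w] by (simp add: pullback_simps I_D)

lemmas module_B = module_at_y[OF B] and group_rep_B = group_rep_at[OF B]
lemmas mL = module_lan[OF A]
lemmas mLB = module_tensor[OF mL module_B]
lemmas pLB_bil = pure_tensor_bilinear[OF mL module_B]

lemma pAB_bil: "x \<in> I \<Longrightarrow> pAB x \<in> bilinear_maps K (ob A x) (ob B y) (ob AB x)"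
  using pure_tensor_bilinear[OF module_at[OF A] module_B] by (simp add: ob_AB)

lemma act_B_closed: "g \<in> Ay \<Longrightarrow> w \<in> carrier (ob B y) \<Longrightarrow> act B g w \<in> carrier (ob B y)"
  using lin_closed[OF group_repD(2)[OF group_rep_B]] by simp

text \<open>Generators \<open>g \<otimes> (v \<otimes> w)\<close> suffice: \<open>f_!\<close> is
  generated by its elements \<open>g \<otimes> u\<close>, and for fixed \<open>g\<close> the
  dependence on \<open>u\<close> is linear.\<close>

lemma lin_eq_lan_AB:
  assumes "module K P" "h \<in> lin_maps K (lan AB) P" "h' \<in> lin_maps K (lan AB) P"
    and "\<And>x g v w. x \<in> I \<Longrightarrow> g \<in> Ay \<Longrightarrow> v \<in> carrier (ob A x) \<Longrightarrow> w \<in> carrier (ob B y) \<Longrightarrow>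
      h (linj AB x (\<delta> g) (pAB x v w)) = h' (linj AB x (\<delta> g) (pAB x v w))"
    and "t \<in> carrier (lan AB)"
  shows "h t = h' t"
proof (rule lin_eq_lan[OF rep_AB assms(1-3) _ assms(5)])
  fix x g u assume x: "x \<in> I" and g: "g \<in> Ay" and u: "u \<in> carrier (ob AB x)"
  have "linj AB x (\<delta> g) \<in> lin_maps K (ob AB x) (lan AB)"
    using bilinear_right[OF lan_inj_bilinear[OF rep_AB x] G.basis_kG] g by simp
  then have l: "linj AB x (\<delta> g) \<in> lin_maps K (tensor K (ob A x) (ob B y)) (lan AB)"
    by (simp add: ob_AB x)
  show "h (linj AB x (\<delta> g) u) = h' (linj AB x (\<delta> g) u)"
    by (rule lin_eq_tensor[OF module_at[OF A x] module_B assms(1)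
          lin_comp[OF l assms(2)] lin_comp[OF l assms(3)]])
      (use assms(4) x g u in \<open>simp_all add: ob_AB\<close>)
qed

lemma proj_lan:
  shows "lambda \<in> lin_maps K (lan AB) LB"
    and "\<And>x g v w. x \<in> I \<Longrightarrow> g \<in> Ay \<Longrightarrow> v \<in> carrier (ob A x) \<Longrightarrow> w \<in> carrier (ob B y) \<Longrightarrow>
      lambda (linj AB x (\<delta> g) (pAB x v w)) = pLB (linj A x (\<delta> g) v) (act B g w)"
proof -
  let ?T = "tensor_rep K X (pullback f L) fB" and ?S = "tensor_rep K Y L B"
  let ?\<alpha> = "\<lambda>x. tensor_map K (ob L (fobj f x)) (ob B (fobj f x)) (eta A x) (\<lambda>w. w)"
  have fL: "rep_on K X (pullback f L)" by (rule rep_on_pullback[OF fmap.groupoid_map_axioms rep_L])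
  have T: "rep_on K X ?T" by (rule rep_on_tensor[OF XF.groupoid_axioms fL rep_fB])
  have S: "rep_on K Y ?S" by (rule rep_on_tensor[OF YF.groupoid_axioms rep_L B])
  have obT: "ob ?T x = LB" if "x \<in> I" for x
    using that by (simp add: ob_tensor_rep pullback_simps I_D)
  have obS: "ob ?S y = LB" by (simp add: ob_tensor_rep)
  have tm: "?\<alpha> x \<in> lin_maps K (tensor K (ob A x) (ob B y)) LB"
    "\<And>v w. v \<in> carrier (ob A x) \<Longrightarrow> w \<in> carrier (ob B y) \<Longrightarrow> ?\<alpha> x (pAB x v w) = pLB (eta A x v) w"
    if x: "x \<in> I" for x
    using tensor_map_linear[OF module_at[OF A x] module_B mL module_B eta_lan_linear[OF A x] lin_ident]
    by (simp_all add: I_D[OF x])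
  have actT: "act ?T a (pLB t w) = pLB (act L (farr f a) t) (act B (farr f a) w)"
    if "x \<in> I" "a \<in> Ax x" "t \<in> carrier (lan A)" "w \<in> carrier (ob B y)" for x a t w
    using act_tensor_rep(2)[OF fL rep_fB, of x a t w] that by (simp add: pullback_simps I_D)
  have aT: "act ?T a \<in> lin_maps K LB LB" if "x \<in> I" "a \<in> Ax x" for x a
    using act_at[OF T that] by (simp add: obT that)
  have aAB: "act AB a \<in> lin_maps K (tensor K (ob A x) (ob B y)) (tensor K (ob A x) (ob B y))"
    if "x \<in> I" "a \<in> Ax x" for x a
    using act_at[OF rep_AB that] by (simp add: ob_AB that)
  \<comment> \<open>Equivariance of the unit tensored with the identity; without it
    \<open>lan_map\<close> would not be well defined on the balanced tensor product.\<close>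
  have eq: "?\<alpha> x (act AB a t) = act ?T a (?\<alpha> x t)"
    if x: "x \<in> I" and a: "a \<in> Ax x" and t: "t \<in> carrier (ob AB x)" for x a t
  proof (rule lin_eq_tensor[OF module_at[OF A x] module_B mLB])
    show "t \<in> carrier (tensor K (ob A x) (ob B y))" using t by (simp add: ob_AB x)
    fix v w assume vw: "v \<in> carrier (ob A x)" "w \<in> carrier (ob B y)"
    then show "?\<alpha> x (act AB a (pAB x v w)) = act ?T a (?\<alpha> x (pAB x v w))"
      using x a lin_closed[OF act_at[OF A x a]] lin_closed[OF eta_lan_linear[OF A x]] farr_G[OF x a]
      by (simp add: act_AB tm(2) actT eta_lan_equivariant[OF A] act_B_closed)
  qed (rule lin_comp[OF aAB[OF x a] tm(1)[OF x]] lin_comp[OF tm(1)[OF x] aT[OF x a]])+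
  have \<alpha>: "?\<alpha> x \<in> lin_maps K (ob AB x) (ob ?T x)" if "x \<in> I" for x
    using tm(1)[OF that] by (simp add: ob_AB obT that)
  have "\<forall>x\<in>I. ?\<alpha> x \<in> lin_maps K (ob AB x) (ob ?T x)"
    "\<forall>x\<in>I. \<forall>a\<in>Ax x. \<forall>t\<in>carrier (ob AB x). ?\<alpha> x (act AB a t) = act ?T a (?\<alpha> x t)"
    using \<alpha> eq by blast+
  note lm = lan_map[OF rep_AB T this]
  \<comment> \<open>\<open>tensor_rep\<close> reads its modules off the target of the arrow. On
    automorphisms of \<open>x\<close> the targets correspond under \<open>f\<close>, so the two
    actions agree there; this is the exchange made in order to apply the counit.\<close>
  have cong: "ob (pullback f ?S) x = ob ?T x" "\<And>a v. a \<in> Ax x \<Longrightarrow> act (pullback f ?S) a v = act ?T a v"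
    if x: "x \<in> I" for x
  proof -
    show "ob (pullback f ?S) x = ob ?T x" by (simp add: ob_tensor_rep pullback_simps)
    fix a v assume a: "a \<in> Ax x"
    have "tgt Y (farr f a) = y" "tgt X a = x" using farr_G[OF x a] a by (simp_all add: homs_def)
    then show "act (pullback f ?S) a v = act ?T a v"
      using I_D[OF x] by (simp add: tensor_rep_def pullback_def)
  qed
  have "\<forall>x\<in>I. ob (pullback f ?S) x = ob ?T x"
    "\<forall>x\<in>I. \<forall>a\<in>Ax x. \<forall>v\<in>carrier (ob ?T x). act (pullback f ?S) a v = act ?T a v"
    using cong by blast+
  note lc = lan_cong[OF T this]
  note ep = eps_lan[OF S, unfolded lc(1) obS]
  have proj: "lambda = (\<lambda>t. eps_lan K X Y f ?S y (lan_map K X Y f ?T ?\<alpha> y t))"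
    by (simp add: proj_lan_def comp_def)
  show "lambda \<in> lin_maps K (lan AB) LB"
    unfolding proj by (rule lin_comp[OF lm(1) ep(1)])
  fix x g v w assume x: "x \<in> I" and g: "g \<in> Ay" and v: "v \<in> carrier (ob A x)" and w: "w \<in> carrier (ob B y)"
  have p: "pAB x v w \<in> carrier (ob AB x)" by (rule bilinear_closed[OF pAB_bil[OF x] v w])
  have e: "eta A x v \<in> carrier (lan A)" by (rule lin_closed[OF eta_lan_linear[OF A x] v])
  have q: "pLB (eta A x v) w \<in> carrier LB" by (rule bilinear_closed[OF pLB_bil e w])
  have "lan_map K X Y f ?T ?\<alpha> y (linj AB x (\<delta> g) (pAB x v w)) = linj ?T x (\<delta> g) (pLB (eta A x v) w)"
    using lm(2)[OF x G.basis_kG p, of g] g tm(2)[OF x v w] by simp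
  also have "linj ?T x = linj (pullback f ?S) x" using lc(2)[OF x] by simp
  finally have "lambda (linj AB x (\<delta> g) (pAB x v w)) = act ?S g (pLB (eta A x v) w)"
    unfolding proj using ep(2)[OF x g q] by simp
  also have "\<dots> = pLB (act L g (eta A x v)) (act B g w)"
    by (rule act_tensor_rep(2)[OF rep_L B y g e w])
  also have "act L g (eta A x v) = linj A x (\<delta> g) v"
    using x g v one_homs by (simp add: eta_lan_eq lan_act(2)[OF A])
  finally show "lambda (linj AB x (\<delta> g) (pAB x v w)) = pLB (linj A x (\<delta> g) v) (act B g w)" .
qed

lemma proj_lan_inj: "inj_on (lambda) (carrier (lan AB))"
proof -
  let ?i = "\<lambda>x. ind_summand K X Y f AB x"
  \<comment> \<open>The inverse sends \<open>(g \<otimes> v) \<otimes> w\<close> to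
    \<open>g \<otimes> (v \<otimes> g\<inverse> w)\<close>, which makes sense only for a group
    element \<open>g\<close>. Hence \<open>\<gamma>\<close> is given on \<open>A_y\<close>,
    \<open>\<beta>\<close> is its linear extension to the group algebra, and \<open>\<mu>\<close>
    lifts \<open>\<beta>\<close> to all summands.\<close>
  define \<gamma> where "\<gamma> w x v = (\<lambda>g. ind_pure K X Y f AB x (\<delta> g) (pAB x v (act B (inv\<^bsub>G\<^esub> g) w)))" for w x v
  define \<beta> where "\<beta> w x r v = lin_ext K (?i x) (\<gamma> w x v) r" for w x r v
  define \<mu> where "\<mu> t w = (\<lambda>x\<in>I. tensor_lift K (?i x) (\<beta> w x) (t x))" for t w
  have pure_cl: "pAB x v w \<in> carrier (ob AB x)" if "x \<in> I" "v \<in> carrier (ob A x)" "w \<in> carrier (ob B y)" for x v w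
    by (rule bilinear_closed[OF pAB_bil[OF that(1)] that(2,3)])
  have ip_lin: "ind_pure K X Y f AB x (\<delta> g) \<in> lin_maps K (ob AB x) (?i x)" if "x \<in> I" "g \<in> Ay" for x g
    using bilinear_right[OF ind_pure_bilinear[OF rep_AB that(1)] G.basis_kG] that(2) by simp
  have \<gamma>_lin: "(\<lambda>v. \<gamma> w x v g) \<in> lin_maps K (ob A x) (?i x)"
    if "x \<in> I" "g \<in> Ay" "w \<in> carrier (ob B y)" for x g w
    unfolding \<gamma>_def using that
    by (intro lin_comp[OF bilinear_left[OF pAB_bil] ip_lin] act_B_closed inv_homs) auto
  have \<gamma>_cl: "\<gamma> w x v g \<in> carrier (?i x)"
    if "x \<in> I" "g \<in> Ay" "v \<in> carrier (ob A x)" "w \<in> carrier (ob B y)" for x v w g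
    using lin_closed[OF \<gamma>_lin] that by blast
  have \<beta>_bil: "\<beta> w x \<in> bilinear_maps K G.kG (ob A x) (?i x)" if w: "w \<in> carrier (ob B y)" and x: "x \<in> I" for w x
  proof (rule bilinearI)
    fix v assume "v \<in> carrier (ob A x)"
    then show "(\<lambda>r. \<beta> w x r v) \<in> lin_maps K G.kG (?i x)"
      unfolding \<beta>_def G.lin_kG
      using \<gamma>_cl w x by (intro lin_ext_linear module_ind rep_AB) auto
  next
    fix r assume r: "r \<in> carrier G.kG"
    have sub: "{g. r g \<noteq> \<zero>\<^bsub>K\<^esub>} \<subseteq> Ay" using r by (auto simp: G.mem_kG)
    then show "(\<lambda>v. \<beta> w x r v) \<in> lin_maps K (ob A x) (?i x)"
      unfolding \<beta>_def
      using \<gamma>_lin w x G.kG_val[OF r] finite_subset[OF sub fin_homs]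
      by (intro lin_ext_fun_linear module_ind rep_AB module_at A) auto
  qed
  have \<beta>_basis: "\<beta> w x (\<delta> g) v = \<gamma> w x v g"
    if "x \<in> I" "g \<in> Ay" "v \<in> carrier (ob A x)" "w \<in> carrier (ob B y)" for x v w g
    unfolding \<beta>_def
    using that \<gamma>_cl by (intro lin_ext_basis[where S = "Ay"] module_ind rep_AB) auto
  \<comment> \<open>When \<open>f(a)\<close> is shifted onto
    \<open>v \<otimes> (g f(a))\<inverse> w\<close> it acts on both factors, and on the second it
    cancels to leave \<open>g\<inverse> w\<close>.\<close>
  have \<beta>_bal: "ind_balanced A x (\<beta> w x)" if w: "w \<in> carrier (ob B y)" and x: "x \<in> I" for w x
    unfolding ind_balanced_def[OF A]
  proof (intro ballI)
    fix g a v assume g: "g \<in> Ay" and a: "a \<in> Ax x" and v: "v \<in> carrier (ob A x)"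
    have fa: "farr f a \<in> Ay" by (rule farr_G[OF x a])
    have av: "act A a v \<in> carrier (ob A x)" by (rule lin_closed[OF act_at[OF A x a] v])
    let ?k = "inv\<^bsub>G\<^esub> (g \<otimes>\<^bsub>G\<^esub> farr f a)"
    have k: "?k \<in> Ay" using g fa by (simp add: inv_homs y_homs)
    have "farr f a \<otimes>\<^bsub>G\<^esub> ?k = inv\<^bsub>G\<^esub> g"
      using g fa by (simp add: G.G.inv_mult_group G.G.m_assoc[symmetric] inv_homs)
    then have "act B (farr f a) (act B ?k w) = act B (inv\<^bsub>G\<^esub> g) w"
      using group_repD(4)[OF group_rep_B, of "farr f a" ?k w] fa k w by simp
    then have "\<gamma> w x v (g \<otimes>\<^bsub>G\<^esub> farr f a) = \<gamma> w x (act A a v) g"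
      unfolding \<gamma>_def
      using ind_pure_balanced[OF rep_AB x g a pure_cl[OF x v act_B_closed[OF k w]]]
        act_AB[OF x a v act_B_closed[OF k w]] by simp
    then show "\<beta> w x (\<delta> (g \<otimes>\<^bsub>G\<^esub> farr f a)) v = \<beta> w x (\<delta> g) (act A a v)"
      using x g v w fa av by (simp add: \<beta>_basis y_homs)
  qed
  have lift: "(\<lambda>t. \<mu> t w) \<in> lin_maps K (lan A) (lan AB)"
    "\<And>x g v. x \<in> I \<Longrightarrow> g \<in> Ay \<Longrightarrow> v \<in> carrier (ob A x) \<Longrightarrow>
       \<mu> (linj A x (\<delta> g) v) w = linj AB x (\<delta> g) (pAB x v (act B (inv\<^bsub>G\<^esub> g) w))"
    if w: "w \<in> carrier (ob B y)" for w
  proof -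
    have "\<forall>x\<in>I. \<beta> w x \<in> bilinear_maps K G.kG (ob A x) (?i x)" "\<forall>x\<in>I. ind_balanced A x (\<beta> w x)"
      using \<beta>_bil[OF w] \<beta>_bal[OF w] by blast+
    note l = lan_lift[OF A modules_ind[OF rep_AB] this]
    show "(\<lambda>t. \<mu> t w) \<in> lin_maps K (lan A) (lan AB)"
      unfolding \<mu>_def lan_eq_dsum[OF rep_AB] by (rule l(1))
    show "\<mu> (linj A x (\<delta> g) v) w = linj AB x (\<delta> g) (pAB x v (act B (inv\<^bsub>G\<^esub> g) w))"
      if "x \<in> I" "g \<in> Ay" "v \<in> carrier (ob A x)" for x g v
      using l(2)[OF that(1) _ that(3), of "\<delta> g"] that w
      by (simp add: \<mu>_def \<beta>_basis G.basis_kG lan_inj_eq[OF rep_AB]) (simp add: \<gamma>_def)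
  qed
  \<comment> \<open>Linearity of \<open>\<mu>\<close> in \<open>w\<close> is not visible from its
    definition as a lift. It is obtained by comparing linear maps in \<open>t\<close> on generators,
    where the value is this expression.\<close>
  have val_lin: "(\<lambda>w. linj AB x (\<delta> g) (pAB x v (act B (inv\<^bsub>G\<^esub> g) w))) \<in> lin_maps K (ob B y) (lan AB)"
    if "x \<in> I" "g \<in> Ay" "v \<in> carrier (ob A x)" for x g v
    using that G.basis_kG[of g]
    by (intro lin_comp[OF group_repD(2)[OF group_rep_B] lin_comp[OF bilinear_right[OF pAB_bil]
        bilinear_right[OF lan_inj_bilinear[OF rep_AB]]]]) (auto simp: inv_homs)
  interpret B: module K "ob B y" by (rule module_B)
  note mLAB = module_lan[OF rep_AB]
  have \<mu>_bil: "\<mu> \<in> bilinear_maps K (lan A) (ob B y) (lan AB)"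
  proof (rule bilinearI[OF linI lift(1)])
    fix t w assume t: "t \<in> carrier (lan A)" and w: "w \<in> carrier (ob B y)"
    show "\<mu> t w \<in> carrier (lan AB)" by (rule lin_closed[OF lift(1)[OF w] t])
    { fix u assume u: "u \<in> carrier (ob B y)"
      show "\<mu> t (u \<oplus>\<^bsub>ob B y\<^esub> w) = \<mu> t u \<oplus>\<^bsub>lan AB\<^esub> \<mu> t w"
        by (rule lin_eq_lan[OF A mLAB lift(1) lin_plus[OF mLAB lift(1)[OF u] lift(1)[OF w]] _ t])
          (use u w in \<open>simp_all add: lift(2) lin_add[OF val_lin]\<close>) }
    fix k assume k: "k \<in> carrier K"
    show "\<mu> t (k \<odot>\<^bsub>ob B y\<^esub> w) = k \<odot>\<^bsub>lan AB\<^esub> \<mu> t w"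
      by (rule lin_eq_lan[OF A mLAB lift(1) lin_scale[OF mLAB lift(1)[OF w] k] _ t])
        (use k w in \<open>simp_all add: lift(2) lin_smult[OF val_lin]\<close>)
  qed
  note inv = tensor_lift_tensor[OF mL module_B mLAB \<mu>_bil]
  have "tensor_lift K (lan AB) \<mu> (lambda t) = t" if "t \<in> carrier (lan AB)" for t
  proof (rule lin_eq_lan_AB[OF mLAB lin_comp[OF proj_lan(1) inv(1)] lin_ident _ that])
    fix x g v w assume *: "x \<in> I" "g \<in> Ay" "v \<in> carrier (ob A x)" "w \<in> carrier (ob B y)"
    have "act B (inv\<^bsub>G\<^esub> g) (act B g w) = w"
      using group_repD(4)[OF group_rep_B, of "inv\<^bsub>G\<^esub> g" g w] group_repD(3)[OF group_rep_B] * by (simp add: inv_homs)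
    then show "tensor_lift K (lan AB) \<mu> (lambda (linj AB x (\<delta> g) (pAB x v w))) =
        linj AB x (\<delta> g) (pAB x v w)"
      using * by (simp add: proj_lan(2) inv(2) lan_inj_closed[OF A] act_B_closed lift(2))
  qed
  then show ?thesis by (rule inj_on_inverseI)
qed

end

end

section \<open>The pre-Nakayama map\<close>

context kan_at
begin

context
  fixes A :: "('x,'a,'k,'v) rep" and \<phi>
  assumes A: "rep_on K X A" and \<phi>: "\<phi> \<in> carrier (rkan A)"
begin

abbreviation "R1 \<equiv> right U1"
abbreviation "P \<equiv> I \<times> Ay"

lemma rep_R1: "rep_on K Y R1"
  by (rule rep_on_right_kan[OF rep_unit])

lemma fin_P: "finite P"
  by (simp add: finite_I fin_homs)

lemma phi_closed: "x \<in> I \<Longrightarrow> g \<in> Ay \<Longrightarrow> \<phi> x (\<delta> g) \<in> carrier (ob A x)"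
  using ran_closed[OF A \<phi> _ G.basis_kG] by simp

abbreviation "phi p \<equiv> \<phi> (fst p) (\<delta> (snd p))"
abbreviation "ch p \<equiv> chi (fst p) (snd p)"

text \<open>One summand of the final value. It is present from the \<open>\<rho>\<close> preimage
  on, as the left tensor factor; the later arrows serve to evaluate the indicator away.\<close>

definition avg_term :: "'x \<times> 'b \<Rightarrow> 'x \<Rightarrow> (('b \<Rightarrow> 'k) \<times> 'v \<Rightarrow> 'k) set" where
  "avg_term p = c (fst p) \<odot>\<^bsub>lan A\<^esub> linj A (fst p) (\<delta> (inv\<^bsub>G\<^esub> (snd p))) (phi p)"

lemma P_D: "p \<in> P \<Longrightarrow> fst p \<in> I" "p \<in> P \<Longrightarrow> snd p \<in> Ay"
  by auto

lemma avg_term_closed: "p \<in> P \<Longrightarrow> avg_term p \<in> carrier (lan A)"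
  unfolding avg_term_def
  by (intro module.smult_closed[OF module_lan[OF A]] c_closed lan_inj_closed[OF A] inv_homs phi_closed P_D)

abbreviation "pure_AR p \<equiv> pure_tensor K (ob A (fst p)) (ob R1 y) (phi p) (act R1 (snd p) (ch p))"

text \<open>The left inverse of \<open>\<rho>\<close> applied to \<open>Phi\<close>: there the
  inverse of \<open>g\<close> turns \<open>1 \<otimes> \<phi>(x, g)\<close> into
  \<open>g\<inverse> \<otimes> \<phi>(x, g)\<close>.\<close>

definition rho_preimage where
  "rho_preimage = (\<Oplus>\<^bsub>tensor K (lan A) (ob R1 y)\<^esub>p\<in>P. pure_tensor K (lan A) (ob R1 y) (avg_term p) (ch p))"

text \<open>On a generator starting with \<open>g\<inverse>\<close> the map \<open>\<lambda>\<close>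
  lets \<open>g\<inverse>\<close> act on the second factor, so that factor is the indicator
  translated by \<open>g\<close> beforehand.\<close>

definition lambda_preimage where
  "lambda_preimage = (\<Oplus>\<^bsub>lan (tensor_rep K X A (pullback f R1))\<^esub>p\<in>P.
     c (fst p) \<odot>\<^bsub>lan (tensor_rep K X A (pullback f R1))\<^esub>
       linj (tensor_rep K X A (pullback f R1)) (fst p) (\<delta> (inv\<^bsub>G\<^esub> (snd p)))
         (pure_AR p))"

text \<open>The state of the composite just before \<open>\<rho>\<close> is inverted, as
  \<open>Phi_eq\<close> confirms.\<close>

abbreviation "Phi \<equiv> (\<lambda>x\<in>I. \<lambda>r\<in>carrier G.kG. pure_tensor K (lan A) self (linj A x (\<delta> \<one>\<^bsub>G\<^esub>) (\<phi> x r)) \<one>\<^bsub>K\<^esub>)"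

lemma Phi_eq: "ran_map K X Y f
    (\<lambda>x. tensor_map K (ob (left A) (fobj f x)) self (eta A x) (\<lambda>c. c)) y
    (ran_map K X Y f (\<lambda>x. unitor_r_inv K (ob A x)) y \<phi>) = Phi"
proof -
  have "tensor_map K (ob (left A) (fobj f x)) self (eta A x) (\<lambda>c. c)
      (unitor_r_inv K (ob A x) (\<phi> x r)) = pure_tensor K (lan A) self (linj A x (\<delta> \<one>\<^bsub>G\<^esub>) (\<phi> x r)) \<one>\<^bsub>K\<^esub>"
    if x: "x \<in> I" and r: "r \<in> carrier G.kG" for x r
    using tensor_map_linear(2)[OF module_at[OF A x] module_self_K module_lan[OF A] module_self_K
        eta_lan_linear[OF A x] lin_ident ran_closed[OF A \<phi> x r]]
    by (simp add: I_D[OF x] unitor_r_inv_def eta_lan_eq[OF x] self_module_simps)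
  then show ?thesis by (auto simp: ran_map_def intro!: restrict_ext)
qed

lemma chi_P: "p \<in> P \<Longrightarrow> ch p \<in> carrier (ob R1 y)"
  using chi_closed by auto

lemma rho_preimage_summand: "(\<lambda>p. pure_tensor K (lan A) (ob R1 y) (avg_term p) (ch p)) \<in> P \<rightarrow> carrier (tensor K (lan A) (ob R1 y))"
  by (intro Pi_I bilinear_closed[OF pure_tensor_bilinear[OF module_lan[OF A] module_ran[OF rep_unit]]]
      avg_term_closed chi_P)

lemma rho_preimage_closed: "rho_preimage \<in> carrier (tensor K (lan A) (ob R1 y))"
proof -
  interpret T: module K "tensor K (lan A) (ob R1 y)"
    by (rule module_tensor[OF module_lan[OF A] module_ran[OF rep_unit]])
  show ?thesis unfolding rho_preimage_def by (rule T.finsum_closed[OF rho_preimage_summand])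
qed

text \<open>\<open>proj_ran_inj\<close> shows only that a preimage is unique; that
  \<open>Phi\<close> has one is checked here by evaluating \<open>\<rho>\<close> on the
  candidate.\<close>

lemma rho_of_preimage: "rho (left A) U1 rho_preimage = Phi"
proof -
  let ?rho = "rho (left A) U1" and ?T = "tensor K (lan A) self"
  let ?p = "pure_tensor K (lan A) self"
  note mL = module_lan[OF A] and rL = rep_on_left_kan[OF A]
  note mT = module_tensor[OF mL module_self_K]
  note p = pure_tensor_bilinear[OF mL module_self_K]
  have oneK: "\<one>\<^bsub>K\<^esub> \<in> carrier self"
    by (simp add: self_module_simps)
  interpret T: module K ?T by (rule mT)
  interpret L: module K "lan A" by (rule mL)
  have basis: "?rho rho_preimage x (\<delta> h) = ?p (linj A x (\<delta> \<one>\<^bsub>G\<^esub>) (\<phi> x (\<delta> h))) \<one>\<^bsub>K\<^esub>"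
    if x: "x \<in> I" and h: "h \<in> Ay" for x h
  proof -
    have r: "(\<lambda>T. ?rho T x (\<delta> h)) \<in> lin_maps K (tensor K (lan A) (ob R1 y)) ?T"
      using bilinear_right[OF rho_bilinear[OF rL rep_unit x] G.basis_kG] h by (simp add: unit_rep_simps)
    have "?rho rho_preimage x (\<delta> h) = (\<Oplus>\<^bsub>?T\<^esub>p\<in>P. ?rho (pure_tensor K (lan A) (ob R1 y) (avg_term p) (ch p)) x (\<delta> h))"
      unfolding rho_preimage_def
      by (rule lin_finsum[OF module_tensor[OF mL module_ran[OF rep_unit]] mT r fin_P rho_preimage_summand])
    also have "\<dots> = ?p (linj A x (\<delta> \<one>\<^bsub>G\<^esub>) (\<phi> x (\<delta> h))) \<one>\<^bsub>K\<^esub>"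
    proof (rule orbit_sum[OF mT x h])
      have v: "linj A x (\<delta> \<one>\<^bsub>G\<^esub>) (\<phi> x (\<delta> h)) \<in> carrier (lan A)"
        by (rule lan_inj_closed[OF A x one_homs phi_closed[OF x h]])
      then show "?p (linj A x (\<delta> \<one>\<^bsub>G\<^esub>) (\<phi> x (\<delta> h))) \<one>\<^bsub>K\<^esub> \<in> carrier ?T"
        by (rule bilinear_closed[OF p _ oneK])
      fix x' g assume x': "x' \<in> I" and g: "g \<in> Ay"
      let ?w = "c x' \<odot>\<^bsub>lan A\<^esub> linj A x' (\<delta> (h \<otimes>\<^bsub>G\<^esub> inv\<^bsub>G\<^esub> g)) (\<phi> x' (\<delta> g))"
      have ig: "inv\<^bsub>G\<^esub> g \<in> Ay" using g by (rule inv_homs)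
      have wc: "?w \<in> carrier (lan A)"
        by (intro L.smult_closed c_closed x' lan_inj_closed[OF A] y_homs h ig phi_closed g)
      have "act (left A) h (avg_term (x', g)) = ?w"
        using lin_smult[OF lan_act(1)[OF A h] c_closed[OF x'] lan_inj_closed[OF A x' ig phi_closed[OF x' g]]]
        by (simp add: avg_term_def lan_act(2)[OF A h x' ig phi_closed[OF x' g]])
      then have eq: "?rho (pure_tensor K (lan A) (ob R1 y) (avg_term (x', g)) (ch (x', g))) x (\<delta> h) = ?p ?w (chi x' g x (\<delta> h))"
        using rho_pure[OF rL rep_unit x h avg_term_closed chi_P, of "(x', g)" "(x', g)"] x' g
        by (simp add: unit_rep_simps)
      show "?rho (pure_tensor K (lan A) (ob R1 y) (avg_term (x', g)) (ch (x', g))) x (\<delta> h) =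
        (if x' = x \<and> (\<exists>a\<in>Ax x. h = farr f a \<otimes>\<^bsub>G\<^esub> g)
         then c x \<odot>\<^bsub>?T\<^esub> ?p (linj A x (\<delta> \<one>\<^bsub>G\<^esub>) (\<phi> x (\<delta> h))) \<one>\<^bsub>K\<^esub> else \<zero>\<^bsub>?T\<^esub>)"
      proof (cases "x' = x \<and> (\<exists>a\<in>Ax x. h = farr f a \<otimes>\<^bsub>G\<^esub> g)")
        case True
        then obtain a where x'x: "x' = x" and a: "a \<in> Ax x" and ha: "h = farr f a \<otimes>\<^bsub>G\<^esub> g" by blast
        note fa = farr_G[OF x a]
        \<comment> \<open>For \<open>h = f(a) g\<close> the product \<open>h g\<inverse>\<close> is
          \<open>f(a)\<close>, which crosses the tensor sign and turns \<open>\<phi>(x, g)\<close>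
          into \<open>\<phi>(x, h)\<close>. The term no longer depends on \<open>g\<close>, as
          \<open>orbit_sum\<close> requires.\<close>
        have "h \<otimes>\<^bsub>G\<^esub> inv\<^bsub>G\<^esub> g = \<one>\<^bsub>G\<^esub> \<otimes>\<^bsub>G\<^esub> farr f a"
          unfolding ha using fa g ig by (simp add: G.G.m_assoc)
        then have "linj A x (\<delta> (h \<otimes>\<^bsub>G\<^esub> inv\<^bsub>G\<^esub> g)) (\<phi> x (\<delta> g)) = linj A x (\<delta> \<one>\<^bsub>G\<^esub>) (act A a (\<phi> x (\<delta> g)))"
          using lan_inj_balanced[OF A x one_homs a phi_closed[OF x g]] by simp
        also have "act A a (\<phi> x (\<delta> g)) = \<phi> x (\<delta> h)"
          using ran_equivariant[OF A \<phi> x a g] ha by simp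
        finally have "?w = c x \<odot>\<^bsub>lan A\<^esub> linj A x (\<delta> \<one>\<^bsub>G\<^esub>) (\<phi> x (\<delta> h))" by (simp add: x'x)
        moreover have "chi x' g x (\<delta> h) = \<one>\<^bsub>K\<^esub>" using True x h by (simp add: chi_basis)
        ultimately show ?thesis
          unfolding eq using True v c_closed[OF x] by (simp add: lin_smult[OF bilinear_left[OF p oneK]])
      next
        case False
        then have "chi x' g x (\<delta> h) = \<zero>\<^bsub>self\<^esub>" using x h by (auto simp: chi_basis self_module_simps)
        then show ?thesis
          unfolding eq using False lin_zero[OF module_self_K mT bilinear_right[OF p wc]] by auto
      qed
    qed
    finally show ?thesis .
  qed
  \<comment> \<open>Both sides are linear in \<open>r\<close>, so agreement at group elements is
    enough.\<close>
  have "?rho rho_preimage x r = ?p (linj A x (\<delta> \<one>\<^bsub>G\<^esub>) (\<phi> x r)) \<one>\<^bsub>K\<^esub>" if x: "x \<in> I" and r: "r \<in> carrier G.kG" for x r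
  proof (rule G.lin_eq_kG[OF mT _ _ _ r])
    show "(\<lambda>r. ?rho rho_preimage x r) \<in> lin_maps K G.kG ?T"
      using bilinear_left[OF rho_bilinear[OF rL rep_unit x] rho_preimage_closed] by (simp add: unit_rep_simps)
    show "(\<lambda>r. ?p (linj A x (\<delta> \<one>\<^bsub>G\<^esub>) (\<phi> x r)) \<one>\<^bsub>K\<^esub>) \<in> lin_maps K G.kG ?T"
      by (intro lin_comp[OF lin_comp[OF ran_linear[OF A \<phi> x]] bilinear_left[OF p oneK]]
          bilinear_right[OF lan_inj_bilinear[OF A x]] G.basis_kG) (simp add: one_homs)
  qed (use basis x in simp)
  then show ?thesis
    by (subst rho_ext[OF rL rep_unit]) (auto intro!: restrict_ext)
qed

abbreviation "AR \<equiv> tensor_rep K X A (pullback f R1)"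

lemma lambda_preimage_pure_closed:
  assumes "p \<in> P"
  shows "pure_AR p \<in> carrier (ob AR (fst p))"
  by (rule bilinear_closed[OF pAB_bil[OF A rep_R1 P_D(1)[OF assms]] phi_closed[OF P_D[OF assms]]
        act_B_closed[OF A rep_R1 P_D(2)[OF assms] chi_P[OF assms]]])

lemma lambda_preimage_summand: "(\<lambda>p. c (fst p) \<odot>\<^bsub>lan AR\<^esub> linj AR (fst p) (\<delta> (inv\<^bsub>G\<^esub> (snd p)))
     (pure_AR p)) \<in> P \<rightarrow> carrier (lan AR)"
  by (intro Pi_I module.smult_closed[OF module_lan[OF rep_AB[OF A rep_R1]]] c_closed
      lan_inj_closed[OF rep_AB[OF A rep_R1]] inv_homs P_D lambda_preimage_pure_closed)

lemma lambda_preimage_closed: "lambda_preimage \<in> carrier (lan AR)"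
proof -
  interpret T: module K "lan AR" by (rule module_lan[OF rep_AB[OF A rep_R1]])
  show ?thesis unfolding lambda_preimage_def by (rule T.finsum_closed[OF lambda_preimage_summand])
qed

text \<open>Applied twice: to \<open>\<lambda>\<close> itself, and to the two arrows that follow its
  inverse.\<close>

lemma lin_lambda_preimage:
  assumes "module K M" "h \<in> lin_maps K (lan AR) M"
  shows "h lambda_preimage = (\<Oplus>\<^bsub>M\<^esub>p\<in>P. c (fst p) \<odot>\<^bsub>M\<^esub> h (linj AR (fst p) (\<delta> (inv\<^bsub>G\<^esub> (snd p)))
     (pure_AR p)))"
proof -
  note mAR = module_lan[OF rep_AB[OF A rep_R1]]
  interpret M: module K M by fact
  have s: "h (c (fst p) \<odot>\<^bsub>lan AR\<^esub> u) = c (fst p) \<odot>\<^bsub>M\<^esub> h u" if "p \<in> P" "u \<in> carrier (lan AR)" for p u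
    using that by (intro lin_smult[OF assms(2)] c_closed P_D)
  have cl: "linj AR (fst p) (\<delta> (inv\<^bsub>G\<^esub> (snd p)))
     (pure_AR p) \<in> carrier (lan AR)" if "p \<in> P" for p
    using that by (intro lan_inj_closed[OF rep_AB[OF A rep_R1]] inv_homs P_D lambda_preimage_pure_closed)
  show ?thesis
    unfolding lambda_preimage_def lin_finsum[OF mAR assms fin_P lambda_preimage_summand]
    using s cl lin_closed[OF assms(2)] c_closed by (intro M.finsum_cong') auto
qed

lemma lambda_of_preimage: "lambda A R1 lambda_preimage = rho_preimage"
proof -
  note mLB = module_tensor[OF module_lan[OF A] module_ran[OF rep_unit]]
  interpret T: module K "tensor K (lan A) (ob R1 y)" by (rule mLB)
  note gR = group_rep_ran[OF rep_unit]
  have "c (fst p) \<odot>\<^bsub>tensor K (lan A) (ob R1 y)\<^esub> lambda A R1 (linj AR (fst p) (\<delta> (inv\<^bsub>G\<^esub> (snd p)))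
     (pure_AR p)) =
     pure_tensor K (lan A) (ob R1 y) (avg_term p) (ch p)" if p: "p \<in> P" for p
  proof -
    note i = inv_homs[OF P_D(2)[OF p]]
    have "act R1 (inv\<^bsub>G\<^esub> (snd p)) (act R1 (snd p) (ch p)) = ch p"
      using group_repD(4)[OF gR, of "inv\<^bsub>G\<^esub> (snd p)" "snd p" "ch p"] group_repD(3)[OF gR chi_P[OF p]]
        chi_P[OF p] P_D(2)[OF p] i by simp
    then show ?thesis
      unfolding avg_term_def
      using proj_lan(2)[OF A rep_R1 P_D(1)[OF p] i phi_closed[OF P_D[OF p]] act_B_closed[OF A rep_R1 P_D(2)[OF p] chi_P[OF p]]]
        lin_smult[OF bilinear_left[OF pLB_bil[OF A rep_R1] chi_P[OF p]] c_closed[OF P_D(1)[OF p]]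
          lan_inj_closed[OF A P_D(1)[OF p] i phi_closed[OF P_D[OF p]]]]
      by simp
  qed
  then show ?thesis
    unfolding lin_lambda_preimage[OF mLB proj_lan(1)[OF A rep_R1]] rho_preimage_def
    using rho_preimage_summand by (intro T.finsum_cong') auto
qed

lemma proj_inv: "proj_lan_inv K X Y f A R1 y (proj_ran_inv K X Y f (left A) U1 y Phi) = lambda_preimage"
proof -
  have "proj_ran_inv K X Y f (left A) U1 y Phi = rho_preimage"
    unfolding proj_ran_inv_def rho_of_preimage[symmetric]
    by (rule inv_into_f_f[OF proj_ran_inj[OF rep_on_left_kan[OF A]]]) (simp add: ob_tensor_rep rho_preimage_closed)
  moreover have "proj_lan_inv K X Y f A R1 y rho_preimage = lambda_preimage"
    unfolding proj_lan_inv_def lambda_of_preimage[symmetric]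
    by (rule inv_into_f_f[OF proj_lan_inj[OF A rep_R1] lambda_preimage_closed])
  ultimately show ?thesis by simp
qed

text \<open>The value is kept as a sum in \<open>f_!A(y)\<close>, because the counit in
  \<open>unit_endo\<close> is linear on that module; components are taken only in
  \<open>pre_nakayama_formula\<close>.\<close>

lemma pre_nakayama_sum: "pre_nakayama K X Y f A y \<phi> = (\<Oplus>\<^bsub>lan A\<^esub>p\<in>P. avg_term p)"
proof -
  let ?AU = "tensor_rep K X A U1"
  let ?\<alpha> = "\<lambda>x. tensor_map K (ob A x) self (\<lambda>v. v) (eps_ran K X Y f x)"
  let ?\<beta> = "\<lambda>x. unitor_r K (ob A x)"
  let ?pU = "\<lambda>x. pure_tensor K (ob A x) self"
  note rAR = rep_AB[OF A rep_R1] and rAU = rep_on_tensor[OF XF.groupoid_axioms A rep_unit]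
  have obAU: "ob ?AU x = tensor K (ob A x) self" for x
    by (simp add: ob_tensor_rep unit_rep_simps)
  note obAR = ob_AB[OF A rep_R1]
  have eps: "eps_ran K X Y f x \<in> lin_maps K (ob R1 y) self" if "x \<in> I" for x
    using eps_ran_linear[OF rep_R1 rep_unit that] by (simp add: unit_rep_simps)
  have tm: "?\<alpha> x \<in> lin_maps K (tensor K (ob A x) (ob R1 y)) (ob ?AU x)"
    "\<And>v \<psi>. v \<in> carrier (ob A x) \<Longrightarrow> \<psi> \<in> carrier (ob R1 y) \<Longrightarrow>
       ?\<alpha> x (pure_tensor K (ob A x) (ob R1 y) v \<psi>) = ?pU x v (\<psi> x (\<delta> \<one>\<^bsub>G\<^esub>))"
    if "x \<in> I" for x
    using tensor_map_linear[OF module_at[OF A that] module_ran[OF rep_unit] module_at[OF A that] module_self_K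
        lin_ident eps[OF that]]
    by (simp_all add: obAU eps_ran_def kG_one_y[OF that])
  have actAU: "act ?AU a (?pU x v k) = ?pU x (act A a v) k"
    if "x \<in> I" "a \<in> Ax x" "v \<in> carrier (ob A x)" "k \<in> carrier K" for x a v k
    using act_tensor_rep(2)[OF A rep_unit I_D(2)[OF that(1)] that(2,3), of k] that(4)
    by (simp add: unit_rep_simps self_module_simps)
  have aAR: "act AR a \<in> lin_maps K (tensor K (ob A x) (ob R1 y)) (tensor K (ob A x) (ob R1 y))"
    if "x \<in> I" "a \<in> Ax x" for x a
    using act_at[OF rAR that] by (simp add: obAR that)
  have eq1: "?\<alpha> x (act AR a t) = act ?AU a (?\<alpha> x t)"
    if x: "x \<in> I" and a: "a \<in> Ax x" and t: "t \<in> carrier (ob AR x)" for x a t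
  proof (rule lin_eq_tensor[OF module_at[OF A x] module_ran[OF rep_unit] module_at[OF rAU x]])
    show "t \<in> carrier (tensor K (ob A x) (ob R1 y))" using t by (simp add: obAR x)
    fix v \<psi> assume v: "v \<in> carrier (ob A x)" and \<psi>: "\<psi> \<in> carrier (ob R1 y)"
    note fa = farr_G[OF x a]
    \<comment> \<open>The counit is equivariant for the trivial action: evaluating
      \<open>f(a) \<psi>\<close> at 1 gives the value of \<open>\<psi>\<close> at
      \<open>f(a)\<close>, which equals its value at 1.\<close>
    have "act R1 (farr f a) \<psi> x (\<delta> \<one>\<^bsub>G\<^esub>) = \<psi> x (\<delta> \<one>\<^bsub>G\<^esub>)"
      using ran_act_basis[OF rep_unit fa one_homs x] ran_equivariant[OF rep_unit \<psi> x a one_homs] fa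
      by (simp add: unit_rep_simps)
    then show "?\<alpha> x (act AR a (pure_tensor K (ob A x) (ob R1 y) v \<psi>)) = act ?AU a (?\<alpha> x (pure_tensor K (ob A x) (ob R1 y) v \<psi>))"
      using x a v \<psi> fa lin_closed[OF act_at[OF A x a] v] act_B_closed[OF A rep_R1 fa \<psi>]
        ran_unit_closed[OF \<psi> x G.basis_kG] one_homs
      by (simp add: act_AB[OF A rep_R1] tm(2) actAU)
  qed (rule lin_comp[OF aAR[OF x a] tm(1)[OF x]] lin_comp[OF tm(1)[OF x] act_at[OF rAU x a]])+
  have "\<forall>x\<in>I. ?\<alpha> x \<in> lin_maps K (ob AR x) (ob ?AU x)"
    "\<forall>x\<in>I. \<forall>a\<in>Ax x. \<forall>t\<in>carrier (ob AR x). ?\<alpha> x (act AR a t) = act ?AU a (?\<alpha> x t)"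
    using tm(1) eq1 by (simp_all add: obAR)
  note m2 = lan_map[OF rAR rAU this]
  note ur = unitor_r_linear[OF module_at[OF A]]
  have eq2: "?\<beta> x (act ?AU a t) = act A a (?\<beta> x t)"
    if x: "x \<in> I" and a: "a \<in> Ax x" and t: "t \<in> carrier (ob ?AU x)" for x a t
  proof (rule lin_eq_tensor[OF module_at[OF A x] module_self_K module_at[OF A x]])
    show "t \<in> carrier (tensor K (ob A x) self)" using t by (simp add: obAU)
    show "(\<lambda>t. ?\<beta> x (act ?AU a t)) \<in> lin_maps K (tensor K (ob A x) self) (ob A x)"
      using act_at[OF rAU x a] ur(1)[OF x] by (auto simp: obAU intro: lin_comp)
    show "(\<lambda>t. act A a (?\<beta> x t)) \<in> lin_maps K (tensor K (ob A x) self) (ob A x)"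
      by (rule lin_comp[OF ur(1)[OF x] act_at[OF A x a]])
    fix v k assume "v \<in> carrier (ob A x)" "k \<in> carrier self"
    then show "?\<beta> x (act ?AU a (?pU x v k)) = act A a (?\<beta> x (?pU x v k))"
      using x a lin_closed[OF act_at[OF A x a]]
      by (simp add: self_module_simps actAU ur(2) lin_smult[OF act_at[OF A x a]])
  qed
  have "\<forall>x\<in>I. ?\<beta> x \<in> lin_maps K (ob ?AU x) (ob A x)"
    "\<forall>x\<in>I. \<forall>a\<in>Ax x. \<forall>t\<in>carrier (ob ?AU x). ?\<beta> x (act ?AU a t) = act A a (?\<beta> x t)"
    using ur(1) eq2 by (auto simp: obAU)
  note m1 = lan_map[OF rAU A this]
  interpret L: module K "lan A" by (rule module_lan[OF A])
  let ?m1 = "lan_map K X Y f A ?\<beta> y" and ?m2 = "lan_map K X Y f ?AU ?\<alpha> y"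
  have "pre_nakayama K X Y f A y \<phi> = ?m1 (?m2 lambda_preimage)"
    unfolding pre_nakayama_def comp_apply Phi_eq proj_inv ..
  also have "\<dots> = (\<Oplus>\<^bsub>lan A\<^esub>p\<in>P. c (fst p) \<odot>\<^bsub>lan A\<^esub> ?m1 (?m2 (linj AR (fst p) (\<delta> (inv\<^bsub>G\<^esub> (snd p)))
     (pure_AR p))))"
    by (rule lin_lambda_preimage[OF module_lan[OF A] lin_comp[OF m2(1) m1(1)]])
  also have "\<dots> = (\<Oplus>\<^bsub>lan A\<^esub>p\<in>P. avg_term p)"
  proof (rule L.finsum_cong')
    show "avg_term \<in> P \<rightarrow> carrier (lan A)" using avg_term_closed by blast
    fix p assume p: "p \<in> P"
    note i = inv_homs[OF P_D(2)[OF p]] and x = P_D(1)[OF p] and g = P_D(2)[OF p]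
    note v = phi_closed[OF x g] and a = act_B_closed[OF A rep_R1 g chi_P[OF p]]
    \<comment> \<open>The coset of \<open>g\<close> contains \<open>g\<close>, witnessed by the
      identity of \<open>x\<close>. So the translated indicator takes the value one at the unit, and
      no factor is left.\<close>
    have "\<exists>a\<in>homs X (fst p) (fst p). snd p = farr f a \<otimes>\<^bsub>G\<^esub> snd p"
      using XF.idn_hom[OF I_D(2)[OF x]] fmap.farr_idn[OF I_D(2)[OF x]] I_D(1)[OF x] g G.G.l_one[of "snd p"]
      by (intro bexI[of _ "idn X (fst p)"]) (simp_all add: one_aut)
    then have one: "act R1 (snd p) (ch p) (fst p) (\<delta> \<one>\<^bsub>G\<^esub>) = \<one>\<^bsub>K\<^esub>"
      using ran_act_basis[OF rep_unit g one_homs x] x g by (simp add: chi_basis)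
    have id: "\<delta> (inv\<^bsub>G\<^esub> (snd p)) \<in> carrier G.kG" using i by (simp add: G.basis_kG)
    have pc: "?pU (fst p) (phi p) \<one>\<^bsub>K\<^esub> \<in> carrier (ob ?AU (fst p))"
      using bilinear_closed[OF pure_tensor_bilinear[OF module_at[OF A x] module_self_K] v]
      by (simp add: obAU self_module_simps)
    interpret V: module K "ob A (fst p)" by (rule module_at[OF A x])
    show "c (fst p) \<odot>\<^bsub>lan A\<^esub> ?m1 (?m2 (linj AR (fst p) (\<delta> (inv\<^bsub>G\<^esub> (snd p)))
        (pure_AR p))) = avg_term p"
      unfolding m2(2)[OF x id lambda_preimage_pure_closed[OF p]] tm(2)[OF x v a] one m1(2)[OF x id pc] avg_term_def
      using v by (simp add: ur(2)[OF x v])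
  qed simp
  finally show ?thesis .
qed

lemma pre_nakayama_formula:
  "pre_nakayama K X Y f A y \<phi> = (\<lambda>x\<in>I. c x \<odot>\<^bsub>ind A x\<^esub>
     (\<Oplus>\<^bsub>ind A x\<^esub>g\<in>Ay. ipure A x (\<delta> (inv\<^bsub>G\<^esub> g)) (\<phi> x (\<delta> g))))"
proof (rule extensionalityI[where A = I])
  interpret L: module K "lan A" by (rule module_lan[OF A])
  have "pre_nakayama K X Y f A y \<phi> \<in> carrier (lan A)"
    unfolding pre_nakayama_sum using avg_term_closed by (intro L.finsum_closed) blast
  then show "pre_nakayama K X Y f A y \<phi> \<in> extensional I"
    by (simp add: lan_eq_dsum[OF A] mem_dsum)
  fix x assume x: "x \<in> I"
  interpret J: module K "ind A x" by (rule module_ind[OF A x])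
  have pj: "(\<lambda>t. t x) \<in> lin_maps K (lan A) (ind A x)"
    using dsum_proj_linear[OF x] by (simp add: lan_eq_dsum[OF A])
  have ip: "ipure A x (\<delta> (inv\<^bsub>G\<^esub> g)) (\<phi> x (\<delta> g)) \<in> carrier (ind A x)" if "g \<in> Ay" for g
    using bilinear_closed[OF ind_pure_bilinear[OF A x] G.basis_kG phi_closed[OF x that]] inv_homs[OF that] by simp
  have val: "avg_term (x', g) x = (if x' = x then c x \<odot>\<^bsub>ind A x\<^esub> ipure A x (\<delta> (inv\<^bsub>G\<^esub> g)) (\<phi> x (\<delta> g)) else \<zero>\<^bsub>ind A x\<^esub>)"
    if "x' \<in> I" "g \<in> Ay" for x' g
    using that x c_closed[OF that(1)] by (auto simp: avg_term_def lan_eq_dsum[OF A] dsum_ops lan_inj_eq[OF A] dsum_inj_def)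
  have "pre_nakayama K X Y f A y \<phi> x = (\<Oplus>\<^bsub>ind A x\<^esub>p\<in>P. avg_term p x)"
    unfolding pre_nakayama_sum
    by (rule lin_finsum[OF module_lan[OF A] module_ind[OF A x] pj fin_P]) (use avg_term_closed in blast)
  \<comment> \<open>In the component at \<open>x\<close> only the pairs with first entry
    \<open>x\<close> survive.\<close>
  also have "\<dots> = (\<Oplus>\<^bsub>ind A x\<^esub>p\<in>Pair x ` Ay. avg_term p x)"
  proof (rule J.add.finprod_mono_neutral_cong_right)
    show "(\<lambda>p. avg_term p x) \<in> P \<rightarrow> carrier (ind A x)"
      using lin_closed[OF pj] avg_term_closed by blast
    show "avg_term p x = \<zero>\<^bsub>ind A x\<^esub>" if "p \<in> P - Pair x ` Ay" for p
    proof -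
      from that obtain x' g where p: "p = (x', g)" "x' \<in> I" "g \<in> Ay" "x' \<noteq> x" by blast
      then show ?thesis using val by simp
    qed
  qed (use x fin_P in auto)
  also have "\<dots> = (\<Oplus>\<^bsub>ind A x\<^esub>g\<in>Ay. avg_term (x, g) x)"
    by (rule J.add.finprod_reindex)
      (use lin_closed[OF pj] avg_term_closed x in \<open>auto intro: inj_onI\<close>)
  also have "\<dots> = (\<Oplus>\<^bsub>ind A x\<^esub>g\<in>Ay. c x \<odot>\<^bsub>ind A x\<^esub> ipure A x (\<delta> (inv\<^bsub>G\<^esub> g)) (\<phi> x (\<delta> g)))"
    using ip c_closed[OF x] x by (intro J.finsum_cong') (auto simp: val)
  also have "\<dots> = c x \<odot>\<^bsub>ind A x\<^esub> (\<Oplus>\<^bsub>ind A x\<^esub>g\<in>Ay. ipure A x (\<delta> (inv\<^bsub>G\<^esub> g)) (\<phi> x (\<delta> g)))"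
    using ip c_closed[OF x] fin_homs by (intro J.finsum_smult_ldistr[symmetric]) auto
  finally show "pre_nakayama K X Y f A y \<phi> x = (\<lambda>x\<in>I. c x \<odot>\<^bsub>ind A x\<^esub>
     (\<Oplus>\<^bsub>ind A x\<^esub>g\<in>Ay. ipure A x (\<delta> (inv\<^bsub>G\<^esub> g)) (\<phi> x (\<delta> g)))) x"
    using x by simp
qed simp

end

end

section \<open>The endomorphism \<open>\<delta>\<close>\<close>

text \<open>Each nonempty fibre of \<open>h\<close> is a translate of the kernel, so the group is
  counted fibre by fibre over the image.\<close>

lemma group_hom_card:
  assumes "group_hom G H h" "finite (carrier G)"
  shows "card (carrier G) = card (h ` carrier G) * card (kernel G H h)"
proof -
  interpret group_hom G H h by fact
  have fibre: "card {a \<in> carrier G. h a = b} = card (kernel G H h)" if "b \<in> h ` carrier G" for b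
  proof -
    from that obtain a0 where a0: "a0 \<in> carrier G" "b = h a0" by blast
    have "{a \<in> carrier G. h a = b} = (\<lambda>k. a0 \<otimes>\<^bsub>G\<^esub> k) ` kernel G H h"
    proof (intro equalityI subsetI)
      fix a assume a: "a \<in> {a \<in> carrier G. h a = b}"
      then have "inv\<^bsub>G\<^esub> a0 \<otimes>\<^bsub>G\<^esub> a \<in> kernel G H h" using a0 by (simp add: kernel_def)
      moreover have "a = a0 \<otimes>\<^bsub>G\<^esub> (inv\<^bsub>G\<^esub> a0 \<otimes>\<^bsub>G\<^esub> a)" using a a0 by (simp add: G.m_assoc[symmetric])
      ultimately show "a \<in> (\<lambda>k. a0 \<otimes>\<^bsub>G\<^esub> k) ` kernel G H h" by blast
    qed (use a0 in \<open>auto simp: kernel_def\<close>)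
    moreover have "inj_on (\<lambda>k. a0 \<otimes>\<^bsub>G\<^esub> k) (kernel G H h)"
      using a0 by (auto intro!: inj_onI simp: kernel_def)
    ultimately show ?thesis by (simp add: card_image)
  qed
  have "card (carrier G) = (\<Sum>b\<in>h ` carrier G. card {a \<in> carrier G. h a = b})"
    using sum.image_gen[OF assms(2), of "\<lambda>_. 1::nat" h] by simp
  then show ?thesis using fibre by simp
qed

section \<open>The inclusion of a point into the full subgroupoid on one object\<close>

lemma objs_full_sub: "q \<in> objs G \<Longrightarrow> objs (full_sub G {q}) = {q}"
  by (auto simp: full_sub_def)

lemma homs_full_sub: "homs (full_sub G {q}) x z = (if x = q \<and> z = q then homs G q q else {})"
  by (auto simp: full_sub_def homs_def)

lemma full_sub_simps: "cmp (full_sub G S) = cmp G" "idn (full_sub G S) = idn G"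
  "src (full_sub G S) = src G" "tgt (full_sub G S) = tgt G"
  by (simp_all add: full_sub_def)

lemma (in groupoid) groupoid_full_sub:
  assumes "q \<in> objs G"
  shows "groupoid (full_sub G {q})"
proof
  fix a assume "a \<in> arrs (full_sub G {q})"
  then show "src (full_sub G {q}) a \<in> objs (full_sub G {q})" "tgt (full_sub G {q}) a \<in> objs (full_sub G {q})"
    using assms by (auto simp: full_sub_def)
qed (use assms idn_hom cmp_hom inverse in \<open>auto simp: homs_full_sub objs_full_sub full_sub_simps cmp_assoc
      cmp_idn_left cmp_idn_right split: if_splits\<close>)

lemma homs_point: "homs point_groupoid x z = {()}"
  by (auto simp: point_groupoid_def homs_def)

lemma ess_finite_point: "ess_finite_groupoid point_groupoid"
  by unfold_locales (auto simp: homs_point, auto simp: point_groupoid_def homs_def)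

lemma skeletal_point: "skeletal point_groupoid"
  by (simp add: skeletal_def point_groupoid_def)

text \<open>A connected component of the homotopy fibre may have many isomorphic objects, whereas
  one object alone is skeletal, as \<open>kan\<close> demands.\<close>

lemma (in groupoid) kan_at_point:
  assumes "field K" "char_zero K" "q \<in> objs G" "finite (homs G q q)"
  shows "kan_at point_groupoid (full_sub G {q}) (point_map G q) K q"
proof -
  interpret S: groupoid "full_sub G {q}" by (rule groupoid_full_sub[OF assms(3)])
  interpret pt: ess_finite_groupoid point_groupoid by (rule ess_finite_point)
  have "ess_finite_groupoid (full_sub G {q})"
    by unfold_locales (use assms in \<open>auto simp: objs_full_sub homs_full_sub\<close>)
  moreover have "groupoid_map point_groupoid (full_sub G {q}) (point_map G q)"
    by unfold_locales
      (use assms(3) idn_hom[OF assms(3)] in \<open>auto simp: point_map_def objs_full_sub homs_full_sub full_sub_simps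
        cmp_idn_left[of _ q q]\<close>)
  moreover have "skeletal (full_sub G {q})"
    by (auto simp: skeletal_def full_sub_def)
  ultimately show ?thesis
    using assms by (simp add: kan_at_def kan_at_axioms_def kan_def kan_axioms_def ess_finite_point
      skeletal_point objs_full_sub)
qed

text \<open>For the inclusion of a point the image of the automorphism group is trivial, so no
  denominator appears, and each automorphism of \<open>q\<close> contributes \<open>k\<close> once.
  The scalar is thus the number of automorphisms.\<close>

lemma (in groupoid) unit_endo_eq:
  assumes K: "field K" and "char_zero K" and q: "q \<in> objs G" and "finite (homs G q q)"
    and k: "k \<in> carrier K"
  shows "unit_endo K G q k = nat_scalar K (card (homs G q q)) \<otimes>\<^bsub>K\<^esub> k"
proof -
  interpret A: kan_at point_groupoid "full_sub G {q}" "point_map G q" K q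
    by (rule kan_at_point) fact+
  let ?S = "full_sub G {q}" and ?f = "point_map G q"
  let ?u = "unit_rep K"
  let ?\<phi> = "eta_ran K point_groupoid ?S ?f ?u q k"
  have I: "A.I = {()}" by (auto simp: obj_fibre_def point_groupoid_def point_map_def)
  have hq: "homs ?S q q = homs G q q" by (simp add: homs_full_sub)
  have u: "rep_on K ?S ?u" by (rule rep_on_unit[OF A.K.is_cring])
  have gu: "group_rep K A.G (self_module K) (\<lambda>_ c. c)"
    using A.group_rep_at[OF u] by (simp add: unit_rep_def)
  have fu: "rep_on K point_groupoid (pullback ?f ?u)"
    by (rule rep_on_pullback[OF A.fmap.groupoid_map_axioms u])
  have ob: "ob (pullback ?f ?u) x = self_module K" "act (pullback ?f ?u) a = (\<lambda>c. c)" for x a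
    by (simp_all add: pullback_def unit_rep_def)
  have ks: "k \<in> carrier (self_module K)" using k by (simp add: self_module_def)
  have gb: "group_algebra_act A.G (self_module K) (\<lambda>_ c. c) (basis_elt K g) k = k" if "g \<in> homs G q q" for g
    using A.G.group_algebra_act_basis[OF gu _ ks] that by (simp add: hq)
  have \<phi>_eq: "?\<phi> = (\<lambda>x\<in>A.I. \<lambda>r\<in>carrier A.G.kG. group_algebra_act A.G (self_module K) (\<lambda>_ c. c) r k)"
    by (simp add: eta_ran_def unit_rep_def)
  have \<phi>: "?\<phi> \<in> carrier (A.rkan (pullback ?f ?u))"
    unfolding \<phi>_eq
  proof (rule A.ranI[OF fu])
    show "(\<lambda>r. group_algebra_act A.G (self_module K) (\<lambda>_ c. c) r k) \<in> lin_maps K A.G.kG (ob (pullback ?f ?u) x)" for x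
      using bilinear_left[OF A.G.group_algebra_act_bilinear[OF gu] ks] by (simp add: ob)
    fix x a g assume *: "x \<in> A.I" "a \<in> homs point_groupoid x x" "g \<in> homs ?S q q"
    then have "farr ?f a \<otimes>\<^bsub>A.G\<^esub> g \<in> homs G q q" using A.farr_G[OF *(1,2)] A.y_homs[of "farr ?f a" g] by (simp add: hq)
    then show "group_algebra_act A.G (self_module K) (\<lambda>_ c. c) (basis_elt K (farr ?f a \<otimes>\<^bsub>A.G\<^esub> g)) k
        = act (pullback ?f ?u) a (group_algebra_act A.G (self_module K) (\<lambda>_ c. c) (basis_elt K g) k)"
      using *(3) by (simp add: gb ob hq)
  qed
  have \<phi>_val: "?\<phi> x (basis_elt K g) = k" if "x \<in> A.I" "g \<in> homs G q q" for x g
    using that gb A.G.basis_kG[of g] by (simp add: \<phi>_eq hq)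
  have c: "A.c x = \<one>\<^bsub>K\<^esub>" for x
  proof -
    have "farr ?f ` homs point_groupoid x x = {idn G q}" by (auto simp: point_map_def homs_point)
    then show ?thesis by simp
  qed
  have obu: "ob ?u q = self_module K" by (simp add: unit_rep_def)
  note ep = A.eps_lan[OF u, unfolded obu]
  interpret M: module K "self_module K" by (rule A.module_self_K)
  \<comment> \<open>The counit turns \<open>g\<inverse> \<otimes> k\<close> into the action of
    \<open>g\<inverse>\<close> on \<open>k\<close>, and that action is trivial on the unit.\<close>
  have val: "eps_lan K point_groupoid ?S ?f ?u q (A.avg_term (pullback ?f ?u) ?\<phi> p) = k"
    if p: "p \<in> A.I \<times> homs ?S q q" for p
  proof -
    note x = A.P_D(1)[OF fu \<phi> p] and g = A.P_D(2)[OF fu \<phi> p]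
    note i = A.inv_homs[OF g]
    have l: "A.linj (pullback ?f ?u) (fst p) (basis_elt K (inv\<^bsub>A.G\<^esub> (snd p))) k \<in> carrier (A.lan (pullback ?f ?u))"
      by (rule A.lan_inj_closed[OF fu x i]) (simp add: ob ks)
    interpret L: module K "A.lan (pullback ?f ?u)" by (rule A.module_lan[OF fu])
    show ?thesis
      unfolding A.avg_term_def[OF fu \<phi>] \<phi>_val[OF x g[unfolded hq]] c L.smult_one[OF l] ep(2)[OF x i ks]
      by (simp add: unit_rep_def)
  qed
  have tL: "A.avg_term (pullback ?f ?u) ?\<phi> \<in> A.I \<times> homs ?S q q \<rightarrow> carrier (A.lan (pullback ?f ?u))"
    using A.avg_term_closed[OF fu \<phi>] by blast
  have "unit_endo K G q k = eps_lan K point_groupoid ?S ?f ?u q (pre_nakayama K point_groupoid ?S ?f (pullback ?f ?u) q ?\<phi>)"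
    by (simp add: unit_endo_def Let_def)
  also have "\<dots> = (\<Oplus>\<^bsub>self_module K\<^esub>p\<in>A.I \<times> homs ?S q q. eps_lan K point_groupoid ?S ?f ?u q (A.avg_term (pullback ?f ?u) ?\<phi> p))"
    unfolding A.pre_nakayama_sum[OF fu \<phi>]
    by (rule lin_finsum[OF A.module_lan[OF fu] A.module_self_K ep(1) A.fin_P[OF fu \<phi>] tL])
  also have "\<dots> = (\<Oplus>\<^bsub>self_module K\<^esub>p\<in>A.I \<times> homs ?S q q. k)"
    by (intro M.finsum_cong') (use val ks in auto)
  also have "\<dots> = [card (A.I \<times> homs ?S q q)] \<cdot>\<^bsub>self_module K\<^esub> k"
    by (rule M.add.finprod_const[OF ks])
  also have "\<dots> = nat_scalar K (card (homs G q q)) \<otimes>\<^bsub>K\<^esub> k"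
    unfolding M.add_pow_eq_smult[OF ks] by (simp add: I hq card_cartesian_product self_module_def)
  finally show ?thesis .
qed

section \<open>The homotopy fibre as a groupoid\<close>

lemma objs_hfib: "(x, h) \<in> objs (hfib X Y f y) \<longleftrightarrow> x \<in> objs X \<and> h \<in> homs Y (fobj f x) y"
  by (simp add: hfib_def Let_def)

lemma mem_homs_hfib: "e \<in> homs (hfib X Y f y) p q \<longleftrightarrow> (\<exists>a. e = (p, a, q) \<and> p \<in> objs (hfib X Y f y) \<and>
   q \<in> objs (hfib X Y f y) \<and> a \<in> homs X (fst p) (fst q) \<and> cmp Y (snd q) (farr f a) = snd p)"
  by (auto simp: homs_def hfib_def Let_def)

lemma hfib_ops: "cmp (hfib X Y f y) (q', b, r) (p, a, q) = (p, cmp X b a, r)"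
  "idn (hfib X Y f y) p = (p, idn X (fst p), p)"
  by (simp_all add: hfib_def Let_def)

lemma (in groupoid_map) groupoid_hfib: "groupoid (hfib X Y f y)"
proof
  let ?P = "hfib X Y f y"
  fix e assume "e \<in> arrs ?P"
  then show "src ?P e \<in> objs ?P" "tgt ?P e \<in> objs ?P"
    by (auto simp: hfib_def Let_def)
next
  let ?P = "hfib X Y f y"
  have mem: "p \<in> objs ?P \<longleftrightarrow> fst p \<in> objs X \<and> snd p \<in> homs Y (fobj f (fst p)) y" for p
    by (cases p) (simp add: objs_hfib)
  show "idn ?P p \<in> homs ?P p p" if "p \<in> objs ?P" for p
    using that by (simp add: mem_homs_hfib hfib_ops mem X.idn_hom farr_idn Y.cmp_idn_right[of "snd p" _ y])
  fix e p q assume "e \<in> homs ?P p q"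
  then obtain a where a: "e = (p, a, q)" "p \<in> objs ?P" "q \<in> objs ?P" "a \<in> homs X (fst p) (fst q)"
    "cmp Y (snd q) (farr f a) = snd p" by (auto simp: mem_homs_hfib)
  note fa = farr[OF a(4)]
  show "cmp ?P e (idn ?P p) = e" "cmp ?P (idn ?P q) e = e"
    using a X.cmp_idn_right X.cmp_idn_left by (simp_all add: hfib_ops)
  show "\<exists>e'\<in>homs ?P q p. cmp ?P e' e = idn ?P p \<and> cmp ?P e e' = idn ?P q"
  proof -
    obtain b where b: "b \<in> homs X (fst q) (fst p)" "cmp X b a = idn X (fst p)" "cmp X a b = idn X (fst q)"
      using X.inverse[OF a(4)] by blast
    \<comment> \<open>The inverse of \<open>a\<close> in \<open>X\<close> is also a morphism of the
      fibre: composing the structure map at \<open>p\<close> with \<open>f(b)\<close> cancels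
      \<open>f(a)\<close> against \<open>f(b)\<close>.\<close>
    have "cmp Y (snd p) (farr f b) = cmp Y (snd q) (cmp Y (farr f a) (farr f b))"
      using a(5) Y.cmp_assoc[OF farr[OF b(1)] fa, of "snd q" y] a(3) by (simp add: mem)
    also have "\<dots> = snd q"
      using b(3) a(3)
      by (simp add: mem farr_cmp[OF b(1) a(4), symmetric] farr_idn Y.cmp_idn_right[of "snd q" _ y])
    finally show ?thesis
      using a b by (intro bexI[of _ "(q, b, p)"]) (simp_all add: hfib_ops mem_homs_hfib)
  qed
  fix e' r assume "e' \<in> homs ?P q r"
  then obtain b where b: "e' = (q, b, r)" "r \<in> objs ?P" "b \<in> homs X (fst q) (fst r)"
    "cmp Y (snd r) (farr f b) = snd q" by (auto simp: mem_homs_hfib)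
  have "cmp Y (snd r) (farr f (cmp X b a)) = snd p"
    using Y.cmp_assoc[OF fa farr[OF b(3)], of "snd r" y] b a farr_cmp[OF a(4) b(3)] by (simp add: mem)
  then show "cmp ?P e' e \<in> homs ?P p r"
    using a b X.cmp_hom[OF a(4) b(3)] by (simp add: hfib_ops mem_homs_hfib)
  fix e'' s assume "e'' \<in> homs ?P r s"
  then obtain d where "e'' = (r, d, s)" "d \<in> homs X (fst r) (fst s)" by (auto simp: mem_homs_hfib)
  then show "cmp ?P e'' (cmp ?P e' e) = cmp ?P (cmp ?P e'' e') e"
    using a b X.cmp_assoc[OF a(4) b(3)] by (simp add: hfib_ops)
qed

section \<open>Automorphisms in the homotopy fibre and the scalars they produce\<close>

context kan_at
begin

abbreviation "ker x \<equiv> kernel (H x) (aut_group Y (fobj f x)) (farr f)"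
abbreviation "Py \<equiv> hfib X Y f y"

text \<open>\<open>Y\<close> is skeletal, so an arrow from \<open>f x\<close> to \<open>y\<close>
  forces \<open>f x = y\<close>; the homotopy fibre then has the objects of the strict fibre, paired
  with elements of \<open>A_y\<close>.\<close>

lemma objs_Py: "(x, h) \<in> objs Py \<longleftrightarrow> x \<in> I \<and> h \<in> Ay"
proof -
  have "fobj f x = y" if "h \<in> homs Y (fobj f x) y"
    using that skeletal_Y by (auto simp: skeletal_def homs_def)
  then show ?thesis by (auto simp: objs_hfib obj_fibre_def)
qed

text \<open>An automorphism of \<open>(x, h)\<close> is an \<open>a\<close> with
  \<open>h f(a) = h\<close>, and \<open>h\<close> can be cancelled.\<close>

lemma homs_Py:
  assumes "x \<in> I" "h \<in> Ay"
  shows "homs Py (x, h) (x, h) = (\<lambda>a. ((x, h), a, (x, h))) ` ker x"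
proof -
  have "cmp Y h (farr f a) = h \<longleftrightarrow> farr f a = \<one>\<^bsub>G\<^esub>" if "a \<in> Ax x" for a
    using G.G.l_cancel_one[of h "farr f a"] assms(2) farr_G[OF assms(1) that] by (simp add: mult_aut)
  then show ?thesis
    using assms G.G.r_one[of h] by (auto simp: mem_homs_hfib objs_Py kernel_def I_D mult_aut)
qed

lemma card_homs_Py: "x \<in> I \<Longrightarrow> h \<in> Ay \<Longrightarrow> card (homs Py (x, h) (x, h)) = card (ker x)"
  unfolding homs_Py by (rule card_image) (auto intro: inj_onI)

lemma finite_ker: "x \<in> I \<Longrightarrow> finite (ker x)"
  using finite_group_algebra.fin[OF H] by (simp add: kernel_def)

lemma card_ker_pos:
  assumes "x \<in> I"
  shows "card (ker x) > 0"
proof -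
  have "idn X x \<in> ker x"
    using XF.idn_hom fmap.farr_idn I_D[OF assms] by (simp add: kernel_def one_aut)
  then show ?thesis using finite_ker[OF assms] by (auto simp: card_gt_0_iff)
qed

lemma card_aut: "x \<in> I \<Longrightarrow> card (Ax x) = card (farr f ` Ax x) * card (ker x)"
  using group_hom_card[OF group_hom_farr] finite_group_algebra.fin[OF H] by (simp add: I_D)

text \<open>The base point chosen by \<open>SOME\<close> may carry another \<open>h\<close>, but
  \<open>X\<close> is skeletal, so it lies over the same \<open>x\<close>. Its automorphism count is
  the order of the same kernel, and the choice has no effect.\<close>

lemma delta_unit_eq:
  assumes "x \<in> I" "h \<in> Ay" "k \<in> carrier K"
  shows "delta_unit K X Y f y (x, h) k = nat_scalar K (card (ker x)) \<otimes>\<^bsub>K\<^esub> k"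
proof -
  interpret P: groupoid Py by (rule fmap.groupoid_hfib)
  define q where "q = (SOME q. q \<in> iso_class Py (x, h))"
  have "(x, h) \<in> iso_class Py (x, h)"
    using assms P.idn_hom[of "(x, h)"] by (auto simp: iso_class_def objs_Py)
  then have "q \<in> iso_class Py (x, h)" unfolding q_def by (rule someI)
  then obtain e where q: "q \<in> objs Py" and e: "e \<in> homs Py (x, h) q" by (auto simp: iso_class_def)
  from e obtain a where "a \<in> homs X x (fst q)" by (auto simp: mem_homs_hfib)
  then have "fst q = x"
    using skeletal_X by (auto simp: skeletal_def homs_def)
  then obtain h' where q': "q = (x, h')" by (cases q) auto
  then have h': "h' \<in> Ay" using q by (simp add: objs_Py)
  have "finite (homs Py q q)"
    unfolding q' homs_Py[OF assms(1) h'] using finite_ker[OF assms(1)] by simp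
  from P.unit_endo_eq[OF K.field_axioms char_zero q this assms(3)]
  show ?thesis
    unfolding delta_unit_def q_def[symmetric] by (simp add: q' card_homs_Py[OF assms(1) h'])
qed

lemma nat_scalar_closed: "nat_scalar K n \<in> carrier K"
  using K.add.nat_pow_closed by simp

context
  fixes V :: "('x,'a,'k,'v) rep"
  assumes V: "rep_on K X V"
begin

lemma delta_pullback_eq:
  assumes "x \<in> I" "h \<in> Ay" "v \<in> carrier (ob V x)"
  shows "delta_pullback K X Y f V y (x, h) v = nat_scalar K (card (ker x)) \<odot>\<^bsub>ob V x\<^esub> v"
proof -
  note mV = module_at[OF V assms(1)]
  let ?n = "nat_scalar K (card (ker x))"
  have d: "delta_unit K X Y f y (x, h) \<in> lin_maps K self self"
    by (rule lin_cong[OF lin_scale[OF module_self_K lin_ident nat_scalar_closed[of "card (ker x)"]]])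
      (simp_all add: self_module_simps delta_unit_eq[OF assms(1,2)] module_self_K)
  have one: "\<one>\<^bsub>K\<^esub> \<in> carrier self" by (simp add: self_module_simps)
  have "delta_pullback K X Y f V y (x, h) v =
      unitor_l K (ob V x) (tensor_map K self (ob V x) (delta_unit K X Y f y (x, h)) (\<lambda>v. v)
        (pure_tensor K self (ob V x) \<one>\<^bsub>K\<^esub> v))"
    by (simp add: delta_pullback_def unitor_l_inv_def)
  also have "\<dots> = unitor_l K (ob V x) (pure_tensor K self (ob V x) ?n v)"
    using tensor_map_linear(2)[OF module_self_K mV module_self_K mV d lin_ident one assms(3)]
      delta_unit_eq[OF assms(1,2) K.one_closed] nat_scalar_closed by simp
  also have "\<dots> = ?n \<odot>\<^bsub>ob V x\<^esub> v"
    by (rule unitor_l_pure[OF mV assms(3) nat_scalar_closed])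
  finally show ?thesis .
qed

text \<open>Stated for arbitrary scalars \<open>k x\<close>, so that it evaluates both
  \<open>\<delta>\<close> and its inverse. Uniqueness for the definite description holds because the
  cocone elements \<open>h \<otimes> v\<close> generate \<open>f_!V(y)\<close>.\<close>

lemma colim_endo_scalar:
  assumes s: "\<And>x h v. x \<in> I \<Longrightarrow> h \<in> Ay \<Longrightarrow> v \<in> carrier (ob V x) \<Longrightarrow> s (x, h) v = k x \<odot>\<^bsub>ob V x\<^esub> v"
    and k: "\<And>x. x \<in> I \<Longrightarrow> k x \<in> carrier K" and t: "t \<in> carrier (lan V)"
  shows "colim_endo K X Y f V y s t = (\<lambda>x\<in>I. k x \<odot>\<^bsub>ind V x\<^esub> t x)"
proof -
  \<comment> \<open>Restricted to the carrier because \<open>colim_endo\<close> selects an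
    extensional map.\<close>
  define D where "D = (\<lambda>t\<in>carrier (lan V). \<lambda>x\<in>I. k x \<odot>\<^bsub>ind V x\<^esub> t x)"
  note mL = module_lan[OF V]
  have "(\<lambda>t. \<lambda>x\<in>I. k x \<odot>\<^bsub>ind V x\<^esub> t x) \<in> lin_maps K (lan V) (lan V)"
    unfolding lan_eq_dsum[OF V]
  proof (rule dsum_lin_into)
    fix x assume x: "x \<in> I"
    have "(\<lambda>t. k x \<odot>\<^bsub>ind V x\<^esub> t x) \<in> lin_maps K (dsum I (ind V)) (ind V x)"
      by (rule lin_scale[OF module_ind[OF V x] dsum_proj_linear[where M = "ind V", OF x] k[OF x]])
    then show "(\<lambda>t. (\<lambda>x\<in>I. k x \<odot>\<^bsub>ind V x\<^esub> t x) x) \<in> lin_maps K (dsum I (ind V)) (ind V x)"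
      using x by simp
  qed (use mL in \<open>simp_all add: lan_eq_dsum[OF V]\<close>)
  then have D_lin: "D \<in> lin_maps K (lan V) (lan V)"
    by (rule lin_cong) (simp_all add: D_def mL)
  have D_ext: "D \<in> extensional (carrier (lan V))" by (simp add: D_def)
  have Dv: "D (linj V x (\<delta> h) v) = linj V x (\<delta> h) (s (x, h) v)"
    if x: "x \<in> I" and h: "h \<in> Ay" and v: "v \<in> carrier (ob V x)" for x h v
  proof -
    have "D (linj V x (\<delta> h) v) = (\<lambda>x'\<in>I. k x' \<odot>\<^bsub>ind V x'\<^esub> linj V x (\<delta> h) v x')"
      using lan_inj_closed[OF V x h v] by (simp add: D_def)
    also have "\<dots> = dsum_inj I (ind V) x (k x \<odot>\<^bsub>ind V x\<^esub> ipure V x (\<delta> h) v)"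
      unfolding lan_inj_eq[OF V x] dsum_inj_def
      by (rule restrict_ext) (use module.smult_r_null[OF module_ind[OF V]] k in auto)
    also have "k x \<odot>\<^bsub>ind V x\<^esub> ipure V x (\<delta> h) v = ipure V x (\<delta> h) (k x \<odot>\<^bsub>ob V x\<^esub> v)"
      using lin_smult[OF bilinear_right[OF ind_pure_bilinear[OF V x] G.basis_kG] k[OF x] v] h by simp
    finally show ?thesis unfolding s[OF x h v] lan_inj_eq[OF V x] .
  qed
  have "colim_endo K X Y f V y s = D"
    unfolding colim_endo_def Let_def
  proof (rule the_equality)
    show "D \<in> lin_maps K (lan V) (lan V) \<inter> extensional (carrier (lan V)) \<and>
      (\<forall>(x, h)\<in>objs Py. \<forall>v\<in>carrier (ob V x). D (linj V x (\<delta> h) v) = linj V x (\<delta> h) (s (x, h) v))"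
      using D_lin Dv D_ext by (auto simp: objs_Py)
    fix D' assume D': "D' \<in> lin_maps K (lan V) (lan V) \<inter> extensional (carrier (lan V)) \<and>
      (\<forall>(x, h)\<in>objs Py. \<forall>v\<in>carrier (ob V x). D' (linj V x (\<delta> h) v) = linj V x (\<delta> h) (s (x, h) v))"
    then have D'v: "D' (linj V x (\<delta> h) v) = linj V x (\<delta> h) (s (x, h) v)"
      if "x \<in> I" "h \<in> Ay" "v \<in> carrier (ob V x)" for x h v
      using that by (fastforce simp: objs_Py)
    show "D' = D"
    proof (rule extensionalityI[where A = "carrier (lan V)"])
      fix t assume t: "t \<in> carrier (lan V)"
      show "D' t = D t"
        by (rule lin_eq_lan[OF V mL _ D_lin _ t]) (use D' Dv D'v in auto)
    qed (use D' D_ext in auto)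
  qed
  then show ?thesis using t by (simp add: D_def)
qed

lemma delta_lan_formula:
  assumes "t \<in> carrier (lan V)"
  shows "delta_lan K X Y f V y t = (\<lambda>x\<in>I. nat_scalar K (card (ker x)) \<odot>\<^bsub>ind V x\<^esub> t x)"
  unfolding delta_lan_def
  by (rule colim_endo_scalar[OF delta_pullback_eq nat_scalar_closed assms])

lemma nakayama_formula:
  assumes \<phi>: "\<phi> \<in> carrier (rkan V)"
  shows "nakayama K X Y f V y \<phi> = (\<lambda>x\<in>I. inv\<^bsub>K\<^esub> (nat_scalar K (card (Ax x))) \<odot>\<^bsub>ind V x\<^esub>
     (\<Oplus>\<^bsub>ind V x\<^esub>g\<in>Ay. ipure V x (\<delta> (inv\<^bsub>G\<^esub> g)) (\<phi> x (\<delta> g))))"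
proof -
  let ?n = "\<lambda>x. nat_scalar K (card (ker x))"
  let ?s = "\<lambda>p. inv_into (carrier (ob V (fst p))) (delta_pullback K X Y f V y p)"
  let ?sum = "\<lambda>x. \<Oplus>\<^bsub>ind V x\<^esub>g\<in>Ay. ipure V x (\<delta> (inv\<^bsub>G\<^esub> g)) (\<phi> x (\<delta> g))"
  have nU: "?n x \<in> Units K" if "x \<in> I" for x
    using nat_scalar_nonzero[OF card_ker_pos[OF that]] .
  \<comment> \<open>On \<open>V(x)\<close> the map \<open>\<delta>\<close> is multiplication by the
    order of the kernel, a unit of \<open>K\<close>, so \<open>inv_into\<close> is multiplication by
    the inverse scalar.\<close>
  have s: "?s (x, h) v = inv\<^bsub>K\<^esub> (?n x) \<odot>\<^bsub>ob V x\<^esub> v"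
    if x: "x \<in> I" and h: "h \<in> Ay" and v: "v \<in> carrier (ob V x)" for x h v
  proof -
    interpret M: module K "ob V x" by (rule module_at[OF V x])
    have inv: "inv\<^bsub>K\<^esub> (?n x) \<odot>\<^bsub>ob V x\<^esub> (?n x \<odot>\<^bsub>ob V x\<^esub> u) = u"
      "?n x \<odot>\<^bsub>ob V x\<^esub> (inv\<^bsub>K\<^esub> (?n x) \<odot>\<^bsub>ob V x\<^esub> u) = u" if "u \<in> carrier (ob V x)" for u
      using that nU[OF x] by (simp_all add: M.smult_assoc1[symmetric] nat_scalar_closed)
    have inj: "inj_on (delta_pullback K X Y f V y (x, h)) (carrier (ob V x))"
      by (rule inj_on_inverseI[of _ "\<lambda>u. inv\<^bsub>K\<^esub> (?n x) \<odot>\<^bsub>ob V x\<^esub> u"])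
        (simp add: delta_pullback_eq[OF x h] inv)
    have iv: "inv\<^bsub>K\<^esub> (?n x) \<odot>\<^bsub>ob V x\<^esub> v \<in> carrier (ob V x)" using nU[OF x] v by simp
    show ?thesis
      using inv_into_f_f[OF inj iv] by (simp add: delta_pullback_eq[OF x h iv] inv v)
  qed
  have pre: "pre_nakayama K X Y f V y \<phi> \<in> carrier (lan V)"
  proof -
    interpret L: module K "lan V" by (rule module_lan[OF V])
    show ?thesis
      unfolding pre_nakayama_sum[OF V \<phi>] using avg_term_closed[OF V \<phi>] by (intro L.finsum_closed) blast
  qed
  have "nakayama K X Y f V y \<phi> = (\<lambda>x\<in>I. inv\<^bsub>K\<^esub> (?n x) \<odot>\<^bsub>ind V x\<^esub> pre_nakayama K X Y f V y \<phi> x)"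
    unfolding nakayama_def comp_def
    by (rule colim_endo_scalar[OF s _ pre]) (use nU in auto)
  also have "\<dots> = (\<lambda>x\<in>I. inv\<^bsub>K\<^esub> (nat_scalar K (card (Ax x))) \<odot>\<^bsub>ind V x\<^esub> ?sum x)"
  proof (rule restrict_ext)
    fix x assume x: "x \<in> I"
    interpret J: module K "ind V x" by (rule module_ind[OF V x])
    have sum: "?sum x \<in> carrier (ind V x)"
    proof (rule J.finsum_closed, rule Pi_I)
      fix g assume g: "g \<in> Ay"
      show "ipure V x (\<delta> (inv\<^bsub>G\<^esub> g)) (\<phi> x (\<delta> g)) \<in> carrier (ind V x)"
        using bilinear_closed[OF ind_pure_bilinear[OF V x] G.basis_kG phi_closed[OF V \<phi> x g]] inv_homs[OF g]
        by simp
    qed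
    let ?m = "nat_scalar K (card (farr f ` Ax x))"
    have mU: "?m \<in> Units K" using nat_scalar_nonzero[OF card_image_pos[OF x]] .
    have "nat_scalar K (card (Ax x)) = ?m \<otimes>\<^bsub>K\<^esub> ?n x"
      unfolding card_aut[OF x]
      by (simp add: K.add_pow_ldistr nat_scalar_closed K.add.nat_pow_pow mult.commute)
    moreover have "inv\<^bsub>K\<^esub> (?m \<otimes>\<^bsub>K\<^esub> ?n x) = inv\<^bsub>K\<^esub> (?n x) \<otimes>\<^bsub>K\<^esub> inv\<^bsub>K\<^esub> ?m"
      by (rule K.comm_inv_char)
        (use mU nU[OF x] K.m_lcomm[of ?m "inv\<^bsub>K\<^esub> (?n x)"] in
          \<open>simp_all add: nat_scalar_closed K.m_assoc, simp add: K.m_assoc[symmetric] nat_scalar_closed\<close>)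
    ultimately show "inv\<^bsub>K\<^esub> (?n x) \<odot>\<^bsub>ind V x\<^esub> pre_nakayama K X Y f V y \<phi> x =
        inv\<^bsub>K\<^esub> (nat_scalar K (card (Ax x))) \<odot>\<^bsub>ind V x\<^esub> ?sum x"
      using x sum mU nU[OF x] by (simp add: pre_nakayama_formula[OF V \<phi>] J.smult_assoc1)
  qed
  finally show ?thesis .
qed

end

end

lemma (in vect_rep) rep_on: "rep_on K X V"
  unfolding rep_on_def group_rep_def
  using ob_module act_lin act_idn act_cmp by (simp add: one_aut mult_aut)

theorem theorem6p3:
  fixes K :: "('k,'r) ring_scheme"
    and X :: "('x,'a) groupoid_data" and Y :: "('y,'b) groupoid_data"
    and f :: "('x,'a,'y,'b) gmap" and V :: "('x,'a,'k,'v) rep"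
  assumes "field K" and "char_zero K"
    and "ess_finite_groupoid X" and "skeletal X"
    and "ess_finite_groupoid Y" and "skeletal Y"
    and "groupoid_map X Y f"
    and "vect_rep X K V"
  shows "(\<forall>y\<in>objs Y. \<forall>\<phi>\<in>carrier (ob (right_kan K X Y f V) y).
      pre_nakayama K X Y f V y \<phi> =
        (\<lambda>x\<in>obj_fibre X f y.
          inv\<^bsub>K\<^esub> (nat_scalar K (card (farr f ` carrier (aut_group X x))))
            \<odot>\<^bsub>ind_summand K X Y f V x\<^esub>
          (\<Oplus>\<^bsub>ind_summand K X Y f V x\<^esub>g\<in>carrier (aut_group Y y).
             ind_pure K X Y f V x (basis_elt K (inv\<^bsub>aut_group Y y\<^esub> g)) (\<phi> x (basis_elt K g)))))
    \<and> (\<forall>y\<in>objs Y. \<forall>t\<in>carrier (ob (left_kan K X Y f V) y).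
      delta_lan K X Y f V y t =
        (\<lambda>x\<in>obj_fibre X f y.
          nat_scalar K (card (kernel (aut_group X x) (aut_group Y (fobj f x)) (farr f)))
            \<odot>\<^bsub>ind_summand K X Y f V x\<^esub> t x))
    \<and> (\<forall>y\<in>objs Y. \<forall>\<phi>\<in>carrier (ob (right_kan K X Y f V) y).
      nakayama K X Y f V y \<phi> =
        (\<lambda>x\<in>obj_fibre X f y.
          inv\<^bsub>K\<^esub> (nat_scalar K (card (carrier (aut_group X x))))
            \<odot>\<^bsub>ind_summand K X Y f V x\<^esub>
          (\<Oplus>\<^bsub>ind_summand K X Y f V x\<^esub>g\<in>carrier (aut_group Y y).
             ind_pure K X Y f V x (basis_elt K (inv\<^bsub>aut_group Y y\<^esub> g)) (\<phi> x (basis_elt K g)))))"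
proof -
  interpret kan X Y f K
    using assms by (simp add: kan_def kan_axioms_def)
  have V: "rep_on K X V" by (rule vect_rep.rep_on[OF assms(8)])
  show ?thesis
    using kan_at.pre_nakayama_formula[OF kan_atI V] kan_at.delta_lan_formula[OF kan_atI V]
      kan_at.nakayama_formula[OF kan_atI V]
    by simp
qed

end
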